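(* Let $W \subset \mathbb{R}^{3}$ be a $2$-plane which is not a subspace (that is, an affine $2$-plane with $0 \notin W$), and let $S_{W} := S^{2} \cap W$. If $K \subset \mathbb{R}^{3}$ is a Borel set, then $$\dim_{\mathrm{H}} \pi_{e}(K) \geq \min\left\{\dim_{\mathrm{H}} K,\; 1 + \tfrac{1}{3}\dim_{\mathrm{H}} K\right\}$$ for $\mathcal{H}^{1}$ almost every $e \in S_{W}$. In particular, if $K \subset \mathbb{R}^{3}$ is a Borel set with $\dim_{\mathrm{H}} K \leq \tfrac{3}{2}$, then $\dim_{\mathrm{H}} \pi_{e}(K) = \dim_{\mathrm{H}} K$ for $\mathcal{H}^{1}$ almost every $e \in S_{W}$.
   Context: $S^{2}$ is the unit sphere in $\mathbb{R}^{3}$. For $e \in S^{2}$, $\pi_{e} \colon \mathbb{R}^{3} \to e^{\perp}$ is the orthogonal projection onto the plane $e^{\perp} = \{v \in \mathbb{R}^3 : v \cdot e = 0\}$. $\dim_{\mathrm{H}}$ denotes Hausdorff dimension and $\mathcal{H}^{1}$ denotes $1$-dimensional Hausdorff measure. *)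

theory Defs
  imports "HOL-Analysis.Analysis"
begin

text \<open>
  The weight \<open>diam(U)^s\<close>, with the usual conventions \<open>diam({})^s = 0\<close> and \<open>diam(U)^0 = 1\<close>
  for nonempty \<open>U\<close>.  The case \<open>s = 0\<close> is separated because \<open>0 powr 0 = 0\<close> in HOL.
\<close>

definition diam_pow :: "real \<Rightarrow> 'a::metric_space set \<Rightarrow> ennreal" where
  "diam_pow s U =
     (if U = {} then 0 else if s = 0 then 1 else ennreal (diameter U powr s))"

text \<open>
  Boundedness of the covering sets is required explicitly because \<^const>\<open>diameter\<close> is real-valued
  and carries no information on unbounded sets.  The covering sets may be empty, so finite
  covers are included.
\<close>

definition hausdorff_premeasure :: "real \<Rightarrow> real \<Rightarrow> 'a::metric_space set \<Rightarrow> ennreal" where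
  "hausdorff_premeasure s \<delta> A =
     (INF U \<in> {U :: nat \<Rightarrow> 'a set. A \<subseteq> (\<Union>n. U n) \<and> (\<forall>n. bounded (U n) \<and> diameter (U n) \<le> \<delta>)}.
        (\<Sum>n. diam_pow s (U n)))"

text \<open>
  The \<open>s\<close>-dimensional Hausdorff (outer) measure, without a normalising constant, for \<open>s \<ge> 0\<close>.
\<close>

definition hausdorff_measure :: "real \<Rightarrow> 'a::metric_space set \<Rightarrow> ennreal" where
  "hausdorff_measure s A = (SUP \<delta> \<in> {0<..}. hausdorff_premeasure s \<delta> A)"

text \<open>The infimum is taken in \<^typ>\<open>ennreal\<close>, hence is \<open>\<infinity>\<close> if no such \<open>s\<close> exists.\<close>

definition hausdorff_dim :: "'a::metric_space set \<Rightarrow> ennreal" where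
  "hausdorff_dim A = (INF s \<in> {s. 0 \<le> s \<and> hausdorff_measure s A = 0}. ennreal s)"

definition orth_proj :: "'a::real_inner set \<Rightarrow> 'a \<Rightarrow> 'a" where
  "orth_proj V x = (THE w. w \<in> V \<and> (\<forall>v\<in>V. orthogonal (x - w) v))"

definition proj_perp :: "'a::real_inner \<Rightarrow> 'a \<Rightarrow> 'a" where
  "proj_perp e = orth_proj {v. v \<bullet> e = 0}"

lemma proj_perp_eq:
  assumes "norm e = 1"
  shows "proj_perp e x = x - (x \<bullet> e) *\<^sub>R e"
proof -
  have ee: "e \<bullet> e = 1"
    using assms by (simp add: dot_square_norm)
  show ?thesis
    unfolding proj_perp_def orth_proj_def
  proof (rule the_equality)
    show "x - (x \<bullet> e) *\<^sub>R e \<in> {v. v \<bullet> e = 0} \<and>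
      (\<forall>v\<in>{v. v \<bullet> e = 0}. orthogonal (x - (x - (x \<bullet> e) *\<^sub>R e)) v)"
      using ee by (auto simp: orthogonal_def inner_diff_left inner_diff_right inner_commute)
  next
    fix w
    assume w: "w \<in> {v. v \<bullet> e = 0} \<and> (\<forall>v\<in>{v. v \<bullet> e = 0}. orthogonal (x - w) v)"
    define d where "d = w - (x - (x \<bullet> e) *\<^sub>R e)"
    have d: "d \<bullet> e = 0"
      using w ee by (simp add: d_def inner_diff_left)
    then have "(x - w) \<bullet> d = 0"
      using w by (auto simp: orthogonal_def)
    moreover have "x - w = (x \<bullet> e) *\<^sub>R e - d"
      by (simp add: d_def)
    ultimately have "d \<bullet> d = 0"
      using d by (simp add: inner_diff_left inner_diff_right inner_commute)
    then show "w = x - (x \<bullet> e) *\<^sub>R e"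
      by (simp add: d_def)
  qed
qed

end

theory Submission
  imports Defs
begin

text \<open>
  The directions in \<open>S_W\<close> lie on a circle that spans a cone \<open>Q = 0\<close>, and two points \<open>p\<close>, \<open>q\<close> have the
  same image under some \<open>\<pi>_e\<close> iff \<open>p - q\<close> is a multiple of a direction, in particular \<open>Q (p - q) = 0\<close>;
  identifying points of space with circles in the plane, this is tangency. Fix \<open>t < min s (1 + s/3)\<close>
  with \<open>s < dim K\<close> and a Frostman measure \<open>\<mu>\<close> of exponent \<open>s\<close> on \<open>K\<close>. If \<open>\<pi>_e K\<close> is \<open>t\<close>-null, then at
  arbitrarily fine scales \<open>\<delta>\<close> about \<open>\<delta>^(-t)\<close> tubes in direction \<open>e\<close> carry at least \<open>\<delta>^\<eta>\<close> of \<open>\<mu>\<close>, so a typical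
  \<open>q\<close> has mass about \<open>\<delta>^t\<close> within \<open>\<delta>\<close> of the line \<open>q + \<real> e\<close>, at some popular distance \<open>d\<close>. If this happens
  at scale \<open>\<delta>\<close> for nearly \<open>1/\<delta>\<close> separated directions, a typical \<open>q\<close> is tangent, in three transversal
  directions, to triples \<open>(p1, p2, p3)\<close> of total weight about \<open>\<delta>^(3 (t - 1))\<close>. Conversely a triple at mutual
  distance \<open>d\<close> is tangent to at most about \<open>d^(-3)\<close> triples of directions for each \<open>q\<close>, and, by a three circle
  lemma, the admissible \<open>q\<close> lie in few balls of radius about \<open>\<delta>\<close>; this gives the bound
  \<open>d^(2 s - 3) \<delta>^s\<close>, whose maximum over \<open>\<delta> \<le> d \<le> 1\<close> contradicts the choice of \<open>t\<close>. Hence the directions that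
  are bad at scale \<open>\<delta>\<close> form a set of length at most a positive power of \<open>\<delta>\<close>, and Borel-Cantelli over dyadic
  scales concludes.
\<close>

section \<open>Hausdorff measure\<close>

text \<open>The minimum in the theorem comes from the bound \<delta>^(3 (t - 1)) \<le> d^(2 s - 3)
  \<delta>^s, where d^(2 s) is the mass of the pairs (p2, p3) near p1. If s \<ge> 3/2 the worst
  distance is d = 1 and the bound forces t \<ge> 1 + s/3; if s < 3/2 it is d = \<delta> and forces t
  \<ge> s, up to small losses. A main obstacle is that an efficient cover of \<pi>_e K mixes scales
  in a way that depends on e. Pigeonholing mass over levels needs a finest level, hence compactness,
  while K is only Borel. So a compact K' in K, the same for all directions, is obtained by
  capacitability of a net content. Masses are recorded on dyadic cells only, and every later count
  is a finite sum. The three circle lemma is local: it compares points q, q' that are already within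
  about d \<rho>^2 of each other, \<rho> being the separation of the directions. Passing to all q
  costs powers of 1/\<rho>, which is harmless for \<rho> = \<delta>^(4 \<eta>). The lemma rests on
  nondegeneracy of Q, and there the plane has to miss the origin.\<close>

lemma dyadic_bracket:
  fixes r :: real
  assumes "0 < r" "r \<le> 1"
  obtains m where "1 / 2 ^ Suc m < r" "r \<le> 1 / 2 ^ m"
proof -
  define m where "m = (LEAST m. 1 / 2 ^ Suc m < r)"
  obtain k where "(1/2) ^ k < r" using real_arch_pow_inv[OF assms(1), of "1/2"] by auto
  moreover have "1 / 2 ^ Suc k = (1/2) ^ k / (2::real)" by (simp add: power_one_over)
  ultimately have "1 / 2 ^ Suc k < r" using assms(1) by linarith
  then have m: "1 / 2 ^ Suc m < r" unfolding m_def by (rule LeastI)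
  have "r \<le> 1 / 2 ^ m"
  proof (cases m)
    case (Suc m')
    then have "\<not> 1 / 2 ^ Suc m' < r" unfolding m_def by (intro not_less_Least) simp
    then show ?thesis using Suc by simp
  qed (use assms in simp)
  with m show thesis by (rule that)
qed

lemma suminf_ennreal_geometric:
  assumes "0 \<le> e"
  shows "(\<Sum>n. ennreal (e * (1/2) ^ Suc n)) = ennreal e"
proof -
  have "(\<lambda>n. e * (1/2) ^ Suc n) sums (e * 1)" by (intro sums_mult power_half_series)
  then show ?thesis using assms by (intro suminf_ennreal_eq) auto
qed

lemma hausdorff_premeasure_le:
  assumes "A \<subseteq> (\<Union>n. U n)" "\<And>n. bounded (U n)" "\<And>n. diameter (U n) \<le> \<delta>"
  shows "hausdorff_premeasure s \<delta> A \<le> (\<Sum>n. diam_pow s (U n))"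
  unfolding hausdorff_premeasure_def using assms by (intro INF_lower) auto

lemma hausdorff_premeasure_approx:
  fixes A :: "'a::metric_space set"
  assumes "hausdorff_premeasure s \<delta> A < c"
  obtains U where "A \<subseteq> (\<Union>n. U n)" "\<And>n::nat. bounded (U n)" "\<And>n. diameter (U n) \<le> \<delta>"
    "(\<Sum>n. diam_pow s (U n)) < c"
  using assms unfolding hausdorff_premeasure_def INF_less_iff by auto

lemma hausdorff_premeasure_mono:
  "A \<subseteq> B \<Longrightarrow> hausdorff_premeasure s \<delta> A \<le> hausdorff_premeasure s \<delta> B"
  unfolding hausdorff_premeasure_def by (rule INF_superset_mono) auto

lemma hausdorff_premeasure_UN:
  fixes A :: "nat \<Rightarrow> 'a::metric_space set"
  shows "hausdorff_premeasure s \<delta> (\<Union>n. A n) \<le> (\<Sum>n. hausdorff_premeasure s \<delta> (A n))"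
proof (rule ennreal_le_epsilon)
  fix e :: real assume e: "0 < e" and fin: "(\<Sum>n. hausdorff_premeasure s \<delta> (A n)) < top"
  have fin1: "hausdorff_premeasure s \<delta> (A n) < top" for n
  proof -
    have "(\<Sum>i\<in>{n}. hausdorff_premeasure s \<delta> (A i)) \<le> (\<Sum>n. hausdorff_premeasure s \<delta> (A n))"
      by (rule sum_le_suminf) auto
    then show ?thesis using fin by (simp add: le_less_trans)
  qed
  have "\<exists>U. A n \<subseteq> (\<Union>m. U m) \<and> (\<forall>m::nat. bounded (U m) \<and> diameter (U m) \<le> \<delta>) \<and>
      (\<Sum>m. diam_pow s (U m)) \<le> hausdorff_premeasure s \<delta> (A n) + ennreal (e * (1/2)^Suc n)" for n
  proof -
    have "hausdorff_premeasure s \<delta> (A n) < hausdorff_premeasure s \<delta> (A n) + ennreal (e * (1/2)^Suc n)"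
      using fin1[of n] e ennreal_add_left_cancel_less[of "hausdorff_premeasure s \<delta> (A n)" 0 "ennreal (e * (1/2)^Suc n)"]
      by (simp add: less_top)
    then show ?thesis by (rule hausdorff_premeasure_approx) (auto intro: less_imp_le)
  qed
  then obtain U where U: "\<And>n. A n \<subseteq> (\<Union>m. U n m)" "\<And>n m::nat. bounded (U n m)" "\<And>n m. diameter (U n m) \<le> \<delta>"
      "\<And>n. (\<Sum>m. diam_pow s (U n m)) \<le> hausdorff_premeasure s \<delta> (A n) + ennreal (e * (1/2)^Suc n)"
    by metis
  define V where "V k = (case prod_decode k of (n, m) \<Rightarrow> U n m)" for k
  have "x \<in> (\<Union>k. V k)" if xA: "x \<in> A n" for x n
  proof -
    obtain m where "x \<in> U n m" using U(1)[of n] xA by blast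
    then have "x \<in> V (prod_encode (n, m))" by (simp add: V_def)
    then show ?thesis by blast
  qed
  then have "hausdorff_premeasure s \<delta> (\<Union>n. A n) \<le> (\<Sum>k. diam_pow s (V k))"
    by (intro hausdorff_premeasure_le) (auto simp: V_def U split: prod.split)
  also have "\<dots> = (\<Sum>k. (\<lambda>(n,m). diam_pow s (U n m)) (prod_decode k))"
    by (simp add: V_def case_prod_unfold)
  also have "\<dots> = (\<Sum>n. \<Sum>m. diam_pow s (U n m))"
    using suminf_ennreal_2dimen[of "\<lambda>n. \<Sum>m. diam_pow s (U n m)" "\<lambda>(n,m). diam_pow s (U n m)"]
    by (simp add: comp_def)
  also have "\<dots> \<le> (\<Sum>n. hausdorff_premeasure s \<delta> (A n) + ennreal (e * (1/2)^Suc n))"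
    by (intro suminf_le U) auto
  also have "\<dots> = (\<Sum>n. hausdorff_premeasure s \<delta> (A n)) + (\<Sum>n. ennreal (e * (1/2)^Suc n))"
    by (intro suminf_add[symmetric]) auto
  also have "(\<Sum>n. ennreal (e * (1/2)^Suc n)) = ennreal e"
    using e by (simp only: suminf_ennreal_geometric)
  finally show "hausdorff_premeasure s \<delta> (\<Union>n. A n) \<le> (\<Sum>n. hausdorff_premeasure s \<delta> (A n)) + ennreal e" .
qed

lemma hausdorff_measure_eq_0_iff:
  "hausdorff_measure s A = 0 \<longleftrightarrow> (\<forall>\<delta>>0. hausdorff_premeasure s \<delta> A = 0)"
  unfolding hausdorff_measure_def bot_ennreal[symmetric] SUP_bot_conv by auto

lemma hausdorff_measure_null_UN:
  fixes A :: "nat \<Rightarrow> 'a::metric_space set"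
  assumes "\<And>n. hausdorff_measure s (A n) = 0"
  shows "hausdorff_measure s (\<Union>n. A n) = 0"
  unfolding hausdorff_measure_eq_0_iff
proof (intro allI impI)
  fix \<delta> :: real assume "0 < \<delta>"
  then have "hausdorff_premeasure s \<delta> (A n) = 0" for n
    using assms[of n] by (simp add: hausdorff_measure_eq_0_iff)
  then show "hausdorff_premeasure s \<delta> (\<Union>n. A n) = 0"
    using hausdorff_premeasure_UN[of s \<delta> A] by simp
qed

lemma hausdorff_measure_null_countable_UN:
  assumes "countable I" "\<And>i. i \<in> I \<Longrightarrow> hausdorff_measure s (A i) = 0"
  shows "hausdorff_measure s (\<Union>i\<in>I. A i :: 'b::metric_space set) = 0"
proof (cases "I = {}")
  case True
  have "hausdorff_premeasure s \<delta> ({} :: 'b set) \<le> (\<Sum>n::nat. diam_pow s ({} :: 'b set))" if "\<delta> > 0" for \<delta>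
    by (rule hausdorff_premeasure_le) (use that in auto)
  then show ?thesis using True by (auto simp: hausdorff_measure_eq_0_iff diam_pow_def)
next
  case False
  then have "(\<Union>i\<in>I. A i) = (\<Union>n. A (from_nat_into I n))"
    using assms(1) range_from_nat_into[of I] by (metis image_image)
  then show ?thesis
    using hausdorff_measure_null_UN[of s "\<lambda>n. A (from_nat_into I n)"] assms(2) False
    by (simp add: from_nat_into)
qed

lemma hausdorff_measure_null_mono:
  "A \<subseteq> B \<Longrightarrow> hausdorff_measure s B = 0 \<Longrightarrow> hausdorff_measure s A = 0"
  unfolding hausdorff_measure_eq_0_iff by (metis hausdorff_premeasure_mono le_zero_eq)

lemma diam_pow_antimono:
  assumes "0 \<le> t" "t \<le> t'" "diameter U \<le> 1" "bounded U"
  shows "diam_pow t' U \<le> diam_pow t U"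
proof -
  have d: "0 \<le> diameter U" using assms by (simp add: diameter_ge_0)
  have "diameter U powr t' \<le> 1" if "0 \<le> t'" using powr_mono2[of t' "diameter U" 1] that d assms by simp
  moreover have "diameter U powr t' \<le> diameter U powr t"
    using powr_mono'[of t t' "diameter U"] d assms by simp
  ultimately show ?thesis using assms by (auto simp: diam_pow_def)
qed

lemma hausdorff_measure_null_mono_exponent:
  assumes "0 \<le> t" "t \<le> t'" "hausdorff_measure t A = 0"
  shows "hausdorff_measure t' A = 0"
  unfolding hausdorff_measure_eq_0_iff
proof (intro allI impI)
  fix \<delta> :: real assume \<delta>: "0 < \<delta>"
  \<comment> \<open>Covers at scale \<open>min \<delta> 1\<close> have diameters at most 1, where
    raising the exponent lowers the weight.\<close>
  have "hausdorff_premeasure t' \<delta> A \<le> hausdorff_premeasure t (min \<delta> 1) A"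
    unfolding hausdorff_premeasure_def[of t]
  proof (rule INF_greatest)
    fix U :: "nat \<Rightarrow> 'a set"
    assume "U \<in> {U. A \<subseteq> (\<Union>n. U n) \<and> (\<forall>n. bounded (U n) \<and> diameter (U n) \<le> min \<delta> 1)}"
    then have U: "A \<subseteq> (\<Union>n. U n)" "\<And>n. bounded (U n)" "\<And>n. diameter (U n) \<le> \<delta>" "\<And>n. diameter (U n) \<le> 1"
      by auto
    have "hausdorff_premeasure t' \<delta> A \<le> (\<Sum>n. diam_pow t' (U n))"
      using U by (intro hausdorff_premeasure_le) auto
    also have "\<dots> \<le> (\<Sum>n. diam_pow t (U n))"
      using U assms by (intro suminf_le diam_pow_antimono) auto
    finally show "hausdorff_premeasure t' \<delta> A \<le> (\<Sum>n. diam_pow t (U n))" .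
  qed
  then show "hausdorff_premeasure t' \<delta> A = 0"
    using assms(3) \<delta> by (simp add: hausdorff_measure_eq_0_iff)
qed

lemma hausdorff_measure_nonzero_below_dim:
  assumes "0 \<le> s" "ennreal s < hausdorff_dim A"
  shows "hausdorff_measure s A \<noteq> 0"
  using assms unfolding hausdorff_dim_def by (metis (mono_tags, lifting) INF_lower mem_Collect_eq not_le)

lemma hausdorff_measure_null_above_dim:
  assumes "hausdorff_dim A < ennreal t"
  shows "hausdorff_measure t A = 0"
proof -
  obtain s where "0 \<le> s" "hausdorff_measure s A = 0" "ennreal s < ennreal t"
    using assms unfolding hausdorff_dim_def INF_less_iff by auto
  then show ?thesis using hausdorff_measure_null_mono_exponent[of s t A] by (simp add: ennreal_less_iff)
qed

lemma hausdorff_dim_contraction_le: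
  assumes f: "\<And>x y. dist (f x) (f y) \<le> dist x y"
  shows "hausdorff_dim (f ` A) \<le> hausdorff_dim A"
  unfolding hausdorff_dim_def
proof (rule INF_superset_mono)
  show "{s. 0 \<le> s \<and> hausdorff_measure s A = 0} \<subseteq> {s. 0 \<le> s \<and> hausdorff_measure s (f ` A) = 0}"
  proof safe
    fix s :: real assume s: "0 \<le> s" "hausdorff_measure s A = 0"
    have bdd: "bounded (f ` U)" if bU: "bounded U" for U
    proof -
      obtain x r where "\<forall>y\<in>U. dist x y \<le> r" using bU by (auto simp: bounded_def)
      then have "\<forall>y\<in>f ` U. dist (f x) y \<le> r" using f by (auto intro: order_trans[OF f])
      then show ?thesis unfolding bounded_def by blast
    qed
    have diam: "diameter (f ` U) \<le> diameter U" if "bounded U" for U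
    proof (cases "U = {}")
      case False
      have "dist (f x) (f y) \<le> diameter U" if "x \<in> U" "y \<in> U" for x y
        using f[of x y] diameter_bounded_bound[OF \<open>bounded U\<close> that] by linarith
      then have "(SUP (x, y) \<in> f ` U \<times> f ` U. dist x y) \<le> diameter U"
        using False by (intro cSUP_least) auto
      then show ?thesis using False by (simp add: diameter_def)
    qed simp
    show "hausdorff_measure s (f ` A) = 0"
      unfolding hausdorff_measure_eq_0_iff
    proof (intro allI impI)
      fix \<delta> :: real assume "0 < \<delta>"
      have "hausdorff_premeasure s \<delta> (f ` A) \<le> hausdorff_premeasure s \<delta> A"
        unfolding hausdorff_premeasure_def[of s \<delta> A]
      proof (rule INF_greatest)
        fix U :: "nat \<Rightarrow> 'a set"
        assume "U \<in> {U. A \<subseteq> (\<Union>n. U n) \<and> (\<forall>n. bounded (U n) \<and> diameter (U n) \<le> \<delta>)}"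
        then have U: "A \<subseteq> (\<Union>n. U n)" "\<And>n. bounded (U n)" "\<And>n. diameter (U n) \<le> \<delta>"
          by auto
        have "hausdorff_premeasure s \<delta> (f ` A) \<le> (\<Sum>n. diam_pow s (f ` U n))"
        proof (rule hausdorff_premeasure_le)
          show "f ` A \<subseteq> (\<Union>n. f ` U n)" using U(1) by blast
        qed (use U in \<open>auto intro: bdd order_trans[OF diam]\<close>)
        also have "\<dots> \<le> (\<Sum>n. diam_pow s (U n))"
          using U s diam bdd by (intro suminf_le) (auto simp: diam_pow_def diameter_ge_0 intro!: ennreal_leI powr_mono2)
        finally show "hausdorff_premeasure s \<delta> (f ` A) \<le> (\<Sum>n. diam_pow s (U n))" .
      qed
      then show "hausdorff_premeasure s \<delta> (f ` A) = 0"
        using s \<open>0 < \<delta>\<close> by (simp add: hausdorff_measure_eq_0_iff)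
    qed
  qed
qed simp

section \<open>Finite covers and a Borel-Cantelli lemma for length\<close>

lemma hausdorff_premeasure_finite_cover:
  assumes "finite I" "A \<subseteq> (\<Union>i\<in>I. B i)" "\<And>i. i \<in> I \<Longrightarrow> bounded (B i)"
    "\<And>i. i \<in> I \<Longrightarrow> diameter (B i) \<le> D" "D \<le> \<delta>" "0 \<le> D" "0 < s"
  shows "hausdorff_premeasure s \<delta> A \<le> ennreal (real (card I) * D powr s)"
proof -
  obtain g where g: "bij_betw g {..<card I} I"
    using \<open>finite I\<close> by (metis bij_betw_from_nat_into_finite)
  define U where "U n = (if n < card I then B (g n) else {})" for n
  have gI: "g n \<in> I" if "n < card I" for n using g that by (auto simp: bij_betw_def)
  have "A \<subseteq> (\<Union>n. U n)"
  proof
    fix x assume "x \<in> A"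
    then obtain i where i: "i \<in> I" "x \<in> B i" using assms by auto
    then have "i \<in> g ` {..<card I}" using g by (simp add: bij_betw_def)
    then obtain n where "n < card I" "g n = i" by auto
    then have "x \<in> U n" using i by (simp add: U_def)
    then show "x \<in> (\<Union>n. U n)" by blast
  qed
  then have "hausdorff_premeasure s \<delta> A \<le> (\<Sum>n. diam_pow s (U n))"
    using assms gI by (intro hausdorff_premeasure_le) (auto simp: U_def intro: order_trans[OF assms(4) assms(5)])
  also have "\<dots> = (\<Sum>n<card I. diam_pow s (U n))"
    by (rule suminf_finite) (auto simp: U_def diam_pow_def)
  also have "\<dots> \<le> (\<Sum>n<card I. ennreal (D powr s))"
    using assms gI by (intro sum_mono) (auto simp: U_def diam_pow_def diameter_ge_0 intro!: ennreal_leI powr_mono2)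
  also have "\<dots> = ennreal (real (card I) * D powr s)"
    by (simp add: ennreal_mult ennreal_of_nat_eq_real_of_nat)
  finally show ?thesis .
qed

text \<open>The convergence half of Borel-Cantelli: covering level j costs at most c 2^(-\<eta> j),
  and the tails of this geometric series tend to 0. Only covers of the \<open>F j\<close> enter, so
  it applies to arbitrary sets.\<close>

lemma hausdorff_measure_limsup_null:
  fixes E :: "'a::metric_space set" and c \<eta> :: real
  assumes "0 < \<eta>" "0 \<le> c"
    and cov: "\<And>J. E \<subseteq> (\<Union>j\<in>{J..}. F j)"
    and small: "\<And>j. J0 \<le> j \<Longrightarrow> \<exists>I (B :: nat \<Rightarrow> 'a set). finite I \<and> F j \<subseteq> (\<Union>i\<in>I. B i) \<and>
      (\<forall>i\<in>I. bounded (B i) \<and> diameter (B i) \<le> c / 2^j) \<and> real (card I) \<le> 2 powr (j * (1 - \<eta>))"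
  shows "hausdorff_measure 1 E = 0"
  unfolding hausdorff_measure_eq_0_iff
proof (intro allI impI)
  fix \<delta> :: real assume \<delta>: "0 < \<delta>"
  define q where "q = 2 powr (-\<eta>)"
  have q: "0 < q" "q < 1" using \<open>0 < \<eta>\<close> powr_less_mono[of "-\<eta>" 0 2] by (auto simp: q_def)
  have "(\<lambda>j. c * (1/2)^j) \<longlonglongrightarrow> 0"
    by (intro tendsto_mult_right_zero LIMSEQ_power_zero) auto
  then have lim: "(\<lambda>j. c / 2^j) \<longlonglongrightarrow> 0"
    by (simp add: power_one_over)
  then have "\<forall>\<^sub>F j in sequentially. c / 2^j < \<delta>" using \<delta> by (rule order_tendstoD)
  then obtain J1 where J1: "\<And>j. J1 \<le> j \<Longrightarrow> c / 2^j < \<delta>" by (auto simp: eventually_sequentially)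
  have one: "hausdorff_premeasure 1 \<delta> (F j) \<le> ennreal (c * q^j)" if j: "J0 \<le> j" "J1 \<le> j" for j
  proof -
    obtain I B where IB: "finite I" "F j \<subseteq> (\<Union>i\<in>I. (B :: nat \<Rightarrow> 'a set) i)"
      "\<And>i. i \<in> I \<Longrightarrow> bounded (B i) \<and> diameter (B i) \<le> c / 2^j" "real (card I) \<le> 2 powr (j * (1 - \<eta>))"
      using small[OF j(1)] by blast
    have "hausdorff_premeasure 1 \<delta> (F j) \<le> ennreal (real (card I) * (c / 2^j) powr 1)"
      using IB J1[OF j(2)] \<open>0 \<le> c\<close> by (intro hausdorff_premeasure_finite_cover[of I _ B]) auto
    also have "\<dots> \<le> ennreal (2 powr (j * (1 - \<eta>)) * (c / 2^j))"
      using IB \<open>0 \<le> c\<close> by (intro ennreal_leI mult_mono) auto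
    also have "2 powr (j * (1 - \<eta>)) * (c / 2^j) = c * q^j"
      by (simp add: q_def powr_powr powr_diff powr_minus powr_realpow[symmetric] algebra_simps divide_simps)
    finally show ?thesis .
  qed
  have bound: "hausdorff_premeasure 1 \<delta> E \<le> ennreal (c * q^J / (1 - q))" if J: "J0 \<le> J" "J1 \<le> J" for J
  proof -
    have "E \<subseteq> (\<Union>k. F (J + k))"
    proof
      fix x assume "x \<in> E"
      then obtain j where "J \<le> j" "x \<in> F j" using cov[of J] by auto
      then have "x \<in> F (J + (j - J))" by simp
      then show "x \<in> (\<Union>k. F (J + k))" by blast
    qed
    then have "hausdorff_premeasure 1 \<delta> E \<le> (\<Sum>k. hausdorff_premeasure 1 \<delta> (F (J + k)))"
      by (rule order_trans[OF hausdorff_premeasure_mono hausdorff_premeasure_UN])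
    also have "\<dots> \<le> (\<Sum>k. ennreal (c * q^(J+k)))"
      using J by (intro suminf_le one) auto
    also have "\<dots> = ennreal (c * q^J / (1 - q))"
    proof -
      have "(\<lambda>k. c * q^J * q^k) sums (c * q^J * (1 / (1 - q)))"
        using q by (intro sums_mult geometric_sums) auto
      then show ?thesis using q \<open>0 \<le> c\<close> by (intro suminf_ennreal_eq) (auto simp: power_add mult.assoc)
    qed
    finally show ?thesis .
  qed
  have "(\<lambda>J. ennreal (c * q^J / (1 - q))) \<longlonglongrightarrow> ennreal (c * 0 / (1 - q))"
    using q by (intro tendsto_intros LIMSEQ_power_zero) auto
  then have "hausdorff_premeasure 1 \<delta> E \<le> ennreal (c * 0 / (1 - q))"
    by (rule LIMSEQ_le_const) (use bound in \<open>auto intro!: exI[of _ "max J0 J1"]\<close>)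
  then show "hausdorff_premeasure 1 \<delta> E = 0" by simp
qed

section \<open>Net content\<close>

text \<open>\<open>f n x\<close> plays the role of the generation \<open>n\<close> cell containing
  \<open>x\<close>. Through \<open>par\<close> the cells form a tree, so two of them are nested or
  disjoint as point sets; this and a weight depending on the generation only is all that the content
  argument uses.\<close>

locale cell_tree =
  fixes f :: "nat \<Rightarrow> 'a \<Rightarrow> 'b" and par :: "'b \<Rightarrow> 'b" and w :: "nat \<Rightarrow> ennreal"
  assumes par_f: "par (f (Suc n) x) = f n x"
begin

lemma par_funpow_f: "(par ^^ k) (f (n + k) x) = f n x"
proof (induction k arbitrary: n)
  case (Suc k)
  have "(par ^^ Suc k) (f (n + Suc k) x) = par ((par ^^ k) (f (Suc n + k) x))"
    by simp
  then show ?case using Suc[of "Suc n"] par_f by simp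
qed simp

definition ancestor :: "nat \<times> 'b \<Rightarrow> nat \<times> 'b \<Rightarrow> bool" where
  "ancestor c c' \<longleftrightarrow> fst c \<le> fst c' \<and> snd c = (par ^^ (fst c' - fst c)) (snd c')"

lemma ancestor_refl: "ancestor c c"
  by (simp add: ancestor_def)

lemma ancestor_f: "m \<le> n \<Longrightarrow> ancestor (m, a) (n, f n x) \<longleftrightarrow> a = f m x"
  using par_funpow_f[of "n - m" m x] by (auto simp: ancestor_def)

definition covers :: "(nat \<times> 'b) set \<Rightarrow> 'a set \<Rightarrow> bool" where
  "covers C A \<longleftrightarrow> (\<forall>x\<in>A. \<exists>n. (n, f n x) \<in> C)"

lemma covers_mono: "covers C A \<Longrightarrow> C \<subseteq> D \<Longrightarrow> covers D A"
  unfolding covers_def by blast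

text \<open>Phrasing the sum of \<open>w\<close> over a family of cells as a density against
  counting measure yields monotonicity, modularity and continuity from below at once.\<close>

definition weight :: "(nat \<times> 'b) set \<Rightarrow> ennreal" where
  "weight C = emeasure (density (count_space UNIV) (\<lambda>c. w (fst c))) C"

lemma weight_mono: "C \<subseteq> D \<Longrightarrow> weight C \<le> weight D"
  unfolding weight_def by (intro emeasure_mono) auto

lemma weight_Un_Int: "weight (C \<union> D) + weight (C \<inter> D) = weight C + weight D"
  unfolding weight_def by (rule emeasure_Un_Int[symmetric]) auto

lemma weight_singleton: "weight {(n, b)} = w n"
  unfolding weight_def by (subst emeasure_density) (auto simp: nn_integral_count_space_indicator[symmetric] nn_integral_count_space_finite)

lemma weight_empty: "weight {} = 0"
  by (simp add: weight_def)

text \<open>The net version of Hausdorff content: cells of all generations compete, with no upper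
  bound on their size. This makes it finite on single cells and continuous along increasing
  sequences.\<close>

definition content :: "'a set \<Rightarrow> ennreal" where
  "content A = (INF C\<in>{C. covers C A}. weight C)"

lemma content_le: "covers C A \<Longrightarrow> content A \<le> weight C"
  unfolding content_def by (rule INF_lower) simp

lemma content_mono: "A \<subseteq> B \<Longrightarrow> content A \<le> content B"
  unfolding content_def by (rule INF_superset_mono) (auto simp: covers_def)

lemma content_empty: "content {} = 0"
  using content_le[of "{}" "{}"] by (simp add: covers_def weight_empty)

lemma content_cell: "A \<subseteq> {x. f n x = b} \<Longrightarrow> content A \<le> w n"
  using content_le[of "{(n, b)}" A] by (auto simp: covers_def weight_singleton)

lemma content_approx:
  assumes "content A < \<infinity>" "0 < \<epsilon>"
  obtains C where "covers C A" "weight C \<le> content A + \<epsilon>"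
proof -
  have "\<exists>C\<in>{C. covers C A}. weight C < content A + \<epsilon>"
    using assms ennreal_add_left_cancel_less[of "content A" 0 \<epsilon>]
    by (subst INF_less_iff[symmetric]) (auto simp: content_def[symmetric] less_top)
  then show ?thesis using that by (auto intro: less_imp_le)
qed

lemma content_Un: "content (A \<union> B) \<le> content A + content B"
proof (rule ennreal_le_epsilon)
  fix e :: real assume fin: "content A + content B < top" and e: "0 < e"
  have e2: "0 < ennreal (e/2)" using e by simp
  obtain C where C: "covers C A" "weight C \<le> content A + ennreal (e/2)"
    using fin e2 content_approx[of A "ennreal (e/2)"] by auto
  obtain D where D: "covers D B" "weight D \<le> content B + ennreal (e/2)"
    using fin e2 content_approx[of B "ennreal (e/2)"] by auto
  have "content (A \<union> B) \<le> weight (C \<union> D)"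
    using C D by (intro content_le) (auto simp: covers_def)
  also have "\<dots> \<le> weight C + weight D"
    by (subst weight_Un_Int[symmetric]) (simp add: add_increasing2)
  also have "\<dots> \<le> (content A + ennreal (e/2)) + (content B + ennreal (e/2))"
    using C D by (intro add_mono)
  also have "\<dots> = content A + content B + (ennreal (e/2) + ennreal (e/2))"
    by (simp add: ac_simps)
  also have "ennreal (e/2) + ennreal (e/2) = ennreal e"
    using e by (simp flip: ennreal_plus)
  finally show "content (A \<union> B) \<le> content A + content B + ennreal e" .
qed

lemma content_UN_finite: "finite I \<Longrightarrow> content (\<Union>i\<in>I. A i) \<le> (\<Sum>i\<in>I. content (A i))"
proof (induction I rule: finite_induct)
  case (insert i I)
  have "content (\<Union>i\<in>insert i I. A i) \<le> content (A i) + content (\<Union>i\<in>I. A i)"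
    using content_Un by simp
  also have "\<dots> \<le> content (A i) + (\<Sum>i\<in>I. content (A i))"
    using insert by (intro add_mono) auto
  finally show ?case using insert by simp
qed (simp add: content_empty)

text \<open>With families ordered by the region they cover, \<open>join\<close> thins a family to
  its maximal cells without shrinking that region, and \<open>meet\<close> keeps the cells lying
  under both families.\<close>

definition join :: "(nat \<times> 'b) set \<Rightarrow> (nat \<times> 'b) set" where
  "join C = {c \<in> C. \<forall>c'\<in>C. ancestor c' c \<longrightarrow> c' = c}"

definition meet :: "(nat \<times> 'b) set \<Rightarrow> (nat \<times> 'b) set \<Rightarrow> (nat \<times> 'b) set" where
  "meet C D = {c \<in> C \<union> D. (\<exists>a\<in>C. ancestor a c) \<and> (\<exists>a\<in>D. ancestor a c)}"

lemma covers_join: "covers C A \<Longrightarrow> covers (join C) A"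
  unfolding covers_def
proof
  fix x assume "\<forall>x\<in>A. \<exists>n. (n, f n x) \<in> C" "x \<in> A"
  then obtain n0 where n0: "(n0, f n0 x) \<in> C" by auto
  define n where "n = (LEAST n. (n, f n x) \<in> C)"
  have n: "(n, f n x) \<in> C" unfolding n_def using n0 by (rule LeastI)
  have "(n, f n x) \<in> join C"
    unfolding join_def
  proof (intro CollectI conjI ballI impI n)
    fix c' assume c': "c' \<in> C" "ancestor c' (n, f n x)"
    obtain m a where ma: "c' = (m, a)" by (cases c')
    have "m \<le> n" using c' ma by (simp add: ancestor_def)
    then have "a = f m x" using c' ma ancestor_f by simp
    then have "n \<le> m" using c' ma unfolding n_def by (auto intro: Least_le)
    then show "c' = (n, f n x)" using \<open>m \<le> n\<close> ma \<open>a = f m x\<close> by simp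
  qed
  then show "\<exists>n. (n, f n x) \<in> join C" ..
qed

lemma covers_meet:
  assumes "covers C A" "covers D A"
  shows "covers (meet C D) A"
  unfolding covers_def
proof
  fix x assume "x \<in> A"
  then obtain n m where nm: "(n, f n x) \<in> C" "(m, f m x) \<in> D"
    using assms unfolding covers_def by blast
  have "(max n m, f (max n m) x) \<in> meet C D"
    unfolding meet_def using nm ancestor_f[of n "max n m"] ancestor_f[of m "max n m"]
    by (auto simp: max_def intro: bexI[of _ "(n, f n x)"] bexI[of _ "(m, f m x)"] ancestor_refl)
  then show "\<exists>n. (n, f n x) \<in> meet C D" ..
qed

text \<open>Strong subadditivity of the weight: a cell that is both maximal in \<open>C \<union> D\<close> and below both
  families has to lie in both of them.\<close>

lemma weight_join_meet: "weight (join (C \<union> D)) + weight (meet C D) \<le> weight C + weight D"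
proof -
  have "weight (join (C \<union> D)) + weight (meet C D)
      = weight (join (C \<union> D) \<union> meet C D) + weight (join (C \<union> D) \<inter> meet C D)"
    by (simp add: weight_Un_Int)
  also have "\<dots> \<le> weight (C \<union> D) + weight (C \<inter> D)"
    by (intro add_mono weight_mono) (auto simp: join_def meet_def)
  finally show ?thesis by (simp add: weight_Un_Int)
qed

text \<open>The increasing sets lemma. Nearly optimal covers \<open>C n\<close> are merged one after
  the other; by strong subadditivity the merge with \<open>C (Suc n)\<close> adds only
  \<open>\<epsilon> (Suc n)\<close> to the excess over the content, because the \<open>meet\<close>
  that is given up still covers \<open>A n\<close>. The excesses sum to at most
  \<open>e\<close>.\<close>

theorem content_UN_incseq:
  assumes inc: "incseq A" and bd: "\<And>n. content (A n) \<le> c" and "c < \<infinity>"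
  shows "content (\<Union>n. A n) \<le> c"
proof (rule ennreal_le_epsilon)
  fix e :: real assume e: "0 < e"
  define \<epsilon> where "\<epsilon> n = e * (1/2)^Suc n" for n :: nat
  have \<epsilon>: "0 < \<epsilon> n" for n using e by (simp add: \<epsilon>_def)
  have fin: "content (A n) < \<infinity>" for n using bd[of n] \<open>c < \<infinity>\<close> by (rule le_less_trans)
  have "\<forall>n. \<exists>C. covers C (A n) \<and> weight C \<le> content (A n) + ennreal (\<epsilon> n)"
    using content_approx[OF fin] \<epsilon> by (metis ennreal_less_zero_iff)
  then obtain C where C: "\<And>n. covers (C n) (A n)" "\<And>n. weight (C n) \<le> content (A n) + ennreal (\<epsilon> n)"
    by metis
  define D where "D = rec_nat (join (C 0)) (\<lambda>n X. join (X \<union> C (Suc n)))"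
  have D0: "D 0 = join (C 0)" and DS: "D (Suc n) = join (D n \<union> C (Suc n))" for n
    by (simp_all add: D_def)
  have covD: "covers (D n) (A n)" for n
    by (cases n) (auto simp: D0 DS intro!: covers_join C intro: covers_mono[OF C(1)])
  have wD: "weight (D n) \<le> content (A n) + ennreal (e * (1 - (1/2)^Suc n))" for n
  proof (induction n)
    case 0
    have "weight (D 0) \<le> weight (C 0)"
      unfolding D0 by (rule weight_mono) (auto simp: join_def)
    also have "\<dots> \<le> content (A 0) + ennreal (\<epsilon> 0)" by (rule C)
    finally show ?case by (simp add: \<epsilon>_def)
  next
    case (Suc n)
    \<comment> \<open>\<open>C (Suc n)\<close> covers the larger set \<open>A (Suc n)\<close>, hence
      also \<open>A n\<close>. The finite number \<open>content (A n)\<close> is cancelled at the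
      end of the step.\<close>
    have "covers (meet (D n) (C (Suc n))) (A n)"
      using covD[of n] C(1)[of "Suc n"] incseq_SucD[OF inc, of n]
      by (intro covers_meet) (auto simp: covers_def)
    then have "content (A n) \<le> weight (meet (D n) (C (Suc n)))" by (rule content_le)
    then have "content (A n) + weight (D (Suc n)) \<le> weight (D (Suc n)) + weight (meet (D n) (C (Suc n)))"
      by (simp add: add.commute add_mono)
    also have "\<dots> \<le> weight (D n) + weight (C (Suc n))"
      unfolding DS by (rule weight_join_meet)
    also have "\<dots> \<le> (content (A n) + ennreal (e * (1 - (1/2)^Suc n))) + (content (A (Suc n)) + ennreal (\<epsilon> (Suc n)))"
      by (intro add_mono Suc C)
    also have "\<dots> = content (A n) + (content (A (Suc n)) + (ennreal (e * (1 - (1/2)^Suc n)) + ennreal (\<epsilon> (Suc n))))"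
      by (simp add: ac_simps)
    also have "ennreal (e * (1 - (1/2)^Suc n)) + ennreal (\<epsilon> (Suc n)) = ennreal (e * (1 - (1/2)^Suc (Suc n)))"
    proof -
      have "(1/2)^Suc n \<le> (1::real)" by (intro power_le_one) auto
      moreover have "e * (1 - (1/2)^Suc n) + \<epsilon> (Suc n) = e * (1 - (1/2)^Suc (Suc n))"
        by (simp add: \<epsilon>_def algebra_simps)
      ultimately show ?thesis using e \<epsilon>[of "Suc n"] by (subst ennreal_plus[symmetric]) auto
    qed
    finally show ?case using fin[of n] by (auto simp: ennreal_add_left_cancel_le)
  qed
  have Dsub: "D n \<subseteq> (\<Union>m. C m)" for n
    by (induction n) (auto simp: D0 DS join_def)
  \<comment> \<open>The families \<open>D n\<close> are not increasing, since later merges may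
    remove cells. A cell that is maximal among all \<open>C m\<close> is never removed, so these
    cells form an increasing sequence inside the \<open>D n\<close>, and continuity from below
    applies to it.\<close>
  define B where "B n = (\<Union>m\<le>n. C m) \<inter> join (\<Union>m. C m)" for n
  have BD: "B n \<subseteq> D n" for n
  proof (induction n)
    case 0
    then show ?case by (auto simp: B_def D0 join_def)
  next
    case (Suc n)
    show ?case
    proof
      fix c assume c: "c \<in> B (Suc n)"
      then have "c \<in> B n \<union> C (Suc n)" by (auto simp: B_def le_Suc_eq)
      then have "c \<in> D n \<union> C (Suc n)" using Suc by blast
      moreover have "c \<in> join (\<Union>m. C m)" using c by (auto simp: B_def)
      ultimately show "c \<in> D (Suc n)" using Dsub[of n] unfolding DS join_def by blast
    qed
  qed
  have UB: "(\<Union>n. B n) = join (\<Union>m. C m)" by (auto simp: B_def join_def)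
  have incB: "incseq B" unfolding B_def incseq_def by (intro allI impI Int_mono UN_mono) auto
  have "content (\<Union>n. A n) \<le> weight (\<Union>n. B n)"
    unfolding UB by (intro content_le covers_join) (use C(1) in \<open>unfold covers_def, blast\<close>)
  also have "\<dots> = (SUP n. weight (B n))"
    unfolding weight_def using incB by (intro SUP_emeasure_incseq[symmetric]) auto
  also have "\<dots> \<le> c + ennreal e"
  proof (rule SUP_least)
    fix n
    have "weight (B n) \<le> weight (D n)" by (rule weight_mono[OF BD])
    also have "\<dots> \<le> content (A n) + ennreal (e * (1 - (1/2)^Suc n))" by (rule wD)
    also have "\<dots> \<le> c + ennreal e"
      using e by (intro add_mono bd ennreal_leI) (simp add: field_simps)
    finally show "weight (B n) \<le> c + ennreal e" .
  qed
  finally show "content (\<Union>n. A n) \<le> c + ennreal e" .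
qed

end

section \<open>Analytic sets and capacitability\<close>

text \<open>Projections of closed subsets of the product with Baire space. In this form countable
  unions and intersections reduce to coding of sequences, and the capacity argument can bound the
  coordinates one at a time.\<close>

definition analytic_set :: "'a::metric_space set \<Rightarrow> bool" where
  "analytic_set A \<longleftrightarrow> (\<exists>C :: ('a \<times> (nat \<Rightarrow> nat)) set. closed C \<and> A = fst ` C)"

lemma analytic_setI:
  fixes C :: "('a::metric_space \<times> (nat \<Rightarrow> nat)) set"
  shows "closed C \<Longrightarrow> A = fst ` C \<Longrightarrow> analytic_set A"
  unfolding analytic_set_def by blast

lemma continuous_coordinate: "continuous_on UNIV (\<lambda>\<sigma> :: nat \<Rightarrow> nat. \<sigma> i)"
  by (rule continuous_on_product_coordinates)

lemma analytic_set_closed: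
  assumes "closed A" shows "analytic_set A"
proof (rule analytic_setI)
  show "closed (A \<times> (UNIV :: (nat \<Rightarrow> nat) set))" using assms by (intro closed_Times) auto
qed auto

text \<open>The first entry of a sequence selects the set \<open>A n\<close>, the remaining entries
  form a witness for membership in it.\<close>

lemma analytic_set_UN:
  fixes A :: "nat \<Rightarrow> 'a::metric_space set"
  assumes "\<And>n. analytic_set (A n)"
  shows "analytic_set (\<Union>n. A n)"
proof -
  obtain C :: "nat \<Rightarrow> ('a \<times> (nat \<Rightarrow> nat)) set" where C: "\<And>n. closed (C n)" "\<And>n. A n = fst ` C n"
    using assms unfolding analytic_set_def by metis
  define D where "D = {(x, \<sigma>). (x, \<lambda>k. \<sigma> (Suc k)) \<in> C (\<sigma> 0)}"
  have cont: "continuous_on UNIV (\<lambda>p :: 'a \<times> (nat \<Rightarrow> nat). (fst p, \<lambda>k. snd p (Suc k)))"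
    by (intro continuous_intros continuous_on_coordinatewise_then_product
        continuous_on_compose2[OF continuous_coordinate]) auto
  have cont0: "continuous_on UNIV (\<lambda>p :: 'a \<times> (nat \<Rightarrow> nat). snd p 0)"
    by (intro continuous_on_compose2[OF continuous_coordinate] continuous_intros) auto
  have "D = (\<Inter>n. (\<lambda>p. snd p 0) -` (-{n}) \<union> (\<lambda>p. (fst p, \<lambda>k. snd p (Suc k))) -` C n)"
    by (auto simp: D_def)
  also have "closed \<dots>"
    using C(1) cont cont0 by (intro closed_INT ballI closed_Un closed_vimage) (auto simp: closed_def open_discrete)
  finally have "closed D" .
  moreover have "(\<Union>n. A n) = fst ` D"
  proof safe
    fix x n assume "x \<in> A n"
    then obtain \<sigma> where "(x, \<sigma>) \<in> C n" using C(2) by force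
    then have "(x, case_nat n \<sigma>) \<in> D" by (simp add: D_def)
    then show "x \<in> fst ` D" by force
  next
    fix x \<sigma> assume "(x, \<sigma>) \<in> D"
    then have "x \<in> A (\<sigma> 0)" unfolding C(2) D_def by force
    then show "fst (x, \<sigma>) \<in> (\<Union>n. A n)" by auto
  qed
  ultimately show ?thesis by (rule analytic_setI)
qed

text \<open>One sequence stores witnesses for all \<open>n\<close> simultaneously, separated by the
  pairing function.\<close>

lemma analytic_set_INT:
  fixes A :: "nat \<Rightarrow> 'a::metric_space set"
  assumes "\<And>n. analytic_set (A n)"
  shows "analytic_set (\<Inter>n. A n)"
proof -
  obtain C :: "nat \<Rightarrow> ('a \<times> (nat \<Rightarrow> nat)) set" where C: "\<And>n. closed (C n)" "\<And>n. A n = fst ` C n"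
    using assms unfolding analytic_set_def by metis
  define D where "D = (\<Inter>n. (\<lambda>p. (fst p, \<lambda>k. snd p (prod_encode (n, k)))) -` C n)"
  have cont: "continuous_on UNIV (\<lambda>p :: 'a \<times> (nat \<Rightarrow> nat). (fst p, \<lambda>k. snd p (prod_encode (n, k))))" for n
    by (intro continuous_intros continuous_on_coordinatewise_then_product
        continuous_on_compose2[OF continuous_coordinate]) auto
  have "closed D"
    unfolding D_def using C(1) cont by (intro closed_INT ballI closed_vimage) auto
  moreover have "(\<Inter>n. A n) = fst ` D"
  proof safe
    fix x assume "x \<in> (\<Inter>n. A n)"
    then have "\<forall>n. \<exists>\<sigma>. (x, \<sigma>) \<in> C n" using C(2) by force
    then obtain \<sigma> where \<sigma>: "\<And>n. (x, \<sigma> n) \<in> C n" by metis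
    have "(x, \<lambda>i. case prod_decode i of (n, k) \<Rightarrow> \<sigma> n k) \<in> D" by (simp add: D_def \<sigma>)
    then show "x \<in> fst ` D" by force
  next
    fix x \<sigma> n assume "(x, \<sigma>) \<in> D"
    then show "fst (x, \<sigma>) \<in> A n" unfolding C(2) D_def by force
  qed
  ultimately show ?thesis by (rule analytic_setI)
qed

lemma analytic_set_open:
  assumes "open (A :: 'a::metric_space set)" shows "analytic_set A"
proof -
  have "\<exists>F :: nat \<Rightarrow> 'a set. (\<forall>n. closed (F n)) \<and> A = (\<Union>n. F n)"
  proof (cases "A = UNIV")
    \<comment> \<open>Treated apart because \<open>infdist\<close> to the empty set is 0 by
      convention, which would make every \<open>F n\<close> empty.\<close>
    case True
    then show ?thesis by (intro exI[of _ "\<lambda>_. UNIV"]) auto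
  next
    case False
    define F where "F n = {x. infdist x (-A) \<ge> 1 / Suc n}" for n
    have "closed (F n)" for n
      unfolding F_def by (intro closed_Collect_le continuous_intros)
    moreover have "A = (\<Union>n. F n)"
    proof safe
      fix x assume "x \<in> A"
      then have "infdist x (-A) > 0"
        using False assms in_closed_iff_infdist_zero[of "-A" x] infdist_nonneg[of x "-A"] by force
      then obtain n where "1 / Suc n < infdist x (-A)"
        using nat_approx_posE by metis
      then show "x \<in> (\<Union>n. F n)" by (auto simp: F_def intro: less_imp_le)
    next
      fix x n assume "x \<in> F n"
      then have "infdist x (-A) > 0" by (simp add: F_def) (smt (verit) of_nat_0_le_iff zero_less_divide_iff)
      then show "x \<in> A" using infdist_zero[of x "-A"] by fastforce
    qed
    ultimately show ?thesis by blast
  qed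
  then show ?thesis using analytic_set_UN analytic_set_closed by metis
qed

lemma analytic_set_borel:
  assumes "A \<in> sets (borel :: 'a::metric_space measure)"
  shows "analytic_set A"
proof -
  have "A \<in> sigma_sets UNIV {S. open S}" using assms by (simp add: borel_def)
  \<comment> \<open>Complements of analytic sets are in general not analytic, so the induction
    carries both statements; for a union, the complement is a countable intersection.\<close>
  then have "analytic_set A \<and> analytic_set (- A)"
  proof (induction rule: sigma_sets.induct)
    case (Basic a)
    then show ?case by (auto intro: analytic_set_open analytic_set_closed)
  next
    case Empty
    then show ?case using analytic_set_closed[of "{}"] analytic_set_closed[of UNIV] by simp
  next
    case (Compl a)
    then show ?case by (simp add: Compl_eq_Diff_UNIV[symmetric])
  next
    case (Union a)
    then show ?case by (auto intro: analytic_set_UN analytic_set_INT)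
  qed
  then show ?thesis ..
qed

lemma tendsto_fun_componentwise_iff:
  "(f \<longlongrightarrow> l) F \<longleftrightarrow> (\<forall>i. ((\<lambda>x. f x i) \<longlongrightarrow> (l i :: 'b::topological_space)) F)"
  using limitin_componentwise[of "\<lambda>_. euclidean" UNIV f l F]
  by (simp add: euclidean_product_topology)

text \<open>Choquet's capacitability argument.  Only continuity along increasing sequences is required of
  \<open>M\<close>: instead of continuity along compact sets, the sets \<open>A k\<close> and their limit set \<open>K\<close> are
  recorded.\<close>

lemma analytic_capacity:
  fixes X :: "'a::heine_borel set" and M :: "'a set \<Rightarrow> 'c::linorder"
  assumes X: "analytic_set X" "bounded X" and c: "c < M X"
    and M: "\<And>B. incseq B \<Longrightarrow> c < M (\<Union>n. B n) \<Longrightarrow> \<exists>n. c < M (B n)"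
  shows "\<exists>A K. compact K \<and> K \<subseteq> X \<and> decseq A \<and> (\<forall>k::nat. A k \<subseteq> X) \<and> (\<forall>k. c < M (A k)) \<and>
    (\<forall>B. closed B \<longrightarrow> (\<forall>k. A k \<inter> B \<noteq> {}) \<longrightarrow> K \<inter> B \<noteq> {})"
proof -
  obtain C :: "('a \<times> (nat \<Rightarrow> nat)) set" where C: "closed C" "X = fst ` C"
    using X(1) unfolding analytic_set_def by auto
  \<comment> \<open>Step \<open>k\<close> bounds the \<open>k\<close>-th entry of the witnesses. The
    projections for the bounds m = 0, 1, 2, ... increase to the previous one, so some bound keeps
    \<open>M\<close> above \<open>c\<close>.\<close>
  have "\<exists>S. \<forall>k. (c < M (fst ` S k) \<and> (k = 0 \<longrightarrow> S k = C)) \<and> (\<exists>m. S (Suc k) = S k \<inter> {p. snd p k \<le> m})"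
  proof (rule dependent_nat_choice)
    show "\<exists>S. c < M (fst ` S) \<and> (0 = 0 \<longrightarrow> S = C)" using c C by auto
  next
    fix S :: "('a \<times> (nat \<Rightarrow> nat)) set" and k :: nat
    assume S: "c < M (fst ` S) \<and> (k = 0 \<longrightarrow> S = C)"
    have "fst ` S = (\<Union>m. fst ` (S \<inter> {p. snd p k \<le> m}))" by force
    moreover have "incseq (\<lambda>m. fst ` (S \<inter> {p. snd p k \<le> m}))"
      unfolding incseq_def by (intro allI impI image_mono) auto
    ultimately obtain m where "c < M (fst ` (S \<inter> {p. snd p k \<le> m}))" using M S by metis
    then show "\<exists>S'. (c < M (fst ` S') \<and> (Suc k = 0 \<longrightarrow> S' = C)) \<and> (\<exists>m. S' = S \<inter> {p. snd p k \<le> m})"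
      by (intro exI[of _ "S \<inter> {p. snd p k \<le> m}"]) auto
  qed
  then obtain S where S: "\<And>k. c < M (fst ` S k)" "S 0 = C" "\<And>k. \<exists>m. S (Suc k) = S k \<inter> {p. snd p k \<le> m}"
    by metis
  obtain N where N: "\<And>k. S (Suc k) = S k \<inter> {p. snd p k \<le> N k}" using S(3) by metis
  have S_eq: "S k = C \<inter> {p. \<forall>i<k. snd p i \<le> N i}" for k
    by (induction k) (auto simp: S N less_Suc_eq)
  \<comment> \<open>The limit of the bounds is a product of finite sets, compact by Tychonoff; above
    it the closed set \<open>C\<close> has a compact part whose projection is the required
    \<open>K\<close>.\<close>
  define T where "T = (\<Pi>\<^sub>E i\<in>UNIV. {..N i})"
  have T: "compact T"
  proof -
    have "compactin (product_topology (\<lambda>i. euclidean) UNIV) T"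
      unfolding T_def by (subst compactin_PiE) (auto simp: compactin_euclidean_iff finite_imp_compact)
    then show ?thesis by (simp add: euclidean_product_topology compactin_euclidean_iff)
  qed
  have T_iff: "\<sigma> \<in> T \<longleftrightarrow> (\<forall>i. \<sigma> i \<le> N i)" for \<sigma> by (auto simp: T_def)
  have clX: "compact (closure X)" using X(2) by (simp add: compact_closure)
  define D where "D = C \<inter> (closure X \<times> T)"
  have D: "compact D" unfolding D_def using C(1) clX T by (intro closed_Int_compact compact_Times)
  show ?thesis
  proof (intro exI conjI allI impI)
    show "compact (fst ` D)" using D by (intro compact_continuous_image continuous_intros)
    show "fst ` D \<subseteq> X" unfolding C D_def by auto
    show "decseq (\<lambda>k. fst ` S k)" unfolding decseq_def S_eq by (intro allI impI image_mono) auto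
    show "fst ` S k \<subseteq> X" for k unfolding C S_eq by auto
    show "c < M (fst ` S k)" for k by (rule S)
    fix B assume B: "closed B" "\<forall>k. fst ` S k \<inter> B \<noteq> {}"
    have "\<forall>k. \<exists>p. p \<in> S k \<and> fst p \<in> B" using B(2) by blast
    then obtain p where p: "\<And>k. p k \<in> S k" "\<And>k. fst (p k) \<in> B" by metis
    \<comment> \<open>The entries of \<open>p k\<close> are bounded only below index
      \<open>k\<close>. Clipping to the box gives a sequence in a compact set, and each fixed entry
      is eventually unaffected, so the limit is also a limit of the points \<open>p (r k)\<close> of
      \<open>C\<close>.\<close>
    define q where "q k = (fst (p k), \<lambda>i. min (snd (p k) i) (N i))" for k
    have qT: "q k \<in> closure X \<times> T" for k
    proof -
      have "fst (p k) \<in> X" using p(1)[of k] unfolding C S_eq by auto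
      then show ?thesis using closure_subset[of X] by (auto simp: q_def T_iff)
    qed
    have "seq_compact (closure X \<times> T)"
      using clX T by (intro compact_imp_seq_compact compact_Times)
    then obtain l r where lr: "l \<in> closure X \<times> T" "strict_mono r" "(q \<circ> r) \<longlonglongrightarrow> l"
      using qT unfolding seq_compact_def by metis
    have fstlim: "(\<lambda>k. fst (p (r k))) \<longlonglongrightarrow> fst l"
      using tendsto_fst[OF lr(3)] by (simp add: q_def comp_def)
    have "(\<lambda>k. snd (p (r k))) \<longlonglongrightarrow> snd l"
      unfolding tendsto_fun_componentwise_iff
    proof
      fix i
      have qi: "(\<lambda>k. snd (q (r k)) i) \<longlonglongrightarrow> snd l i"
        using tendsto_snd[OF lr(3)] unfolding tendsto_fun_componentwise_iff by (simp add: comp_def)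
      show "(\<lambda>k. snd (p (r k)) i) \<longlonglongrightarrow> snd l i"
      proof (rule Lim_transform_eventually[OF qi])
        show "\<forall>\<^sub>F k in sequentially. snd (q (r k)) i = snd (p (r k)) i"
          unfolding eventually_sequentially
        proof (intro exI allI impI)
          fix k assume "Suc i \<le> k"
          then have "i < r k" using seq_suble[OF lr(2), of k] by simp
          then have "snd (p (r k)) i \<le> N i" using p(1)[of "r k"] unfolding S_eq by auto
          then show "snd (q (r k)) i = snd (p (r k)) i" by (simp add: q_def)
        qed
      qed
    qed
    then have "(\<lambda>k. (fst (p (r k)), snd (p (r k)))) \<longlonglongrightarrow> (fst l, snd l)"
      by (intro tendsto_Pair fstlim)
    then have "(\<lambda>k. p (r k)) \<longlonglongrightarrow> l" by simp
    moreover have "p (r k) \<in> C" for k using p(1) unfolding S_eq by auto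
    ultimately have "l \<in> C" using C(1) by (metis closed_sequentially)
    then have "fst l \<in> fst ` D" using lr(1) by (auto simp: D_def)
    moreover have "fst l \<in> B" using B(1) fstlim p(2) by (metis closed_sequentially)
    ultimately show "fst ` D \<inter> B \<noteq> {}" by auto
  qed
qed

section \<open>Frostman weights on dyadic cells\<close>

text \<open>Mass flows down the tree: a cell distributes its mass to its children in proportion to
  \<phi>. Since \<phi> is subadditive, no child receives more than its own \<phi>. This takes the
  place of a limit of measures in the construction of a Frostman measure.\<close>

lemma additive_flow:
  fixes \<phi> :: "nat \<Rightarrow> 'b \<Rightarrow> real" and par :: "'b \<Rightarrow> 'b"
  assumes nonneg: "\<And>n b. 0 \<le> \<phi> n b" and fin: "\<And>b. finite {b'. par b' = b}"
    and sub: "\<And>n b. \<phi> n b \<le> (\<Sum>b' | par b' = b. \<phi> (Suc n) b')"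
  obtains \<nu> where "\<And>n b. 0 \<le> \<nu> n b" "\<And>n b. \<nu> n b \<le> \<phi> n b" "\<And>b. \<nu> 0 b = \<phi> 0 b"
    "\<And>n b. \<nu> n b = (\<Sum>b' | par b' = b. \<nu> (Suc n) b')"
proof -
  define \<nu> where "\<nu> = rec_nat (\<phi> 0) (\<lambda>n v b. v (par b) * (\<phi> (Suc n) b / (\<Sum>b' | par b' = par b. \<phi> (Suc n) b')))"
  have \<nu>0: "\<nu> 0 = \<phi> 0"
    and \<nu>S: "\<nu> (Suc n) b = \<nu> n (par b) * (\<phi> (Suc n) b / (\<Sum>b' | par b' = par b. \<phi> (Suc n) b'))" for n b
    by (simp_all add: \<nu>_def)
  have sum_nonneg: "0 \<le> (\<Sum>b' | par b' = b. \<phi> (Suc n) b')" for n b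
    by (intro sum_nonneg nonneg)
  have \<nu>_nonneg: "0 \<le> \<nu> n b" for n b
    by (induction n arbitrary: b) (auto simp: \<nu>0 \<nu>S nonneg intro!: mult_nonneg_nonneg divide_nonneg_nonneg sum_nonneg)
  have \<nu>_le: "\<nu> n b \<le> \<phi> n b" for n b
  proof (induction n arbitrary: b)
    case (Suc n)
    let ?S = "\<Sum>b' | par b' = par b. \<phi> (Suc n) b'"
    have "\<nu> n (par b) \<le> ?S" using Suc[of "par b"] sub[of n "par b"] by linarith
    then have "\<nu> n (par b) * (\<phi> (Suc n) b / ?S) \<le> ?S * (\<phi> (Suc n) b / ?S)"
      using nonneg sum_nonneg by (intro mult_right_mono divide_nonneg_nonneg) auto
    also have "\<dots> \<le> \<phi> (Suc n) b" using nonneg by simp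
    finally show ?case by (simp add: \<nu>S)
  qed (simp add: \<nu>0)
  show thesis
  proof (rule that[OF \<nu>_nonneg \<nu>_le])
    fix n b
    let ?S = "\<Sum>b' | par b' = b. \<phi> (Suc n) b'"
    have "(\<Sum>b' | par b' = b. \<nu> (Suc n) b') = (\<Sum>b' | par b' = b. \<nu> n b * (\<phi> (Suc n) b' / ?S))"
      by (intro sum.cong) (auto simp: \<nu>S)
    also have "\<dots> = \<nu> n b * (?S / ?S)"
      by (simp add: sum_distrib_left[symmetric] sum_divide_distrib[symmetric])
    \<comment> \<open>If the sum over the children vanishes, subadditivity forces
      \<open>\<nu> n b = 0\<close>, and division by zero does no harm.\<close>
    also have "\<dots> = \<nu> n b"
      using \<nu>_le[of n b] \<nu>_nonneg[of n b] sub[of n b] by (cases "?S = 0") auto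
    finally show "\<nu> n b = (\<Sum>b' | par b' = b. \<nu> (Suc n) b')" ..
  qed (simp add: \<nu>0)
qed

section \<open>Dyadic cells of three-dimensional space\<close>

definition cell :: "nat \<Rightarrow> real ^ 3 \<Rightarrow> int ^ 3" where
  "cell n x = (\<chi> i. \<lfloor>2 ^ n * x $ i\<rfloor>)"

definition cell_parent :: "int ^ 3 \<Rightarrow> int ^ 3" where
  "cell_parent b = (\<chi> i. b $ i div 2)"

definition corner :: "nat \<Rightarrow> int ^ 3 \<Rightarrow> real ^ 3" where
  "corner n b = (\<chi> i. of_int (b $ i) / 2 ^ n)"

text \<open>The fibres of \<open>cell n\<close> are half-open and partition space. Their closures
  are used where a compact set is to be shown to meet a cell, as capacitability tests closed sets
  only.\<close>

definition closed_cell :: "nat \<Rightarrow> int ^ 3 \<Rightarrow> (real ^ 3) set" where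
  "closed_cell n b = {x. \<forall>i. corner n b $ i \<le> x $ i \<and> x $ i \<le> corner n b $ i + 1 / 2 ^ n}"

lemma cell_parent_cell: "cell_parent (cell (Suc n) x) = cell n x"
proof -
  have "\<lfloor>2 ^ Suc n * x $ i\<rfloor> div 2 = \<lfloor>2 ^ n * x $ i\<rfloor>" for i
    using floor_divide_real_eq_div[of 2 "2 ^ Suc n * x $ i"] by simp
  then show ?thesis by (simp add: cell_parent_def cell_def vec_eq_iff)
qed

lemma cell_corner: "cell n (corner n b) = b"
  by (simp add: cell_def corner_def vec_eq_iff)

lemma closed_closed_cell: "closed (closed_cell n b)"
  unfolding closed_cell_def
  by (intro closed_Collect_all closed_Collect_conj closed_Collect_le continuous_intros)

lemma cell_subset_closed_cell: "x \<in> closed_cell n (cell n x)"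
proof -
  have "of_int \<lfloor>2 ^ n * x $ i\<rfloor> / 2 ^ n \<le> x $ i \<and> x $ i \<le> of_int \<lfloor>2 ^ n * x $ i\<rfloor> / 2 ^ n + 1 / 2 ^ n" for i
  proof -
    have "of_int \<lfloor>2 ^ n * x $ i\<rfloor> \<le> 2 ^ n * x $ i" "2 ^ n * x $ i \<le> of_int \<lfloor>2 ^ n * x $ i\<rfloor> + 1"
      by linarith+
    then show ?thesis by (simp add: field_simps)
  qed
  then show ?thesis by (simp add: closed_cell_def corner_def cell_def)
qed

lemma norm_le_componentwise:
  fixes x :: "real ^ 3"
  assumes "\<And>i. \<bar>x $ i\<bar> \<le> r" shows "norm x \<le> 3 * r"
  using norm_le_l1_cart[of x] assms[of 1] assms[of 2] assms[of 3] by (simp add: sum_3)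

lemma closed_cell_dist:
  assumes "x \<in> closed_cell n b" "y \<in> closed_cell n b"
  shows "norm (x - y) \<le> 3 / 2 ^ n"
proof -
  have "\<bar>(x - y) $ i\<bar> \<le> 1 / 2 ^ n" for i
    using assms unfolding closed_cell_def by (simp add: abs_le_iff) (smt (verit))
  then show ?thesis using norm_le_componentwise[of "x - y" "1 / 2 ^ n"] by simp
qed

lemma corner_in_closed_cell: "corner n b \<in> closed_cell n b"
  by (simp add: closed_cell_def)

lemma bounded_closed_cell: "bounded (closed_cell n b)"
  by (rule boundedI[of _ "norm (corner n b) + 3 / 2 ^ n"])
    (smt (verit) closed_cell_dist corner_in_closed_cell norm_triangle_sub norm_minus_commute)

lemma closed_cell_mono:
  assumes "x \<in> closed_cell (Suc n) b" shows "x \<in> closed_cell n (cell_parent b)"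
  unfolding closed_cell_def
proof (intro CollectI allI conjI)
  fix i
  have x: "of_int (b $ i) \<le> 2 ^ Suc n * x $ i" "2 ^ Suc n * x $ i \<le> of_int (b $ i) + 1"
    using assms by (auto simp: closed_cell_def corner_def field_simps)
  have "2 * (b $ i div 2) \<le> b $ i" "b $ i + 1 \<le> 2 * (b $ i div 2) + 2" by auto
  then have "2 * real_of_int (b $ i div 2) \<le> of_int (b $ i)" "of_int (b $ i) + 1 \<le> 2 * real_of_int (b $ i div 2) + 2"
    by linarith+
  with x have "real_of_int (b $ i div 2) \<le> 2 ^ n * x $ i" "2 ^ n * x $ i \<le> of_int (b $ i div 2) + 1"
    by simp_all
  then show "corner n (cell_parent b) $ i \<le> x $ i" "x $ i \<le> corner n (cell_parent b) $ i + 1 / 2 ^ n"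
    by (simp_all add: corner_def cell_parent_def field_simps)
qed

lemma closed_cell_mono_funpow:
  "x \<in> closed_cell (n + k) b \<Longrightarrow> x \<in> closed_cell n ((cell_parent ^^ k) b)"
proof (induction k arbitrary: b)
  case (Suc k)
  have "x \<in> closed_cell (n + k) (cell_parent b)" using closed_cell_mono Suc.prems by simp
  then have "x \<in> closed_cell n ((cell_parent ^^ k) (cell_parent b))" by (rule Suc.IH)
  then show ?case by (simp add: funpow_swap1)
qed simp

lemma int_box_card:
  fixes lo hi :: "3 \<Rightarrow> int"
  assumes "\<And>i. hi i - lo i + 1 \<le> int N"
  shows "finite {a :: int ^ 3. \<forall>i. lo i \<le> a $ i \<and> a $ i \<le> hi i}"
    and "card {a :: int ^ 3. \<forall>i. lo i \<le> a $ i \<and> a $ i \<le> hi i} \<le> N ^ 3"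
proof -
  let ?A = "{a :: int ^ 3. \<forall>i. lo i \<le> a $ i \<and> a $ i \<le> hi i}"
  let ?B = "{lo 1..hi 1} \<times> {lo 2..hi 2} \<times> {lo 3..hi 3}"
  let ?g = "\<lambda>a :: int ^ 3. (a $ 1, a $ 2, a $ 3)"
  have inj: "inj_on ?g ?A" by (auto simp: inj_on_def vec_eq_iff forall_3)
  have img: "?g ` ?A \<subseteq> ?B" by auto
  have c: "card {lo i..hi i} \<le> N" for i using assms[of i] by simp
  show "finite ?A" using finite_imageD[OF finite_subset[OF img] inj] by simp
  have "card ?A \<le> card ?B" using inj img by (rule card_inj_on_le) simp
  also have "\<dots> \<le> N * (N * N)" using c by (simp only: card_cartesian_product) (intro mult_mono, auto)
  finally show "card ?A \<le> N ^ 3" by (simp add: power3_eq_cube)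
qed

lemma finite_cell_children: "finite {b'. cell_parent b' = b}"
proof (rule finite_subset)
  show "{b'. cell_parent b' = b} \<subseteq> {a. \<forall>i. 2 * b $ i \<le> a $ i \<and> a $ i \<le> 2 * b $ i + 1}"
    by (auto simp: cell_parent_def)
  show "finite {a :: int ^ 3. \<forall>i. 2 * b $ i \<le> a $ i \<and> a $ i \<le> 2 * b $ i + 1}"
    by (rule int_box_card(1)[where N = 2]) simp
qed

abbreviation cell_weight :: "real \<Rightarrow> nat \<Rightarrow> ennreal" where
  "cell_weight s n \<equiv> ennreal (2 powr (- (s * real n)))"

interpretation cells: cell_tree cell cell_parent "cell_weight s" for s
  by standard (rule cell_parent_cell)

text \<open>A cover of small total weight can contain only small cells, so a cover that is efficient
  for the content is automatically fine.\<close>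

lemma content_null_imp_hausdorff_null:
  assumes s: "0 < s" and A: "cells.content s A = 0"
  shows "hausdorff_measure s A = 0"
  unfolding hausdorff_measure_eq_0_iff
proof (intro allI impI)
  fix \<delta> :: real assume \<delta>: "0 < \<delta>"
  have "hausdorff_premeasure s \<delta> A \<le> 0 + ennreal e" if e: "0 < e" for e
  proof -
    \<comment> \<open>The second entry forces every cell in the cover to satisfy 3 / 2^n \<le>
      \<delta>; the first pays for the factor 3^s between the diameter bound 3 / 2^n and the side
      length.\<close>
    define \<epsilon> where "\<epsilon> = min (e / 3 powr s) ((\<delta> / 3) powr s)"
    have \<epsilon>: "0 < \<epsilon>" using e \<delta> by (simp add: \<epsilon>_def)
    obtain C where C: "cells.covers C A" "cells.weight s C \<le> ennreal \<epsilon>"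
      using cells.content_approx[of s A "ennreal \<epsilon>"] A \<epsilon> by auto
    define g where "g = from_nat_into (UNIV :: (nat \<times> (int ^ 3)) set)"
    have "infinite (UNIV :: (nat \<times> (int ^ 3)) set)"
      using finite_prod[where ?'a = nat and ?'b = "int ^ 3"] by simp
    then have g: "bij_betw g UNIV UNIV"
      unfolding g_def by (intro bij_betw_from_nat_into) auto
    define U where "U k = (if g k \<in> C then closed_cell (fst (g k)) (snd (g k)) else {})" for k
    have wC: "cells.weight s C = (\<Sum>k. cell_weight s (fst (g k)) * indicator C (g k))"
      unfolding cells.weight_def
      by (subst emeasure_density)
        (auto simp: nn_integral_bij_count_space[OF g, symmetric] nn_integral_count_space_nat)
    have diamU: "diameter (closed_cell n b) \<le> 3 / 2 ^ n" for n b
      by (rule diameter_le) (auto intro: closed_cell_dist)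
    have small: "3 / 2 ^ n \<le> \<delta>" if "(n, b) \<in> C" for n b
    proof -
      have "cell_weight s n \<le> cells.weight s C"
        using that cells.weight_mono[of "{(n, b)}" C s] by (simp add: cells.weight_singleton)
      then have "cell_weight s n \<le> ennreal \<epsilon>" using C(2) by (rule order_trans)
      then have "2 powr (- (s * real n)) \<le> (\<delta> / 3) powr s" using \<epsilon> by (simp add: \<epsilon>_def)
      then have "(2 powr (- real n)) powr s \<le> (\<delta> / 3) powr s" by (simp add: powr_powr mult.commute)
      then have "2 powr (- real n) \<le> \<delta> / 3" using s \<delta> powr_less_mono2[of s "\<delta> / 3" "2 powr (- real n)"] by linarith
      then show ?thesis by (simp add: powr_minus powr_realpow divide_simps mult.commute)
    qed
    have "hausdorff_premeasure s \<delta> A \<le> (\<Sum>k. diam_pow s (U k))"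
    proof (rule hausdorff_premeasure_le)
      show "A \<subseteq> (\<Union>k. U k)"
      proof
        fix x assume "x \<in> A"
        then obtain n where n: "(n, cell n x) \<in> C" using C(1) by (auto simp: cells.covers_def)
        obtain k where "g k = (n, cell n x)" using g by (metis bij_betw_imp_surj_on rangeE UNIV_I)
        then have "x \<in> U k" using n cell_subset_closed_cell by (simp add: U_def)
        then show "x \<in> (\<Union>k. U k)" by blast
      qed
      show "bounded (U k)" for k by (simp add: U_def bounded_closed_cell)
      show "diameter (U k) \<le> \<delta>" for k
        using small[of "fst (g k)" "snd (g k)"] diamU[of "fst (g k)" "snd (g k)"] \<delta> by (auto simp: U_def)
    qed
    also have "\<dots> \<le> (\<Sum>k. ennreal (3 powr s) * (cell_weight s (fst (g k)) * indicator C (g k)))"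
    proof (intro suminf_le)
      fix k
      show "diam_pow s (U k) \<le> ennreal (3 powr s) * (cell_weight s (fst (g k)) * indicator C (g k))"
      proof (cases "g k \<in> C")
        case True
        let ?d = "diameter (closed_cell (fst (g k)) (snd (g k)))" let ?n = "fst (g k)"
        have "?d powr s \<le> (3 / 2 ^ ?n) powr s"
          using diamU s by (intro powr_mono2) (auto simp: diameter_ge_0 bounded_closed_cell)
        also have "\<dots> = 3 powr s * 2 powr (- (s * real ?n))"
        proof -
          have "(3 / 2 ^ ?n :: real) = 3 * 2 powr (- real ?n)"
            by (simp add: powr_minus powr_realpow divide_inverse)
          then show ?thesis by (simp add: powr_mult powr_powr mult.commute)
        qed
        finally show ?thesis using True s
          by (auto simp: U_def diam_pow_def ennreal_mult[symmetric] intro!: ennreal_leI)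
      qed (simp add: U_def diam_pow_def)
    qed auto
    also have "\<dots> = ennreal (3 powr s) * cells.weight s C"
      by (simp add: wC)
    also have "\<dots> \<le> ennreal (3 powr s) * ennreal (e / 3 powr s)"
      using C(2) by (intro mult_left_mono order_trans[OF C(2)] ennreal_leI) (auto simp: \<epsilon>_def)
    also have "\<dots> = ennreal e" using e by (simp add: ennreal_mult[symmetric])
    finally show ?thesis by simp
  qed
  then show "hausdorff_premeasure s \<delta> A = 0"
    using ennreal_le_epsilon[of 0 "hausdorff_premeasure s \<delta> A"] by simp
qed

text \<open>A Frostman measure, recorded through its values on dyadic cells only.\<close>

locale frostman_weights =
  fixes \<nu> :: "nat \<Rightarrow> int ^ 3 \<Rightarrow> real" and s :: real and z :: "int ^ 3"
  assumes s_pos: "0 < s" and nonneg: "\<And>n b. 0 \<le> \<nu> n b"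
    and upper: "\<And>n b. \<nu> n b \<le> 2 powr (- (s * real n))"
    and off_root: "\<And>b. b \<noteq> z \<Longrightarrow> \<nu> 0 b = 0"
    and additive: "\<And>n b. \<nu> n b = (\<Sum>b' | cell_parent b' = b. \<nu> (Suc n) b')"

text \<open>The values \<phi> are limits of the contents of \<open>A k\<close> within a cell, for
  the decreasing sets \<open>A k\<close> produced by capacitability. Subadditivity survives the
  limit because a cell has finitely many children, and the flow makes it additive. A cell of
  positive mass meets every \<open>A k\<close>, hence its closure meets \<open>K'\<close>; this is
  the only link between the masses and \<open>K'\<close>.\<close>

lemma frostman:
  assumes K: "K \<in> sets (borel :: (real ^ 3) measure)" and s: "0 < s" and pos: "hausdorff_measure s K \<noteq> 0"
  shows "\<exists>z K' \<nu>. frostman_weights \<nu> s z \<and> 0 < \<nu> 0 z \<and> compact K' \<and> K' \<subseteq> K \<and>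
    (\<forall>n b. 0 < \<nu> n b \<longrightarrow> K' \<inter> closed_cell n b \<noteq> {})"
proof -
  \<comment> \<open>Some unit cell contains a non-null part of \<open>K\<close>; restricting to it
    gives boundedness and a single root.\<close>
  have "K = (\<Union>z. K \<inter> {x. cell 0 x = z})" by auto
  then have "\<exists>z. hausdorff_measure s (K \<inter> {x. cell 0 x = z}) \<noteq> 0"
    using hausdorff_measure_null_countable_UN[of UNIV s "\<lambda>z. K \<inter> {x. cell 0 x = z}"] pos by auto
  then obtain z where z: "cells.content s (K \<inter> {x. cell 0 x = z}) \<noteq> 0"
    using content_null_imp_hausdorff_null[OF s] by blast
  define X where "X = K \<inter> {x. cell 0 x = z}"
  have "{x. cell 0 x = z} = (\<Inter>i. {x. of_int (z $ i) \<le> x $ i} \<inter> {x. x $ i < of_int (z $ i) + 1})"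
    by (auto simp: cell_def vec_eq_iff floor_eq_iff)
  also have "\<dots> \<in> sets borel"
    by (intro sets.countable_INT'' sets.Int borel_closed borel_open closed_Collect_le open_Collect_less continuous_intros) auto
  finally have X: "X \<in> sets borel" using K by (simp add: X_def)
  have bX: "bounded X"
    by (rule bounded_subset[OF bounded_closed_cell[of 0 z]]) (auto simp: X_def cell_subset_closed_cell)
  obtain c where c: "0 < c" "c < cells.content s X"
    using z dense[of 0 "cells.content s X"] by (auto simp: X_def zero_less_iff_neq_zero)
  have cont: "\<exists>n. c < cells.content s (B n)"
    if "incseq B" "c < cells.content s (\<Union>n. B n)" for B :: "nat \<Rightarrow> (real ^ 3) set"
  proof (rule ccontr)
    assume "\<nexists>n. c < cells.content s (B n)"
    then have "cells.content s (\<Union>n. B n) \<le> c"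
      using that(1) c(2) by (intro cells.content_UN_incseq) (auto simp: not_less top.not_eq_extremum[symmetric])
    then show False using that(2) by simp
  qed
  obtain A K' where AK: "compact K'" "K' \<subseteq> X" "decseq A" "\<And>k::nat. A k \<subseteq> X" "\<And>k. c < cells.content s (A k)"
    "\<And>B. closed B \<Longrightarrow> (\<And>k. A k \<inter> B \<noteq> {}) \<Longrightarrow> K' \<inter> B \<noteq> {}"
    using analytic_capacity[where M = "cells.content s", OF analytic_set_borel[OF X] bX c(2) cont] by auto
  \<comment> \<open>The infimum over the sets \<open>A k\<close> replaces the content of
    \<open>K'\<close>, as content need not be continuous along decreasing sets.\<close>
  define \<Phi> where "\<Phi> n b = (INF k. cells.content s (A k \<inter> {x. cell n x = b}))" for n b
  have lim: "(\<lambda>k. cells.content s (A k \<inter> {x. cell n x = b})) \<longlonglongrightarrow> \<Phi> n b" for n b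
    unfolding \<Phi>_def using AK(3) by (intro LIMSEQ_INF) (auto simp: decseq_def intro!: cells.content_mono)
  have \<Phi>_le: "\<Phi> n b \<le> cell_weight s n" for n b
    unfolding \<Phi>_def by (rule INF_lower2[of 0]) (auto intro: cells.content_cell)
  define \<phi> where "\<phi> n b = enn2real (\<Phi> n b)" for n b
  have \<phi>: "ennreal (\<phi> n b) = \<Phi> n b" for n b
    unfolding \<phi>_def using \<Phi>_le[of n b] by (intro ennreal_enn2real) (auto simp: less_top[symmetric] top_unique)
  have \<phi>_nonneg: "0 \<le> \<phi> n b" for n b by (simp add: \<phi>_def)
  have sub: "\<phi> n b \<le> (\<Sum>b' | cell_parent b' = b. \<phi> (Suc n) b')" for n b
  proof -
    have "\<Phi> n b \<le> (\<Sum>b' | cell_parent b' = b. \<Phi> (Suc n) b')"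
    proof (rule LIMSEQ_le[OF lim])
      show "(\<lambda>k. \<Sum>b' | cell_parent b' = b. cells.content s (A k \<inter> {x. cell (Suc n) x = b'}))
          \<longlonglongrightarrow> (\<Sum>b' | cell_parent b' = b. \<Phi> (Suc n) b')"
        by (intro tendsto_sum lim)
      have "A k \<inter> {x. cell n x = b} \<subseteq> (\<Union>b'\<in>{b'. cell_parent b' = b}. A k \<inter> {x. cell (Suc n) x = b'})" for k
        using cell_parent_cell by auto
      then have "cells.content s (A k \<inter> {x. cell n x = b}) \<le>
          (\<Sum>b' | cell_parent b' = b. cells.content s (A k \<inter> {x. cell (Suc n) x = b'}))" for k
        by (rule order_trans[OF cells.content_mono cells.content_UN_finite[OF finite_cell_children]])
      then show "\<exists>N. \<forall>k\<ge>N. cells.content s (A k \<inter> {x. cell n x = b}) \<le>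
          (\<Sum>b' | cell_parent b' = b. cells.content s (A k \<inter> {x. cell (Suc n) x = b'}))" by blast
    qed
    then have "ennreal (\<phi> n b) \<le> ennreal (\<Sum>b' | cell_parent b' = b. \<phi> (Suc n) b')"
      by (simp add: \<phi>[symmetric] sum_ennreal \<phi>_nonneg)
    then show ?thesis by (simp add: ennreal_le_iff sum_nonneg \<phi>_nonneg)
  qed
  obtain \<nu> where \<nu>: "\<And>n b. 0 \<le> \<nu> n b" "\<And>n b. \<nu> n b \<le> \<phi> n b" "\<And>b. \<nu> 0 b = \<phi> 0 b"
    "\<And>n b. \<nu> n b = (\<Sum>b' | cell_parent b' = b. \<nu> (Suc n) b')"
    using additive_flow[of \<phi> cell_parent, OF \<phi>_nonneg finite_cell_children sub] by metis
  show ?thesis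
  proof (intro exI conjI allI impI)
    show "compact K'" by (rule AK(1))
    show "K' \<subseteq> K" using AK(2) by (auto simp: X_def)
    have root: "\<nu> 0 b = 0" if "b \<noteq> z" for b
    proof -
      have "A 0 \<inter> {x. cell 0 x = b} = {}" using AK(4)[of 0] that by (auto simp: X_def)
      then have "\<Phi> 0 b \<le> 0" unfolding \<Phi>_def by (intro INF_lower2[of 0]) (auto simp: cells.content_empty)
      then show ?thesis by (simp add: \<nu>(3) \<phi>_def)
    qed
    show "frostman_weights \<nu> s z"
    proof
      show "\<nu> n b \<le> 2 powr (- (s * real n))" for n b
        using \<nu>(2)[of n b] \<Phi>_le[of n b] by (simp add: \<phi>[symmetric])
    qed (rule s \<nu>(1) \<nu>(4) root, assumption?)+
    have "A k \<inter> {x. cell 0 x = z} = A k" for k using AK(4)[of k] by (auto simp: X_def)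
    moreover have "c \<le> (INF k. cells.content s (A k))"
      using AK(5) by (intro INF_greatest less_imp_le) auto
    ultimately have "c \<le> \<Phi> 0 z" by (simp add: \<Phi>_def)
    then have "0 < ennreal (\<phi> 0 z)" using c(1) by (simp add: \<phi> del: ennreal_less_zero_iff)
    then show "0 < \<nu> 0 z" by (simp add: \<nu>(3))
    fix n b assume pos: "0 < \<nu> n b"
    have "A k \<inter> {x. cell n x = b} \<noteq> {}" for k
    proof
      assume "A k \<inter> {x. cell n x = b} = {}"
      then have "\<Phi> n b \<le> 0" unfolding \<Phi>_def by (intro INF_lower2[of k]) (auto simp: cells.content_empty)
      then show False using pos \<nu>(2)[of n b] by (simp add: \<phi>_def)
    qed
    then have "A k \<inter> closed_cell n b \<noteq> {}" for k using cell_subset_closed_cell by blast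
    then show "K' \<inter> closed_cell n b \<noteq> {}" by (rule AK(6)[OF closed_closed_cell])
  qed
qed

section \<open>Masses of families of cells and of balls\<close>

context frostman_weights begin

lemma finite_descendants: "finite {b. (cell_parent ^^ k) b = a}"
proof (induction k)
  case (Suc k)
  have "{b. (cell_parent ^^ Suc k) b = a} = (\<Union>b'\<in>{b'. (cell_parent ^^ k) b' = a}. {b. cell_parent b = b'})"
    by (auto simp: funpow_swap1)
  then show ?case using Suc finite_cell_children by simp
qed simp

lemma sum_descendants: "(\<Sum>b | (cell_parent ^^ k) b = a. \<nu> (n + k) b) = \<nu> n a"
proof (induction k)
  case (Suc k)
  have "{b. (cell_parent ^^ Suc k) b = a} = (\<Union>b'\<in>{b'. (cell_parent ^^ k) b' = a}. {b. cell_parent b = b'})"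
    by (auto simp: funpow_swap1)
  then have "(\<Sum>b | (cell_parent ^^ Suc k) b = a. \<nu> (n + Suc k) b)
      = (\<Sum>b' | (cell_parent ^^ k) b' = a. \<Sum>b | cell_parent b = b'. \<nu> (n + Suc k) b)"
    by (simp only:) (rule sum.UNION_disjoint, auto simp: finite_descendants finite_cell_children)
  also have "\<dots> = (\<Sum>b' | (cell_parent ^^ k) b' = a. \<nu> (n + k) b')"
    using additive[of "n + k"] by simp
  finally show ?case using Suc by simp
qed simp

lemma sum_le_ancestors:
  assumes "finite B"
  shows "(\<Sum>b\<in>B. \<nu> (n + k) b) \<le> (\<Sum>a\<in>(cell_parent ^^ k) ` B. \<nu> n a)"
proof -
  have "(\<Sum>b\<in>B. \<nu> (n + k) b) = (\<Sum>a\<in>(cell_parent ^^ k) ` B. \<Sum>b | b \<in> B \<and> (cell_parent ^^ k) b = a. \<nu> (n + k) b)"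
    using assms by (rule sum.image_gen)
  also have "\<dots> \<le> (\<Sum>a\<in>(cell_parent ^^ k) ` B. \<Sum>b | (cell_parent ^^ k) b = a. \<nu> (n + k) b)"
    by (intro sum_mono sum_mono2 finite_descendants nonneg) auto
  finally show ?thesis by (simp add: sum_descendants)
qed

definition cells_at :: "nat \<Rightarrow> (int ^ 3) set" where
  "cells_at n = {b. (cell_parent ^^ n) b = z}"

lemma finite_cells_at: "finite (cells_at n)"
  unfolding cells_at_def by (rule finite_descendants)

lemma sum_cells_at: "(\<Sum>b\<in>cells_at n. \<nu> n b) = \<nu> 0 z"
  unfolding cells_at_def using sum_descendants[where k = n and a = z and n = 0] by simp

lemma root_le_1: "\<nu> 0 z \<le> 1"
  using upper[of 0 z] by simp

text \<open>For r < 1 the cells in question have at most 5^3 ancestors in the generation m with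
  2^(-m) comparable to r, each of mass at most 2^(-s m). For larger r the total mass, at most 1,
  suffices.\<close>

lemma ball_bound:
  assumes r: "1 / 2 ^ j \<le> r"
  shows "(\<Sum>b | b \<in> cells_at j \<and> norm (corner j b - y) \<le> r. \<nu> j b) \<le> 125 * 2 powr s * r powr s"
proof -
  let ?B = "{b \<in> cells_at j. norm (corner j b - y) \<le> r}"
  have fin: "finite ?B" using finite_cells_at by simp
  have r0: "0 < r" using r by (smt (verit) divide_pos_pos zero_less_power)
  have two: "1 \<le> 2 powr s" using s_pos by (simp add: ge_one_powr_ge_zero)
  show ?thesis
  proof (cases "1 \<le> r")
    case True
    have "(\<Sum>b\<in>?B. \<nu> j b) \<le> (\<Sum>b\<in>cells_at j. \<nu> j b)"
      by (intro sum_mono2 finite_cells_at nonneg) auto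
    also have "\<dots> \<le> 1" using sum_cells_at root_le_1 by simp
    also have "1 \<le> r powr s" using True s_pos by (simp add: ge_one_powr_ge_zero)
    also have "\<dots> \<le> 125 * 2 powr s * r powr s" using two mult_right_mono[of 1 "125 * 2 powr s" "r powr s"] by simp
    finally show ?thesis by simp
  next
    case False
    obtain m where m1: "1 / 2 ^ Suc m < r" and m2: "r \<le> 1 / 2 ^ m"
      using dyadic_bracket[of r] r0 False by force
    have "1 / 2 ^ j \<le> (1 / 2 ^ m :: real)" using r m2 by linarith
    then have mj: "m \<le> j" by (simp add: field_simps)
    define k where "k = j - m"
    have j: "j = m + k" using mj by (simp add: k_def)
    have "(\<Sum>b\<in>?B. \<nu> j b) \<le> (\<Sum>a\<in>(cell_parent ^^ k) ` ?B. \<nu> m a)"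
      using sum_le_ancestors[OF fin, of m k] j by simp
    also have "\<dots> \<le> (\<Sum>a\<in>(cell_parent ^^ k) ` ?B. 2 powr (- (s * real m)))"
      by (intro sum_mono upper)
    also have "\<dots> = real (card ((cell_parent ^^ k) ` ?B)) * 2 powr (- (s * real m))" by simp
    also have "\<dots> \<le> 125 * 2 powr (- (s * real m))"
    proof (intro mult_right_mono)
      \<comment> \<open>Scaled by 2^m, the corners are within 1 of \<open>y\<close> in each
        coordinate and rounding down loses at most 1 more, which leaves five integers per
        axis.\<close>
      define lo where "lo i = \<lceil>2 ^ m * y $ i - 2\<rceil>" for i
      define hi where "hi i = \<lfloor>2 ^ m * y $ i + 2\<rfloor>" for i
      have sub: "(cell_parent ^^ k) ` ?B \<subseteq> {a. \<forall>i. lo i \<le> a $ i \<and> a $ i \<le> hi i}"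
      proof safe
        fix b i assume b: "norm (corner j b - y) \<le> r"
        have "(cell_parent ^^ k) b = cell m (corner j b)"
          using cells.par_funpow_f[of k m "corner j b"] by (simp add: cell_corner flip: j)
        then have a: "(cell_parent ^^ k) b $ i = \<lfloor>2 ^ m * corner j b $ i\<rfloor>" by (simp add: cell_def)
        have "\<bar>(corner j b - y) $ i\<bar> \<le> r" using component_le_norm_cart[of "corner j b - y" i] b by linarith
        then have "\<bar>corner j b $ i - y $ i\<bar> \<le> 1 / 2 ^ m" using m2 by simp
        then have "2 ^ m * \<bar>corner j b $ i - y $ i\<bar> \<le> 1" by (simp add: field_simps)
        then have "\<bar>2 ^ m * corner j b $ i - 2 ^ m * y $ i\<bar> \<le> 1"
          by (simp add: abs_mult right_diff_distrib[symmetric])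
        then show "lo i \<le> (cell_parent ^^ k) b $ i" "(cell_parent ^^ k) b $ i \<le> hi i"
          unfolding a lo_def hi_def by linarith+
      qed
      have "hi i - lo i + 1 \<le> int 5" for i unfolding hi_def lo_def by linarith
      from card_mono[OF int_box_card(1)[of hi lo 5, OF this] sub] int_box_card(2)[of hi lo 5, OF this]
      have "card ((cell_parent ^^ k) ` ?B) \<le> 5 ^ 3" by linarith
      then show "real (card ((cell_parent ^^ k) ` ?B)) \<le> 125" by simp
    qed simp
    also have "2 powr (- (s * real m)) \<le> (2 * r) powr s"
    proof -
      have "2 powr (- real m) \<le> 2 * r" using m1 by (simp add: powr_minus powr_realpow field_simps)
      then have "(2 powr (- real m)) powr s \<le> (2 * r) powr s" using s_pos by (intro powr_mono2) auto
      then show ?thesis by (simp add: powr_powr mult.commute)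
    qed
    also have "125 * (2 * r) powr s = 125 * 2 powr s * r powr s" using r0 by (simp add: powr_mult)
    finally show ?thesis by simp
  qed
qed

end

section \<open>Tangency geometry of the circle of directions\<close>

lemma abs_sin_ge:
  assumes "\<bar>x\<bar> \<le> (1::real)" shows "\<bar>x\<bar> / 2 \<le> \<bar>sin x\<bar>"
proof -
  have *: "y / 2 \<le> sin y" if "0 \<le> y" "y \<le> 1" for y :: real
  proof (cases "y = 0")
    case False
    then have "0 < y" using that by simp
    then obtain \<xi> where \<xi>: "0 < \<xi>" "\<xi> < y" "sin y - sin 0 = (y - 0) * cos \<xi>"
      using MVT2[of 0 y sin cos, OF _ DERIV_sin] by blast
    have "cos (pi / 3) \<le> cos \<xi>"
      using \<xi> that pi_gt3 by (intro cos_monotone_0_pi_le) auto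
    then have "1 / 2 \<le> cos \<xi>" by (simp add: cos_60)
    then have "y * (1 / 2) \<le> y * cos \<xi>" using that by (intro mult_left_mono)
    then show ?thesis using \<xi> by simp
  qed simp
  show ?thesis using *[of x] *[of "-x"] assms by (cases "0 \<le> x") auto
qed

text \<open>\<open>n\<close> is the unit normal of the plane, \<open>h\<close> its distance from the
  origin and \<open>R\<close> the radius of the circle of directions. \<open>0 < h\<close> says that
  the plane misses the origin, \<open>0 < R\<close> that it is not tangent to the sphere.\<close>

locale circle_frame =
  fixes n u v :: "real ^ 3" and h R :: real
  assumes n: "n \<bullet> n = 1" and u: "u \<bullet> u = 1" and v: "v \<bullet> v = 1"
    and nu: "n \<bullet> u = 0" and nv: "n \<bullet> v = 0" and uv: "u \<bullet> v = 0"
    and expand: "\<And>x. x = (x \<bullet> n) *\<^sub>R n + (x \<bullet> u) *\<^sub>R u + (x \<bullet> v) *\<^sub>R v"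
    and h: "0 < h" and R: "0 < R" and hR: "h\<^sup>2 + R\<^sup>2 = 1"
begin

lemma orthonormal: "u \<bullet> n = 0" "v \<bullet> n = 0" "v \<bullet> u = 0"
  using nu nv uv by (simp_all add: inner_commute)

lemma inner_expand: "x \<bullet> y = (x \<bullet> n) * (y \<bullet> n) + (x \<bullet> u) * (y \<bullet> u) + (x \<bullet> v) * (y \<bullet> v)"
proof -
  have "x \<bullet> y = ((x \<bullet> n) *\<^sub>R n + (x \<bullet> u) *\<^sub>R u + (x \<bullet> v) *\<^sub>R v) \<bullet> y"
    by (rule arg_cong[where f = "\<lambda>t. t \<bullet> y", OF expand])
  then show ?thesis unfolding inner_add_left inner_scaleR_left inner_commute[of y] .
qed

lemma h_le_1: "h \<le> 1" and R_le_1: "R \<le> 1"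
proof -
  have "h\<^sup>2 \<le> 1" "R\<^sup>2 \<le> 1" using hR zero_le_power2[of h] zero_le_power2[of R] by linarith+
  then show "h \<le> 1" "R \<le> 1" by (simp_all add: abs_square_le_1)
qed

definition \<gamma> :: "real \<Rightarrow> real ^ 3" where
  "\<gamma> \<theta> = h *\<^sub>R n + (R * cos \<theta>) *\<^sub>R u + (R * sin \<theta>) *\<^sub>R v"

lemma \<gamma>_inner: "\<gamma> \<theta> \<bullet> n = h" "\<gamma> \<theta> \<bullet> u = R * cos \<theta>" "\<gamma> \<theta> \<bullet> v = R * sin \<theta>"
  by (simp_all add: \<gamma>_def inner_add_left n u v nu nv uv orthonormal)

lemma norm_\<gamma>: "norm (\<gamma> \<theta>) = 1"
proof -
  have "\<gamma> \<theta> \<bullet> \<gamma> \<theta> = h\<^sup>2 + R\<^sup>2 * ((sin \<theta>)\<^sup>2 + (cos \<theta>)\<^sup>2)"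
    unfolding inner_expand[of "\<gamma> \<theta>" "\<gamma> \<theta>"] \<gamma>_inner by (simp only: power2_eq_square algebra_simps)
  then show ?thesis using hR by (simp add: norm_eq_sqrt_inner)
qed

lemma \<gamma>_diff: "(norm (\<gamma> \<theta> - \<gamma> \<phi>))\<^sup>2 = (2 * R * sin ((\<theta> - \<phi>) / 2))\<^sup>2"
proof -
  have "(norm (\<gamma> \<theta> - \<gamma> \<phi>))\<^sup>2 = R\<^sup>2 * ((cos \<theta> - cos \<phi>)\<^sup>2 + (sin \<theta> - sin \<phi>)\<^sup>2)"
    unfolding power2_norm_eq_inner inner_expand[of "\<gamma> \<theta> - \<gamma> \<phi>" "\<gamma> \<theta> - \<gamma> \<phi>"]
    unfolding inner_diff_left \<gamma>_inner by (simp only: power2_eq_square algebra_simps)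
  also have "(cos \<theta> - cos \<phi>)\<^sup>2 + (sin \<theta> - sin \<phi>)\<^sup>2 = 2 - 2 * cos (\<theta> - \<phi>)"
  proof -
    have "(cos \<theta> - cos \<phi>)\<^sup>2 + (sin \<theta> - sin \<phi>)\<^sup>2
        = ((sin \<theta>)\<^sup>2 + (cos \<theta>)\<^sup>2) + ((sin \<phi>)\<^sup>2 + (cos \<phi>)\<^sup>2) - 2 * (cos \<theta> * cos \<phi> + sin \<theta> * sin \<phi>)"
      by (simp add: power2_eq_square algebra_simps)
    then show ?thesis by (simp add: cos_diff)
  qed
  also have "cos (\<theta> - \<phi>) = 1 - 2 * (sin ((\<theta> - \<phi>) / 2))\<^sup>2"
  proof -
    have "2 * ((\<theta> - \<phi>) / 2) = \<theta> - \<phi>" by (simp add: diff_divide_distrib)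
    then show ?thesis using cos_double_sin[of "(\<theta> - \<phi>) / 2"] by (simp only:)
  qed
  finally show ?thesis by (simp add: power_mult_distrib)
qed

lemma \<gamma>_diff_norm: "norm (\<gamma> \<theta> - \<gamma> \<phi>) = 2 * R * \<bar>sin ((\<theta> - \<phi>) / 2)\<bar>"
  by (rule power2_eq_imp_eq) (use R in \<open>simp_all add: \<gamma>_diff power_mult_distrib\<close>)

lemma \<gamma>_lipschitz: "norm (\<gamma> \<theta> - \<gamma> \<phi>) \<le> \<bar>\<theta> - \<phi>\<bar>"
proof -
  have "norm (\<gamma> \<theta> - \<gamma> \<phi>) \<le> 2 * 1 * \<bar>(\<theta> - \<phi>) / 2\<bar>"
    unfolding \<gamma>_diff_norm using R R_le_1 abs_sin_x_le_abs_x[of "(\<theta> - \<phi>) / 2"] by (intro mult_mono) auto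
  then show ?thesis by simp
qed

lemma \<gamma>_separated: "\<bar>\<theta> - \<phi>\<bar> \<le> 1 \<Longrightarrow> R * \<bar>\<theta> - \<phi>\<bar> / 2 \<le> norm (\<gamma> \<theta> - \<gamma> \<phi>)"
  unfolding \<gamma>_diff_norm using abs_sin_ge[of "(\<theta> - \<phi>) / 2"] R by (simp add: field_simps)

text \<open>This is the form \<open>Q\<close> of the introduction: the circle \<open>\<gamma>\<close> spans its null cone.\<close>

definition cone_form :: "real ^ 3 \<Rightarrow> real ^ 3 \<Rightarrow> real" where
  "cone_form x y = (x \<bullet> n) * (y \<bullet> n) - h\<^sup>2 * (x \<bullet> y)"

lemma cone_form_simps:
  "cone_form (x + y) w = cone_form x w + cone_form y w"
  "cone_form w (x + y) = cone_form w x + cone_form w y"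
  "cone_form (c *\<^sub>R x) w = c * cone_form x w"
  "cone_form w (c *\<^sub>R x) = c * cone_form w x"
  "cone_form x y = cone_form y x"
  by (simp_all add: cone_form_def inner_add_left inner_add_right algebra_simps inner_commute)

lemma cone_form_\<gamma>: "cone_form (\<gamma> \<theta>) (\<gamma> \<theta>) = 0"
  using norm_\<gamma>[of \<theta>] by (simp add: cone_form_def \<gamma>_inner power2_eq_square norm_eq_1)

lemma cone_form_bound: "\<bar>cone_form x y\<bar> \<le> 2 * norm x * norm y"
proof -
  have n1: "norm n = 1" using n by (simp add: norm_eq_1)
  have "\<bar>(x \<bullet> n) * (y \<bullet> n)\<bar> \<le> norm x * norm y"
    using Cauchy_Schwarz_ineq2[of x n] Cauchy_Schwarz_ineq2[of y n] n1
    by (simp add: abs_mult mult_mono)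
  moreover have "\<bar>h\<^sup>2 * (x \<bullet> y)\<bar> \<le> 1 * (norm x * norm y)"
    unfolding abs_mult using h h_le_1 Cauchy_Schwarz_ineq2[of x y]
    by (intro mult_mono) (auto simp: power_le_one)
  ultimately show ?thesis unfolding cone_form_def by linarith
qed

lemma cone_form_\<gamma>_right:
  "cone_form x (\<gamma> \<theta>) = h * R * (R * (x \<bullet> n) - h * (x \<bullet> u) * cos \<theta> - h * (x \<bullet> v) * sin \<theta>)"
proof -
  have "cone_form x (\<gamma> \<theta>) = (1 - h\<^sup>2) * h * (x \<bullet> n) - h\<^sup>2 * (R * cos \<theta> * (x \<bullet> u) + R * sin \<theta> * (x \<bullet> v))"
    unfolding cone_form_def by (subst inner_expand[of x "\<gamma> \<theta>"]) (simp add: \<gamma>_inner algebra_simps power2_eq_square)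
  also have "1 - h\<^sup>2 = R\<^sup>2" using hR by simp
  finally show ?thesis by (simp add: algebra_simps power2_eq_square)
qed

text \<open>The difference of two values of the trigonometric polynomial is -2 sin((\<theta> -
  \<theta>')/2) times \<open>g\<close> at the midpoint, where \<open>g\<close> is minus the
  derivative. Two midpoints then give a linear system for \<open>b\<close> and \<open>c\<close> with
  determinant sin(\<open>?x - ?y\<close>). Each sine is at least \<rho>/4, whence 32 = 4 (4 + 4),
  and 65 = 1 + 32 + 32.\<close>

lemma trig_interpolation:
  fixes p b c :: real
  assumes f: "\<And>\<theta>. \<theta> \<in> {\<theta>1, \<theta>2, \<theta>3} \<Longrightarrow> \<bar>p + b * cos \<theta> + c * sin \<theta>\<bar> \<le> \<epsilon>"
    and sep: "\<rho> \<le> \<bar>\<theta>1 - \<theta>2\<bar>" "\<rho> \<le> \<bar>\<theta>1 - \<theta>3\<bar>" "\<rho> \<le> \<bar>\<theta>2 - \<theta>3\<bar>"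
    and close: "\<bar>\<theta>1 - \<theta>2\<bar> \<le> 1" "\<bar>\<theta>1 - \<theta>3\<bar> \<le> 1" "\<bar>\<theta>2 - \<theta>3\<bar> \<le> 1" and \<rho>: "0 < \<rho>"
  shows "\<bar>b\<bar> \<le> 32 * \<epsilon> / \<rho>\<^sup>2 \<and> \<bar>c\<bar> \<le> 32 * \<epsilon> / \<rho>\<^sup>2 \<and> \<bar>p\<bar> \<le> 65 * \<epsilon> / \<rho>\<^sup>2"
proof -
  define g where "g \<phi> = b * sin \<phi> - c * cos \<phi>" for \<phi>
  have \<epsilon>: "0 \<le> \<epsilon>" using f[of \<theta>1] by simp
  have \<rho>1: "\<rho> \<le> 1" using sep(1) close(1) by linarith
  have sin_ge: "\<rho> / 4 \<le> \<bar>sin ((\<theta> - \<theta>') / 2)\<bar>" if "\<rho> \<le> \<bar>\<theta> - \<theta>'\<bar>" "\<bar>\<theta> - \<theta>'\<bar> \<le> 1" for \<theta> \<theta>' :: real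
    using abs_sin_ge[of "(\<theta> - \<theta>') / 2"] that by (simp add: field_simps)
  have g_le: "\<bar>g ((\<theta> + \<theta>') / 2)\<bar> \<le> 4 * \<epsilon> / \<rho>"
    if "\<theta> \<in> {\<theta>1, \<theta>2, \<theta>3}" "\<theta>' \<in> {\<theta>1, \<theta>2, \<theta>3}" "\<rho> \<le> \<bar>\<theta> - \<theta>'\<bar>" "\<bar>\<theta> - \<theta>'\<bar> \<le> 1" for \<theta> \<theta>'
  proof -
    have "2 * sin ((\<theta> - \<theta>') / 2) * g ((\<theta> + \<theta>') / 2) = - ((p + b * cos \<theta> + c * sin \<theta>) - (p + b * cos \<theta>' + c * sin \<theta>'))"
    proof -
      have "sin ((\<theta>' - \<theta>) / 2) = - sin ((\<theta> - \<theta>') / 2)"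
        by (simp only: sin_minus[symmetric]) (simp add: diff_divide_distrib)
      then have "cos \<theta> = cos \<theta>' - 2 * sin ((\<theta> + \<theta>') / 2) * sin ((\<theta> - \<theta>') / 2)"
        "sin \<theta> = sin \<theta>' + 2 * sin ((\<theta> - \<theta>') / 2) * cos ((\<theta> + \<theta>') / 2)"
        using cos_diff_cos[of \<theta> \<theta>'] sin_diff_sin[of \<theta> \<theta>'] by simp_all
      then show ?thesis unfolding g_def by (simp add: distrib_left distrib_right right_diff_distrib)
    qed
    then have "2 * \<bar>sin ((\<theta> - \<theta>') / 2)\<bar> * \<bar>g ((\<theta> + \<theta>') / 2)\<bar> \<le> 2 * \<epsilon>"
      using f[OF that(1)] f[OF that(2)] by (simp add: abs_mult[symmetric] del: abs_mult)
    moreover have "2 * (\<rho> / 4) * \<bar>g ((\<theta> + \<theta>') / 2)\<bar> \<le> 2 * \<bar>sin ((\<theta> - \<theta>') / 2)\<bar> * \<bar>g ((\<theta> + \<theta>') / 2)\<bar>"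
      using sin_ge[OF that(3,4)] by (intro mult_right_mono) auto
    ultimately show ?thesis using \<rho> by (simp add: field_simps)
  qed
  let ?x = "(\<theta>1 + \<theta>2) / 2" and ?y = "(\<theta>1 + \<theta>3) / 2"
  have gx: "\<bar>g ?x\<bar> \<le> 4 * \<epsilon> / \<rho>" and gy: "\<bar>g ?y\<bar> \<le> 4 * \<epsilon> / \<rho>"
    using sep close by (auto intro!: g_le)
  have xy: "?x - ?y = (\<theta>2 - \<theta>3) / 2" by (simp add: add_divide_distrib diff_divide_distrib)
  have solve: "\<bar>t\<bar> \<le> 32 * \<epsilon> / \<rho>\<^sup>2"
    if t: "t * sin (?x - ?y) = g ?x * k - g ?y * l" and kl: "\<bar>k\<bar> \<le> 1" "\<bar>l\<bar> \<le> 1" for t k l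
  proof -
    have "\<bar>t\<bar> * (\<rho> / 4) \<le> \<bar>t\<bar> * \<bar>sin (?x - ?y)\<bar>"
      unfolding xy using sin_ge sep close by (intro mult_left_mono) auto
    also have "\<dots> = \<bar>g ?x * k - g ?y * l\<bar>" using t by (simp add: abs_mult[symmetric])
    also have "\<dots> \<le> \<bar>g ?x\<bar> * \<bar>k\<bar> + \<bar>g ?y\<bar> * \<bar>l\<bar>" by (metis abs_mult abs_triangle_ineq4)
    also have "\<dots> \<le> (4 * \<epsilon> / \<rho>) * 1 + (4 * \<epsilon> / \<rho>) * 1"
      using gx gy kl \<epsilon> \<rho> by (intro add_mono mult_mono) auto
    finally show ?thesis using \<rho> by (simp add: field_simps power2_eq_square)
  qed
  have b: "\<bar>b\<bar> \<le> 32 * \<epsilon> / \<rho>\<^sup>2"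
    by (rule solve[of _ "cos ?y" "cos ?x"]) (auto simp only: g_def sin_diff abs_cos_le_one, simp add: algebra_simps)
  have c: "\<bar>c\<bar> \<le> 32 * \<epsilon> / \<rho>\<^sup>2"
    by (rule solve[of _ "sin ?y" "sin ?x"]) (auto simp only: g_def sin_diff abs_sin_le_one, simp add: algebra_simps)
  have "\<bar>p\<bar> \<le> \<bar>p + b * cos \<theta>1 + c * sin \<theta>1\<bar> + \<bar>b * cos \<theta>1\<bar> + \<bar>c * sin \<theta>1\<bar>" by linarith
  also have "\<dots> \<le> \<epsilon> + \<bar>b\<bar> * 1 + \<bar>c\<bar> * 1"
    unfolding abs_mult using f[of \<theta>1] by (intro add_mono mult_left_mono) auto
  also have "\<dots> \<le> \<epsilon> / \<rho>\<^sup>2 + 32 * \<epsilon> / \<rho>\<^sup>2 + 32 * \<epsilon> / \<rho>\<^sup>2"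
  proof -
    have "\<epsilon> * \<rho>\<^sup>2 \<le> \<epsilon> * 1" using \<epsilon> \<rho> \<rho>1 by (intro mult_left_mono) (auto simp: power_le_one)
    then have "\<epsilon> \<le> \<epsilon> / \<rho>\<^sup>2" using \<rho> by (simp add: field_simps)
    then show ?thesis using b c by linarith
  qed
  finally show ?thesis using b c by simp
qed

text \<open>129 = 65 + 32 + 32 adds the three coordinate bounds of
  \<open>trig_interpolation\<close>. One factor h R in the denominator comes from
  \<open>cone_form_\<gamma>_right\<close>, the other from the coefficients h and R of the
  coordinates.\<close>

definition nondeg_const :: real where "nondeg_const = 129 / (h\<^sup>2 * R\<^sup>2)"

lemma nondeg_const_pos: "0 < nondeg_const"
  using h R by (simp add: nondeg_const_def)

text \<open>Three well separated directions of the circle span space quantitatively, because the circle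
  does not lie in a plane through the origin.\<close>

lemma cone_form_nondegenerate:
  assumes f: "\<And>\<theta>. \<theta> \<in> {\<theta>1, \<theta>2, \<theta>3} \<Longrightarrow> \<bar>cone_form x (\<gamma> \<theta>)\<bar> \<le> \<epsilon>"
    and sep: "\<rho> \<le> \<bar>\<theta>1 - \<theta>2\<bar>" "\<rho> \<le> \<bar>\<theta>1 - \<theta>3\<bar>" "\<rho> \<le> \<bar>\<theta>2 - \<theta>3\<bar>"
    and close: "\<bar>\<theta>1 - \<theta>2\<bar> \<le> 1" "\<bar>\<theta>1 - \<theta>3\<bar> \<le> 1" "\<bar>\<theta>2 - \<theta>3\<bar> \<le> 1" and \<rho>: "0 < \<rho>"
  shows "norm x \<le> nondeg_const * \<epsilon> / \<rho>\<^sup>2"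
proof -
  define \<epsilon>' where "\<epsilon>' = \<epsilon> / (h * R)"
  have \<epsilon>: "0 \<le> \<epsilon>" using f[of \<theta>1] by simp
  have \<epsilon>': "0 \<le> \<epsilon>'" using \<epsilon> h R by (simp add: \<epsilon>'_def)
  have "\<bar>R * (x \<bullet> n) + (- h * (x \<bullet> u)) * cos \<theta> + (- h * (x \<bullet> v)) * sin \<theta>\<bar> \<le> \<epsilon>'" if "\<theta> \<in> {\<theta>1, \<theta>2, \<theta>3}" for \<theta>
  proof -
    have "h * R * \<bar>R * (x \<bullet> n) - h * (x \<bullet> u) * cos \<theta> - h * (x \<bullet> v) * sin \<theta>\<bar> \<le> \<epsilon>"
      using f[OF that] h R unfolding cone_form_\<gamma>_right abs_mult by simp
    then show ?thesis using h R by (simp add: \<epsilon>'_def pos_le_divide_eq mult.commute)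
  qed
  from trig_interpolation[OF this sep close \<rho>]
  have b: "h * \<bar>x \<bullet> u\<bar> \<le> 32 * \<epsilon>' / \<rho>\<^sup>2" "h * \<bar>x \<bullet> v\<bar> \<le> 32 * \<epsilon>' / \<rho>\<^sup>2" "R * \<bar>x \<bullet> n\<bar> \<le> 65 * \<epsilon>' / \<rho>\<^sup>2"
    using h R by (auto simp: abs_mult)
  have "h * R * norm x \<le> h * R * (\<bar>x \<bullet> n\<bar> + \<bar>x \<bullet> u\<bar> + \<bar>x \<bullet> v\<bar>)"
  proof (rule mult_left_mono)
    have "norm x \<le> norm ((x \<bullet> n) *\<^sub>R n) + norm ((x \<bullet> u) *\<^sub>R u) + norm ((x \<bullet> v) *\<^sub>R v)"
      by (subst expand) (metis (no_types) add_mono_thms_linordered_semiring(3) norm_triangle_ineq order_trans)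
    then show "norm x \<le> \<bar>x \<bullet> n\<bar> + \<bar>x \<bullet> u\<bar> + \<bar>x \<bullet> v\<bar>"
      using n u v by (simp add: norm_eq_sqrt_inner)
  qed (use h R in simp)
  also have "\<dots> = h * (R * \<bar>x \<bullet> n\<bar>) + R * (h * \<bar>x \<bullet> u\<bar>) + R * (h * \<bar>x \<bullet> v\<bar>)" by (simp add: algebra_simps)
  also have "\<dots> \<le> 1 * (65 * \<epsilon>' / \<rho>\<^sup>2) + 1 * (32 * \<epsilon>' / \<rho>\<^sup>2) + 1 * (32 * \<epsilon>' / \<rho>\<^sup>2)"
    using b h R h_le_1 R_le_1 by (intro add_mono mult_mono) auto
  finally have "h * R * norm x \<le> 129 * \<epsilon>' / \<rho>\<^sup>2" by simp
  then have "norm x \<le> 129 * \<epsilon>' / \<rho>\<^sup>2 / (h * R)" using h R by (subst pos_le_divide_eq) (simp_all add: ac_simps)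
  also have "\<dots> = nondeg_const * \<epsilon> / \<rho>\<^sup>2"
    by (simp add: nondeg_const_def \<epsilon>'_def power2_eq_square)
  finally show ?thesis .
qed

definition near_line :: "real \<Rightarrow> real \<Rightarrow> real ^ 3 \<Rightarrow> bool" where
  "near_line \<theta> r x \<longleftrightarrow> norm (x - (x \<bullet> \<gamma> \<theta>) *\<^sub>R \<gamma> \<theta>) \<le> r"

text \<open>Write \<open>x\<close> as a multiple of the null vector \<open>\<gamma> \<theta>\<close>
  plus an error of length at most \<open>r\<close>. The quadratic term of the null vector vanishes,
  and the rest is at most 4 r d + 2 r^2.\<close>

lemma near_line_cone_form:
  assumes "near_line \<theta> r x" "norm x \<le> d" "4 * r \<le> d"
  shows "\<bar>cone_form x x\<bar> \<le> 5 * r * d"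
proof -
  define a where "a = x \<bullet> \<gamma> \<theta>"
  define y where "y = x - a *\<^sub>R \<gamma> \<theta>"
  have y: "norm y \<le> r" using assms by (simp add: near_line_def y_def a_def)
  have r: "0 \<le> r" using y norm_ge_zero order_trans by blast
  have a: "\<bar>a\<bar> \<le> d" using Cauchy_Schwarz_ineq2[of x "\<gamma> \<theta>"] assms(2) by (simp add: a_def norm_\<gamma>)
  have x: "x = a *\<^sub>R \<gamma> \<theta> + y" by (simp add: y_def)
  have "cone_form x x = 2 * a * cone_form (\<gamma> \<theta>) y + cone_form y y"
  proof -
    have "cone_form (a *\<^sub>R \<gamma> \<theta> + y) (a *\<^sub>R \<gamma> \<theta> + y) = 2 * a * cone_form (\<gamma> \<theta>) y + cone_form y y"
      using cone_form_\<gamma>[of \<theta>] cone_form_simps(5)[of y "\<gamma> \<theta>"] by (simp add: cone_form_simps(1-4))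
    then show ?thesis unfolding x[symmetric] .
  qed
  also have "\<bar>\<dots>\<bar> \<le> 2 * \<bar>a\<bar> * \<bar>cone_form (\<gamma> \<theta>) y\<bar> + \<bar>cone_form y y\<bar>"
    using abs_triangle_ineq[of "2 * a * cone_form (\<gamma> \<theta>) y" "cone_form y y"] by (simp add: abs_mult)
  also have "\<dots> \<le> 2 * d * (2 * 1 * r) + 2 * r * r"
  proof (intro add_mono mult_mono)
    show "\<bar>cone_form (\<gamma> \<theta>) y\<bar> \<le> 2 * 1 * r" using cone_form_bound[of "\<gamma> \<theta>" y] y by (simp add: norm_\<gamma>)
    have "2 * norm y * norm y \<le> 2 * r * r" using y r by (intro mult_mono) auto
    then show "\<bar>cone_form y y\<bar> \<le> 2 * r * r" using cone_form_bound[of y y] by linarith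
  qed (use a assms r in auto)
  also have "\<dots> \<le> 5 * r * d"
  proof -
    have "r * (4 * r) \<le> r * d" using assms r by (intro mult_left_mono)
    moreover have "0 \<le> r * d" using assms(3) r by (intro mult_nonneg_nonneg) linarith+
    ultimately show ?thesis by (simp add: algebra_simps)
  qed
  finally show ?thesis .
qed

lemma near_line_length:
  assumes "near_line \<theta> r x" "d / 2 < norm x" "4 * r \<le> d"
  shows "d / 4 \<le> \<bar>x \<bullet> \<gamma> \<theta>\<bar>"
proof -
  have "norm x \<le> norm ((x \<bullet> \<gamma> \<theta>) *\<^sub>R \<gamma> \<theta>) + norm (x - (x \<bullet> \<gamma> \<theta>) *\<^sub>R \<gamma> \<theta>)"
    by (metis add.commute diff_add_cancel norm_triangle_ineq)
  then show ?thesis using assms by (simp add: near_line_def norm_\<gamma>)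
qed

text \<open>Tangency to \<open>p i\<close> makes the cone form of q - \<open>p i\<close> and of q' -
  \<open>p i\<close> small, in whatever direction the tangency occurs, so the directions
  \<open>\<theta>'\<close> disappear. Subtracting, w = q' - q is nearly orthogonal to each
  \<open>\<gamma> (\<theta> i)\<close> for the cone form, up to an error |w|^2 / d. Three separated
  directions then bound \<open>w\<close>, and \<open>small\<close> absorbs the quadratic
  error.\<close>

lemma three_circles_local:
  assumes x: "\<And>i. i < 3 \<Longrightarrow> near_line (\<theta> i) r (q - p i)" "\<And>i. i < 3 \<Longrightarrow> d / 2 < norm (q - p i)"
      "\<And>i. i < 3 \<Longrightarrow> norm (q - p i) \<le> d"
    and x': "\<And>i. i < 3 \<Longrightarrow> near_line (\<theta>' i) r (q' - p i)" "\<And>i. i < 3 \<Longrightarrow> norm (q' - p i) \<le> d"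
    and r: "4 * r \<le> d" and d: "0 < d"
    and sep: "\<And>i j. i < 3 \<Longrightarrow> j < 3 \<Longrightarrow> i \<noteq> j \<Longrightarrow> \<rho> \<le> \<bar>\<theta> i - \<theta> j\<bar>" and \<rho>: "0 < \<rho>"
    and close: "\<And>i j. i < 3 \<Longrightarrow> j < (3::nat) \<Longrightarrow> \<bar>\<theta> i - \<theta> j\<bar> \<le> 1"
    and small: "8 * nondeg_const * norm (q' - q) \<le> d * \<rho>\<^sup>2"
  shows "norm (q' - q) \<le> 72 * nondeg_const * r / \<rho>\<^sup>2"
proof -
  define w where "w = q' - q"
  have r0: "0 \<le> r" using x(1)[of 0] order_trans[OF norm_ge_zero] unfolding near_line_def by simp blast
  have w2: "norm w \<le> 2 * d"
    using x(3)[of 0] x'(2)[of 0] norm_triangle_ineq4[of "q' - p 0" "q - p 0"] by (simp add: w_def)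
  have bound: "\<bar>cone_form w (\<gamma> (\<theta> i))\<bar> \<le> 36 * r + 4 * (norm w)\<^sup>2 / d" if i: "i < 3" for i
  proof -
    define X where "X = q - p i"
    define a where "a = X \<bullet> \<gamma> (\<theta> i)"
    define y where "y = X - a *\<^sub>R \<gamma> (\<theta> i)"
    have y: "norm y \<le> r" using x(1)[OF i] by (simp add: near_line_def y_def a_def X_def)
    have a: "d / 4 \<le> \<bar>a\<bar>" using near_line_length[OF x(1,2)[OF i] r] by (simp add: a_def X_def)
    have Q: "\<bar>cone_form X X\<bar> \<le> 5 * r * d"
      unfolding X_def by (rule near_line_cone_form[OF x(1)[OF i] x(3)[OF i] r])
    have "q' - p i = X + w" by (simp add: X_def w_def)
    then have Q': "\<bar>cone_form (X + w) (X + w)\<bar> \<le> 5 * r * d"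
      using near_line_cone_form[OF x'(1)[OF i] x'(2)[OF i] r] by simp
    have "2 * cone_form X w = cone_form (X + w) (X + w) - cone_form X X - cone_form w w"
      using cone_form_simps(5)[of w X] by (simp add: cone_form_simps(1-4))
    moreover have "\<bar>cone_form w w\<bar> \<le> 2 * (norm w)\<^sup>2"
      using cone_form_bound[of w w] by (simp add: power2_eq_square)
    ultimately have Xw: "\<bar>cone_form X w\<bar> \<le> 5 * r * d + (norm w)\<^sup>2" using Q Q' by linarith
    have "X = a *\<^sub>R \<gamma> (\<theta> i) + y" by (simp add: y_def)
    then have "cone_form X w = a * cone_form w (\<gamma> (\<theta> i)) + cone_form y w"
      using cone_form_simps(5)[of w "\<gamma> (\<theta> i)"] by (simp add: cone_form_simps(1-4))
    moreover have "\<bar>cone_form y w\<bar> \<le> 4 * r * d"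
    proof -
      have "norm y * norm w \<le> r * (2 * d)" using y w2 r0 by (intro mult_mono) auto
      then show ?thesis using cone_form_bound[of y w] by simp
    qed
    \<comment> \<open>9 = 5 + 4: half of 5 + 5 from the two tangencies, and 4 from replacing
      \<open>X\<close> by its component along the direction.\<close>
    ultimately have "\<bar>a * cone_form w (\<gamma> (\<theta> i))\<bar> \<le> 9 * r * d + (norm w)\<^sup>2" using Xw by linarith
    moreover have "d / 4 * \<bar>cone_form w (\<gamma> (\<theta> i))\<bar> \<le> \<bar>a * cone_form w (\<gamma> (\<theta> i))\<bar>"
      unfolding abs_mult using a by (rule mult_right_mono) simp
    ultimately have "d / 4 * \<bar>cone_form w (\<gamma> (\<theta> i))\<bar> \<le> 9 * r * d + (norm w)\<^sup>2" by linarith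
    then show ?thesis using d by (simp add: field_simps)
  qed
  have "norm w \<le> nondeg_const * (36 * r + 4 * (norm w)\<^sup>2 / d) / \<rho>\<^sup>2"
    by (rule cone_form_nondegenerate[of "\<theta> 0" "\<theta> 1" "\<theta> 2"]) (use bound sep close \<rho> in auto)
  also have "\<dots> = 36 * nondeg_const * r / \<rho>\<^sup>2 + norm w * (4 * nondeg_const * norm w / (d * \<rho>\<^sup>2))"
    using d \<rho> by (simp add: field_simps power2_eq_square)
  \<comment> \<open>The hypothesis \<open>small\<close> bounds the quadratic term by half of
    \<open>norm w\<close>; moving it to the left doubles 36 to 72.\<close>
  also have "\<dots> \<le> 36 * nondeg_const * r / \<rho>\<^sup>2 + norm w * (1 / 2)"
    using small d \<rho> by (intro add_left_mono mult_left_mono) (auto simp: w_def field_simps)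
  finally show ?thesis by (simp add: w_def)
qed

text \<open>Consequently a pair of points at distance about d is \<delta>-tangent in about 1/d of
  the \<delta>-separated directions only, the source of the factor d^(-3) for triples.\<close>

lemma near_line_directions_close:
  assumes x: "near_line \<theta> r x" "near_line \<phi> r x" "d / 2 < norm x" and r: "4 * r \<le> d" and d: "0 < d"
    and close: "\<bar>\<theta> - \<phi>\<bar> \<le> 1"
  shows "\<bar>\<theta> - \<phi>\<bar> \<le> 32 * r / (h * R * d)"
proof -
  define a where "a = x \<bullet> \<gamma> \<theta>" define b where "b = x \<bullet> \<gamma> \<phi>"
  define y where "y = x - a *\<^sub>R \<gamma> \<theta>" define w where "w = x - b *\<^sub>R \<gamma> \<phi>"
  have yw: "norm y \<le> r" "norm w \<le> r" using x by (simp_all add: near_line_def y_def w_def a_def b_def)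
  have r0: "0 \<le> r" using yw norm_ge_zero order_trans by blast
  have wy: "norm (w - y) \<le> 2 * r" using norm_triangle_ineq4[of w y] yw by linarith
  have e: "a *\<^sub>R \<gamma> \<theta> - b *\<^sub>R \<gamma> \<phi> = w - y" by (simp add: y_def w_def)
  have a: "d / 4 \<le> \<bar>a\<bar>" unfolding a_def by (rule near_line_length[OF x(1,3) r])
  \<comment> \<open>All directions have the same height \<open>h\<close> over the origin, so the
    heights of the two nearby points compare the lengths \<open>a\<close> and
    \<open>b\<close>.\<close>
  have "(a - b) * h = (w - y) \<bullet> n" by (simp flip: e add: inner_diff_left \<gamma>_inner algebra_simps)
  then have "\<bar>a - b\<bar> * h = \<bar>(w - y) \<bullet> n\<bar>" using h by (metis abs_mult abs_of_pos)
  moreover have "norm n = 1" using n by (simp add: norm_eq_1)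
  ultimately have "\<bar>a - b\<bar> * h \<le> 2 * r"
    using Cauchy_Schwarz_ineq2[of "w - y" n] wy by simp
  then have ab: "\<bar>a - b\<bar> \<le> 2 * r / h" using h by (simp add: field_simps)
  have e2: "a *\<^sub>R (\<gamma> \<theta> - \<gamma> \<phi>) = (w - y) - (a - b) *\<^sub>R \<gamma> \<phi>"
    by (simp flip: e add: algebra_simps)
  have "norm (a *\<^sub>R (\<gamma> \<theta> - \<gamma> \<phi>)) \<le> norm (w - y) + norm ((a - b) *\<^sub>R \<gamma> \<phi>)"
    unfolding e2 by (rule norm_triangle_ineq4)
  then have "\<bar>a\<bar> * norm (\<gamma> \<theta> - \<gamma> \<phi>) \<le> 2 * r + \<bar>a - b\<bar>"
    using wy by (simp add: norm_\<gamma>)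
  also have "\<dots> \<le> 2 * r / h + 2 * r / h"
  proof (rule add_mono[OF _ ab])
    have "h * r \<le> 1 * r" using h_le_1 r0 by (intro mult_right_mono)
    then show "2 * r \<le> 2 * r / h" using h by (simp add: field_simps)
  qed
  finally have "\<bar>a\<bar> * norm (\<gamma> \<theta> - \<gamma> \<phi>) \<le> 4 * r / h" by simp
  moreover have "d / 4 * (R * \<bar>\<theta> - \<phi>\<bar> / 2) \<le> \<bar>a\<bar> * norm (\<gamma> \<theta> - \<gamma> \<phi>)"
    using a \<gamma>_separated[OF close] R d by (intro mult_mono) auto
  ultimately have "d / 4 * (R * \<bar>\<theta> - \<phi>\<bar> / 2) \<le> 4 * r / h" by linarith
  then show ?thesis using d h R by (simp add: field_simps)
qed

end

section \<open>Counting tangencies\<close>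

lemma card_le_spread:
  assumes "finite S" "0 \<le> L" "\<And>i j. i \<in> S \<Longrightarrow> j \<in> S \<Longrightarrow> real i - real j \<le> L"
  shows "real (card S) \<le> L + 1"
proof (cases "S = {}")
  case False
  have "S \<subseteq> {Min S..Max S}" using assms(1) by auto
  then have "card S \<le> card {Min S..Max S}" by (intro card_mono) auto
  moreover have "real (Max S) - real (Min S) \<le> L" using False assms by (intro assms(3)) auto
  moreover have "Min S \<le> Max S" using False assms(1) by simp
  ultimately show ?thesis by (simp add: of_nat_diff)
qed (use assms in simp)

text \<open>\<open>E\<close> is closeness. An element is close to at most a quarter of
  \<open>S\<close>, which leaves three quarters for the second entry and at least half for the
  third: 3/8 = 3/4 * 1/2.\<close>

lemma card_separated_triples:
  fixes S :: "'i set" and N :: real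
  assumes S: "finite S" and N: "\<And>i. i \<in> S \<Longrightarrow> real (card {j \<in> S. E i j}) \<le> N"
    and big: "4 * N \<le> real (card S)"
  shows "3 / 8 * real (card S) ^ 3 \<le> real (card {(i, j, k) \<in> S \<times> S \<times> S. \<not> E i j \<and> \<not> E i k \<and> \<not> E j k})"
proof -
  let ?F = "real (card S)"
  have card_diff: "card (S - X) \<ge> ?F - real (card (S \<inter> X))" for X
    using card_Diff_subset_Int[of S X] S card_mono[of S "S \<inter> X"] by (simp add: of_nat_diff)
  have eq: "{(i, j, k) \<in> S \<times> S \<times> S. \<not> E i j \<and> \<not> E i k \<and> \<not> E j k}
     = (SIGMA i:S. SIGMA j:S - {j. E i j}. S - {k. E i k \<or> E j k})"
    by auto
  have "real (card {(i, j, k) \<in> S \<times> S \<times> S. \<not> E i j \<and> \<not> E i k \<and> \<not> E j k})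
     = (\<Sum>i\<in>S. \<Sum>j\<in>S - {j. E i j}. real (card (S - {k. E i k \<or> E j k})))"
    unfolding eq using S by (simp add: card_SigmaI)
  also have "\<dots> \<ge> (\<Sum>i\<in>S. \<Sum>j\<in>S - {j. E i j}. ?F / 2)"
  proof (intro sum_mono)
    fix i j assume ij: "i \<in> S" "j \<in> S - {j. E i j}"
    have "S \<inter> {k. E i k \<or> E j k} = {k \<in> S. E i k} \<union> {k \<in> S. E j k}" by auto
    then have "real (card (S \<inter> {k. E i k \<or> E j k})) \<le> N + N"
      using card_Un_le[of "{k \<in> S. E i k}" "{k \<in> S. E j k}"] N[of i] N[of j] ij by simp
    then show "?F / 2 \<le> real (card (S - {k. E i k \<or> E j k}))"
      using card_diff[of "{k. E i k \<or> E j k}"] big by linarith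
  qed
  moreover have "(\<Sum>i\<in>S. \<Sum>j\<in>S - {j. E i j}. ?F / 2) \<ge> (\<Sum>i\<in>S. 3 / 4 * ?F * (?F / 2))"
  proof (rule sum_mono)
    fix i assume i: "i \<in> S"
    have "S \<inter> {j. E i j} = {j \<in> S. E i j}" by auto
    then have "3 / 4 * ?F \<le> real (card (S - {j. E i j}))"
      using card_diff[of "{j. E i j}"] N[OF i] big by simp
    then have "3 / 4 * ?F * (?F / 2) \<le> real (card (S - {j. E i j})) * (?F / 2)"
      by (rule mult_right_mono) simp
    then show "3 / 4 * ?F * (?F / 2) \<le> (\<Sum>j\<in>S - {j. E i j}. ?F / 2)" by simp
  qed
  moreover have "(\<Sum>i\<in>S. 3 / 4 * ?F * (?F / 2)) = 3 / 8 * ?F ^ 3"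
    by (simp add: power3_eq_cube)
  ultimately show ?thesis by linarith
qed

text \<open>Cutting a ball of radius d into cubes of side \<open>\<l>\<close> turns the local three
  circle lemma into a bound for all points; points in one cube are within
  \<open>3 * \<l>\<close>.\<close>

lemma sum_le_grid:
  fixes z :: "'p \<Rightarrow> real ^ 3" and m :: "'p \<Rightarrow> real"
  assumes Z: "finite Z" and m: "\<And>q. q \<in> Z \<Longrightarrow> 0 \<le> m q" and \<l>: "0 < \<l>"
    and d: "\<And>q. q \<in> Z \<Longrightarrow> norm (z q - y) \<le> d"
    and loc: "\<And>q0. q0 \<in> Z \<Longrightarrow> (\<Sum>q | q \<in> Z \<and> norm (z q - z q0) \<le> 3 * \<l>. m q) \<le> M" and M: "0 \<le> M" and d0: "0 \<le> d"
  shows "(\<Sum>q\<in>Z. m q) \<le> (2 * d / \<l> + 3) ^ 3 * M"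
proof -
  define g where "g q = (\<chi> i. \<lfloor>(z q - y) $ i / \<l>\<rfloor>)" for q
  define N where "N = nat \<lfloor>2 * d / \<l> + 3\<rfloor>"
  define lo where "lo = (\<lambda>i::3. \<lfloor>- d / \<l>\<rfloor>)"
  define hi where "hi = (\<lambda>i::3. \<lfloor>d / \<l>\<rfloor>)"
  have box: "hi i - lo i + 1 \<le> int N" for i
  proof -
    have "d / \<l> \<ge> 0" using d0 \<l> by simp
    then show ?thesis unfolding hi_def lo_def N_def by (simp add: le_floor_iff) linarith
  qed
  have img: "g ` Z \<subseteq> {a. \<forall>i. lo i \<le> a $ i \<and> a $ i \<le> hi i}"
  proof safe
    fix q i assume "q \<in> Z"
    then have "\<bar>(z q - y) $ i\<bar> \<le> d" using component_le_norm_cart[of "z q - y" i] d[of q] by linarith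
    then have "- d / \<l> \<le> (z q - y) $ i / \<l>" "(z q - y) $ i / \<l> \<le> d / \<l>"
      using \<l> by (intro divide_right_mono; linarith)+
    then show "lo i \<le> g q $ i" "g q $ i \<le> hi i" by (simp_all add: lo_def hi_def g_def floor_mono)
  qed
  have same: "norm (z q - z q0) \<le> 3 * \<l>" if "g q = g q0" for q q0
  proof (rule norm_le_componentwise)
    fix i
    have "\<lfloor>(z q - y) $ i / \<l>\<rfloor> = \<lfloor>(z q0 - y) $ i / \<l>\<rfloor>" using that by (simp add: g_def vec_eq_iff)
    then have "\<bar>(z q - y) $ i / \<l> - (z q0 - y) $ i / \<l>\<bar> \<le> 1" by linarith
    then have "\<bar>(z q - z q0) $ i / \<l>\<bar> \<le> 1" by (simp add: diff_divide_distrib)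
    then show "\<bar>(z q - z q0) $ i\<bar> \<le> \<l>" using \<l> by (simp add: abs_divide)
  qed
  have "(\<Sum>q\<in>Z. m q) = (\<Sum>a\<in>g ` Z. \<Sum>q | q \<in> Z \<and> g q = a. m q)"
    using Z by (rule sum.image_gen)
  also have "\<dots> \<le> (\<Sum>a\<in>g ` Z. M)"
  proof (rule sum_mono)
    fix a assume "a \<in> g ` Z"
    then obtain q0 where q0: "q0 \<in> Z" "a = g q0" by auto
    have "(\<Sum>q | q \<in> Z \<and> g q = a. m q) \<le> (\<Sum>q | q \<in> Z \<and> norm (z q - z q0) \<le> 3 * \<l>. m q)"
      using Z m same q0 by (intro sum_mono2) auto
    then show "(\<Sum>q | q \<in> Z \<and> g q = a. m q) \<le> M" using loc[OF q0(1)] by linarith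
  qed
  also have "\<dots> = real (card (g ` Z)) * M" by simp
  also have "\<dots> \<le> (2 * d / \<l> + 3) ^ 3 * M"
  proof (rule mult_right_mono[OF _ M])
    have "card (g ` Z) \<le> card {a. \<forall>i. lo i \<le> a $ i \<and> a $ i \<le> hi i}"
      by (rule card_mono[OF int_box_card(1)[of hi lo N, OF box] img])
    also have "\<dots> \<le> N ^ 3" by (rule int_box_card(2)[of hi lo N, OF box])
    finally have "real (card (g ` Z)) \<le> real N ^ 3" by (metis of_nat_le_iff of_nat_power)
    also have "\<dots> \<le> (2 * d / \<l> + 3) ^ 3"
      unfolding N_def using d0 \<l> by (intro power_mono) (auto simp: of_nat_nat)
    finally show "real (card (g ` Z)) \<le> (2 * d / \<l> + 3) ^ 3" .
  qed
  finally show ?thesis .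
qed

context circle_frame begin

definition tangent :: "real \<Rightarrow> real \<Rightarrow> real \<Rightarrow> real ^ 3 \<Rightarrow> bool" where
  "tangent \<theta> r d x \<longleftrightarrow> near_line \<theta> r x \<and> d / 2 < norm x \<and> norm x \<le> d"

text \<open>32 comes from \<open>near_line_directions_close\<close>; the 8 absorbs the rounding loss
  2 \<le> 8/d, valid for d \<le> 4.\<close>

definition angle_const :: "real \<Rightarrow> real" where
  "angle_const A = 32 * A / (h * R) + 8"

end

text \<open>The configuration at one scale \<delta> and one distance d: point masses with the
  Frostman bound on balls, and for each index in \<open>I\<close> one direction in the corresponding
  interval of length \<delta>. \<open>A\<close> is the relative thickness of the tubes and \<rho>
  the separation demanded of directions in a triple.\<close>

locale tangency_count = circle_frame +
  fixes P :: "'p set" and z :: "'p \<Rightarrow> real ^ 3" and m :: "'p \<Rightarrow> real"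
    and I :: "nat set" and \<theta> :: "nat \<Rightarrow> real"
    and s C0 A \<delta> d a0 \<rho> :: real
  assumes P: "finite P" and m: "\<And>p. 0 \<le> m p" and total: "(\<Sum>p\<in>P. m p) \<le> 1"
    and s: "0 < s" and C0: "0 \<le> C0" and A: "1 \<le> A" and \<delta>: "0 < \<delta>" and d: "4 * (A * \<delta>) \<le> d" "d \<le> 4"
    and ball: "\<And>y r. \<delta> \<le> r \<Longrightarrow> (\<Sum>p | p \<in> P \<and> norm (z p - y) \<le> r. m p) \<le> C0 * r powr s"
    and I: "finite I" and \<theta>: "\<And>i. i \<in> I \<Longrightarrow> a0 + real i * \<delta> \<le> \<theta> i \<and> \<theta> i \<le> a0 + (real i + 1) * \<delta>"
      "\<And>i. i \<in> I \<Longrightarrow> \<theta> i \<in> {a0..a0 + 1}"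
    and \<rho>: "\<delta> \<le> \<rho>" "\<rho> \<le> 1"
begin

lemma d_pos: "0 < d"
proof -
  have "0 < A * \<delta>" using A \<delta> by (intro mult_pos_pos) auto
  then show ?thesis using d by linarith
qed

lemma \<theta>_close: "i \<in> I \<Longrightarrow> j \<in> I \<Longrightarrow> \<bar>\<theta> i - \<theta> j\<bar> \<le> 1"
  using \<theta>(2)[of i] \<theta>(2)[of j] by auto

text \<open>One unit is lost because a direction may sit anywhere in its interval, another because
  indices are counted with both ends.\<close>

lemma card_index_le:
  assumes S: "S \<subseteq> I" and L: "0 \<le> L" and close: "\<And>i j. i \<in> S \<Longrightarrow> j \<in> S \<Longrightarrow> \<bar>\<theta> i - \<theta> j\<bar> \<le> L"
  shows "real (card S) \<le> L / \<delta> + 2"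
proof -
  have "real (card S) \<le> (L / \<delta> + 1) + 1"
  proof (rule card_le_spread)
    show "finite S" using S I by (rule finite_subset)
    show "0 \<le> L / \<delta> + 1" using L \<delta> by simp
    fix i j assume ij: "i \<in> S" "j \<in> S"
    have "a0 + real i * \<delta> \<le> \<theta> i" "\<theta> j \<le> a0 + (real j + 1) * \<delta>"
      using \<theta>(1)[of i] \<theta>(1)[of j] ij S by auto
    then have "(real i - real j - 1) * \<delta> \<le> \<theta> i - \<theta> j" by (simp add: algebra_simps)
    also have "\<dots> \<le> L" using close[OF ij] by linarith
    finally show "real i - real j \<le> L / \<delta> + 1" using \<delta> by (simp add: field_simps)
  qed
  then show ?thesis by simp
qed

definition near :: "'p \<Rightarrow> 'p \<Rightarrow> nat \<Rightarrow> bool" where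
  "near p q i \<longleftrightarrow> tangent (\<theta> i) (A * \<delta>) d (z q - z p)"

abbreviation tube_mass :: "'p \<Rightarrow> nat \<Rightarrow> real" where
  "tube_mass q i \<equiv> \<Sum>p | p \<in> P \<and> near p q i. m p"

lemma card_near_le: "real (card {i \<in> I. near p q i}) \<le> angle_const A / d"
proof -
  have "real (card {i \<in> I. near p q i}) \<le> (32 * (A * \<delta>) / (h * R * d)) / \<delta> + 2"
  proof (rule card_index_le)
    show "0 \<le> 32 * (A * \<delta>) / (h * R * d)" using A \<delta> h R d_pos by simp
    fix i j assume ij: "i \<in> {i \<in> I. near p q i}" "j \<in> {i \<in> I. near p q i}"
    then show "\<bar>\<theta> i - \<theta> j\<bar> \<le> 32 * (A * \<delta>) / (h * R * d)"
      by (intro near_line_directions_close[of _ _ "z q - z p"] d d_pos \<theta>_close) (auto simp: near_def tangent_def)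
  qed auto
  also have "\<dots> = 32 * A / (h * R) / d + 2" using \<delta> by simp
  also have "\<dots> \<le> 32 * A / (h * R) / d + 8 / d" using d d_pos by (simp add: field_simps)
  finally show ?thesis by (simp add: angle_const_def add_divide_distrib)
qed

definition sep :: "nat \<Rightarrow> nat \<Rightarrow> bool" where
  "sep i j \<longleftrightarrow> \<rho> \<le> \<bar>\<theta> i - \<theta> j\<bar>"

definition triples :: "(nat \<times> nat \<times> nat) set" where
  "triples = {(i, j, k) \<in> I \<times> I \<times> I. sep i j \<and> sep i k \<and> sep j k}"

lemma finite_triples: "finite triples"
  by (rule finite_subset[of _ "I \<times> I \<times> I"]) (use I in \<open>auto simp: triples_def\<close>)

definition tangent_triples :: "'p \<Rightarrow> 'p \<Rightarrow> 'p \<Rightarrow> 'p \<Rightarrow> (nat \<times> nat \<times> nat) set" where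
  "tangent_triples q p1 p2 p3 = {(i, j, k) \<in> triples. near p1 q i \<and> near p2 q j \<and> near p3 q k}"

lemma card_tangent_triples: "real (card (tangent_triples q p1 p2 p3)) \<le> (angle_const A / d) ^ 3"
proof -
  have "tangent_triples q p1 p2 p3 \<subseteq> {i \<in> I. near p1 q i} \<times> {i \<in> I. near p2 q i} \<times> {i \<in> I. near p3 q i}"
    by (auto simp: tangent_triples_def triples_def)
  then have "card (tangent_triples q p1 p2 p3)
      \<le> card ({i \<in> I. near p1 q i} \<times> {i \<in> I. near p2 q i} \<times> {i \<in> I. near p3 q i})"
    using I by (intro card_mono) auto
  also have "\<dots> = card {i \<in> I. near p1 q i} * (card {i \<in> I. near p2 q i} * card {i \<in> I. near p3 q i})"
    by (simp only: card_cartesian_product)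
  finally have "real (card (tangent_triples q p1 p2 p3))
      \<le> real (card {i \<in> I. near p1 q i}) * (real (card {i \<in> I. near p2 q i}) * real (card {i \<in> I. near p3 q i}))"
    unfolding of_nat_mult[symmetric] by (rule of_nat_mono)
  also have "\<dots> \<le> (angle_const A / d) * ((angle_const A / d) * (angle_const A / d))"
  proof -
    have "0 \<le> angle_const A / d" using card_near_le[of p1 q] by (rule order_trans[rotated]) simp
    then show ?thesis by (intro mult_mono card_near_le mult_nonneg_nonneg of_nat_0_le_iff)
  qed
  finally show ?thesis by (simp add: power3_eq_cube)
qed

definition common :: "'p \<Rightarrow> 'p \<Rightarrow> 'p \<Rightarrow> 'p set" where
  "common p1 p2 p3 = {q \<in> P. tangent_triples q p1 p2 p3 \<noteq> {}}"

definition local_mass :: real where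
  "local_mass = C0 * (72 * nondeg_const * (A * \<delta>) / \<rho>\<^sup>2) powr s"

lemma local_mass_nonneg: "0 \<le> local_mass"
  using C0 by (simp add: local_mass_def)

lemma nondeg_const_ge: "1 \<le> nondeg_const"
proof -
  have "h\<^sup>2 * R\<^sup>2 \<le> 1 * 1" using h R h_le_1 R_le_1 by (intro mult_mono) (auto simp: power_le_one)
  then show ?thesis using h R unfolding nondeg_const_def by (subst pos_le_divide_eq) auto
qed

lemma common_local:
  assumes q0: "q0 \<in> common p1 p2 p3" and q: "q \<in> common p1 p2 p3"
    and small: "8 * nondeg_const * norm (z q - z q0) \<le> d * \<rho>\<^sup>2"
  shows "norm (z q - z q0) \<le> 72 * nondeg_const * (A * \<delta>) / \<rho>\<^sup>2"
proof -
  obtain i j k where ijk: "(i, j, k) \<in> triples" "near p1 q0 i" "near p2 q0 j" "near p3 q0 k"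
    using q0 by (auto simp: common_def tangent_triples_def)
  obtain i' j' k' where ijk': "(i', j', k') \<in> triples" "near p1 q i'" "near p2 q j'" "near p3 q k'"
    using q by (auto simp: common_def tangent_triples_def)
  define f where "f a b c l = (if l = 0 then a else if l = (1::nat) then b else c)" for a b c :: nat and l
  define p where "p l = z (if l = 0 then p1 else if l = (1::nat) then p2 else p3)" for l
  have "\<rho> > 0" using \<rho> \<delta> by linarith
  have lt3: "l = 0 \<or> l = 1 \<or> l = 2" if "l < 3" for l :: nat using that by auto
  have A0: "tangent (\<theta> (f i j k l)) (A * \<delta>) d (z q0 - p l)" if "l < 3" for l
    using lt3[OF that] ijk by (auto simp: f_def p_def near_def)
  have A1: "tangent (\<theta> (f i' j' k' l)) (A * \<delta>) d (z q - p l)" if "l < 3" for l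
    using lt3[OF that] ijk' by (auto simp: f_def p_def near_def)
  show ?thesis
  proof (rule three_circles_local[where \<theta> = "\<lambda>l. \<theta> (f i j k l)" and \<theta>' = "\<lambda>l. \<theta> (f i' j' k' l)" and p = p])
    fix l l' :: nat assume l: "l < 3" "l' < 3"
    show "\<bar>\<theta> (f i j k l) - \<theta> (f i j k l')\<bar> \<le> 1"
      using lt3[OF l(1)] lt3[OF l(2)] ijk(1) by (intro \<theta>_close) (auto simp: f_def triples_def)
    assume "l \<noteq> l'"
    then show "\<rho> \<le> \<bar>\<theta> (f i j k l) - \<theta> (f i j k l')\<bar>"
      using lt3[OF l(1)] lt3[OF l(2)] ijk(1) by (auto simp: f_def triples_def sep_def abs_minus_commute)
  qed (use A0 A1 d d_pos small \<open>\<rho> > 0\<close> in \<open>auto simp: tangent_def\<close>)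
qed

lemma sum_common_le: "(\<Sum>q\<in>common p1 p2 p3. m q) \<le> ((48 * nondeg_const + 3) / \<rho>\<^sup>2) ^ 3 * local_mass"
proof -
  \<comment> \<open>Chosen so that \<open>3 * \<l>\<close> meets the closeness condition of
    \<open>common_local\<close> with equality; the number of cubes is then governed by 2 d /
    \<open>\<l>\<close> = 48 \<open>nondeg_const\<close> / \<rho>^2.\<close>
  define \<l> where "\<l> = d * \<rho>\<^sup>2 / (24 * nondeg_const)"
  have \<rho>0: "\<rho> > 0" using \<rho> \<delta> by linarith
  have \<l>: "0 < \<l>" using d_pos \<rho>0 nondeg_const_pos by (simp add: \<l>_def)
  let ?r = "72 * nondeg_const * (A * \<delta>) / \<rho>\<^sup>2"
  have fin: "finite (common p1 p2 p3)" using P by (auto simp: common_def)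
  have r: "\<delta> \<le> ?r"
  proof -
    have "\<rho>\<^sup>2 \<le> 1" using \<rho> \<rho>0 by (simp add: power_le_one)
    then have "\<delta> * \<rho>\<^sup>2 \<le> \<delta> * 1" using \<delta> by (intro mult_left_mono) auto
    also have "\<dots> \<le> (72 * nondeg_const * A) * \<delta>"
    proof -
      have "1 * 1 \<le> nondeg_const * A" using nondeg_const_ge A by (intro mult_mono) auto
      then have "1 * \<delta> \<le> (72 * nondeg_const * A) * \<delta>" using \<delta> by (intro mult_right_mono) auto
      then show ?thesis by simp
    qed
    finally show ?thesis using \<rho>0 by (simp add: pos_le_divide_eq mult.assoc)
  qed
  have "(\<Sum>q\<in>common p1 p2 p3. m q) \<le> (2 * d / \<l> + 3) ^ 3 * local_mass"
  proof (rule sum_le_grid[OF fin m \<l>, where y = "z p1"])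
    fix q assume "q \<in> common p1 p2 p3"
    then show "norm (z q - z p1) \<le> d"
      by (auto simp: common_def tangent_triples_def near_def tangent_def)
  next
    fix q0 assume q0: "q0 \<in> common p1 p2 p3"
    have "(\<Sum>q | q \<in> common p1 p2 p3 \<and> norm (z q - z q0) \<le> 3 * \<l>. m q) \<le> (\<Sum>q | q \<in> P \<and> norm (z q - z q0) \<le> ?r. m q)"
    proof (rule sum_mono2)
      show "{q \<in> common p1 p2 p3. norm (z q - z q0) \<le> 3 * \<l>} \<subseteq> {q \<in> P. norm (z q - z q0) \<le> ?r}"
      proof safe
        fix q assume q: "q \<in> common p1 p2 p3" "norm (z q - z q0) \<le> 3 * \<l>"
        then show "q \<in> P" by (simp add: common_def)
        have "8 * nondeg_const * norm (z q - z q0) \<le> 8 * nondeg_const * (3 * \<l>)"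
          using q(2) nondeg_const_pos by (intro mult_left_mono) auto
        also have "\<dots> = d * \<rho>\<^sup>2" using nondeg_const_pos by (simp add: \<l>_def)
        finally show "norm (z q - z q0) \<le> ?r" by (rule common_local[OF q0 q(1)])
      qed
    qed (use P m in auto)
    also have "\<dots> \<le> local_mass" unfolding local_mass_def by (rule ball[OF r])
    finally show "(\<Sum>q | q \<in> common p1 p2 p3 \<and> norm (z q - z q0) \<le> 3 * \<l>. m q) \<le> local_mass" .
  qed (use local_mass_nonneg d_pos in auto)
  also have "\<dots> \<le> ((48 * nondeg_const + 3) / \<rho>\<^sup>2) ^ 3 * local_mass"
  proof (intro mult_right_mono power_mono local_mass_nonneg)
    have "2 * d / \<l> = 48 * nondeg_const / \<rho>\<^sup>2" using d_pos nondeg_const_pos by (simp add: \<l>_def)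
    moreover have "3 \<le> 3 / \<rho>\<^sup>2" using \<rho> \<rho>0 by (subst pos_le_divide_eq) (auto simp: power_le_one)
    ultimately show "2 * d / \<l> + 3 \<le> (48 * nondeg_const + 3) / \<rho>\<^sup>2" by (simp add: add_divide_distrib)
    show "0 \<le> 2 * d / \<l> + 3" using d_pos \<l> by simp
  qed
  finally show ?thesis .
qed

lemma common_nonempty_close:
  assumes "common p1 p2 p3 \<noteq> {}"
  shows "norm (z p2 - z p1) \<le> 2 * d" "norm (z p3 - z p1) \<le> 2 * d"
proof -
  obtain q where q: "norm (z q - z p1) \<le> d" "norm (z q - z p2) \<le> d" "norm (z q - z p3) \<le> d"
    using assms by (auto simp: common_def tangent_triples_def near_def tangent_def)
  have e: "z p2 - z p1 = (z q - z p1) - (z q - z p2)" "z p3 - z p1 = (z q - z p1) - (z q - z p3)"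
    by simp_all
  show "norm (z p2 - z p1) \<le> 2 * d" unfolding e(1) using q norm_triangle_ineq4[of "z q - z p1" "z q - z p2"] by linarith
  show "norm (z p3 - z p1) \<le> 2 * d" unfolding e(2) using q norm_triangle_ineq4[of "z q - z p1" "z q - z p3"] by linarith
qed

abbreviation ball_mass :: "'p \<Rightarrow> real" where
  "ball_mass q \<equiv> \<Sum>p | p \<in> P \<and> norm (z p - z q) \<le> 2 * d. m p"

text \<open>For fixed (p1, p2, p3): the number of direction triples available to one q, times the
  mass of the q that are tangent to all three.\<close>

definition triple_bound :: real where
  "triple_bound = (angle_const A / d) ^ 3 * (((48 * nondeg_const + 3) / \<rho>\<^sup>2) ^ 3 * local_mass)"

lemma angle_const_pos: "0 < angle_const A"
proof -
  have "0 \<le> 32 * A / (h * R)" using A h R by (intro divide_nonneg_nonneg mult_nonneg_nonneg) auto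
  then show ?thesis by (simp add: angle_const_def)
qed

lemma triple_bound_nonneg: "0 \<le> triple_bound"
  unfolding triple_bound_def using angle_const_pos d_pos nondeg_const_pos local_mass_nonneg \<rho> \<delta>
  by (intro mult_nonneg_nonneg zero_le_power divide_nonneg_nonneg) auto

lemma sum_tangent_triples_le:
  "(\<Sum>q\<in>P. m q * real (card (tangent_triples q p1 p2 p3)))
     \<le> (if norm (z p2 - z p1) \<le> 2 * d \<and> norm (z p3 - z p1) \<le> 2 * d then triple_bound else 0)"
proof -
  have "(\<Sum>q\<in>P. m q * real (card (tangent_triples q p1 p2 p3)))
      = (\<Sum>q\<in>common p1 p2 p3. m q * real (card (tangent_triples q p1 p2 p3)))"
    by (rule sum.mono_neutral_right) (use P in \<open>auto simp: common_def\<close>)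
  also have "\<dots> \<le> (\<Sum>q\<in>common p1 p2 p3. m q * (angle_const A / d) ^ 3)"
    by (intro sum_mono mult_left_mono card_tangent_triples m)
  also have "\<dots> = (angle_const A / d) ^ 3 * (\<Sum>q\<in>common p1 p2 p3. m q)"
    by (simp only: sum_distrib_left mult.commute)
  finally have *: "(\<Sum>q\<in>P. m q * real (card (tangent_triples q p1 p2 p3)))
      \<le> (angle_const A / d) ^ 3 * (\<Sum>q\<in>common p1 p2 p3. m q)" .
  show ?thesis
  proof (cases "common p1 p2 p3 = {}")
    case True
    then show ?thesis using * triple_bound_nonneg by simp
  next
    case False
    have "(angle_const A / d) ^ 3 * (\<Sum>q\<in>common p1 p2 p3. m q) \<le> triple_bound"
      unfolding triple_bound_def using angle_const_pos d_pos
      by (intro mult_left_mono sum_common_le zero_le_power divide_nonneg_nonneg) auto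
    then show ?thesis using * common_nonempty_close[OF False] by simp
  qed
qed

text \<open>Double counting. After expanding the product of tube masses, the sum over q is moved
  inside, where \<open>triple_bound\<close> applies. Only p2 and p3 within 2 d of p1 contribute, so
  each costs the mass of a ball.\<close>

lemma sum_all_le:
  "(\<Sum>q\<in>P. \<Sum>(i, j, k)\<in>triples. m q * (tube_mass q i * (tube_mass q j * tube_mass q k)))
   \<le> (C0 * (2 * d) powr s)\<^sup>2 * triple_bound"
proof -
  define w where "w p q i = (if near p q i then m p else 0)" for p q i
  have w: "tube_mass q i = (\<Sum>p\<in>P. w p q i)" for q i
    unfolding w_def using P by (simp add: sum.inter_filter)
  have prod3: "(\<Sum>p\<in>P. a p) * ((\<Sum>p\<in>P. b p) * (\<Sum>p\<in>P. c p)) = (\<Sum>(p1, p2, p3)\<in>P \<times> P \<times> P. a p1 * (b p2 * c p3))"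
    for a b c :: "'p \<Rightarrow> real"
    unfolding sum_product sum.cartesian_product[symmetric] by (simp only: sum_distrib_left)
  define X where "X q = (\<lambda>(i, j, k) (p1, p2, p3). m q * (w p1 q i * (w p2 q j * w p3 q k)))" for q
  have "(\<Sum>q\<in>P. \<Sum>(i, j, k)\<in>triples. m q * ((\<Sum>p\<in>P. w p q i) * ((\<Sum>p\<in>P. w p q j) * (\<Sum>p\<in>P. w p q k))))
     = (\<Sum>q\<in>P. \<Sum>t\<in>triples. \<Sum>p\<in>P \<times> P \<times> P. X q t p)"
    unfolding prod3 X_def by (simp add: sum_distrib_left case_prod_unfold)
  also have "\<dots> = (\<Sum>q\<in>P. \<Sum>p\<in>P \<times> P \<times> P. \<Sum>t\<in>triples. X q t p)"
    by (rule sum.cong[OF refl], rule sum.swap)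
  also have "\<dots> = (\<Sum>p\<in>P \<times> P \<times> P. \<Sum>q\<in>P. \<Sum>t\<in>triples. X q t p)"
    by (rule sum.swap)
  also have "\<dots> = (\<Sum>(p1, p2, p3)\<in>P \<times> P \<times> P. m p1 * (m p2 * m p3) * (\<Sum>q\<in>P. m q * real (card (tangent_triples q p1 p2 p3))))"
  proof (rule sum.cong[OF refl], clarify)
    fix p1 p2 p3
    have "(\<Sum>t\<in>triples. X q t (p1, p2, p3)) = m p1 * (m p2 * m p3) * (m q * real (card (tangent_triples q p1 p2 p3)))" for q
    proof -
      have "(\<Sum>t\<in>triples. X q t (p1, p2, p3))
          = (\<Sum>t\<in>triples. if t \<in> tangent_triples q p1 p2 p3 then m q * (m p1 * (m p2 * m p3)) else 0)"
        by (intro sum.cong refl) (auto simp: w_def tangent_triples_def X_def split: if_splits)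
      also have "\<dots> = (\<Sum>t\<in>triples \<inter> tangent_triples q p1 p2 p3. m q * (m p1 * (m p2 * m p3)))"
        by (rule sum.inter_restrict[OF finite_triples, symmetric])
      also have "triples \<inter> tangent_triples q p1 p2 p3 = tangent_triples q p1 p2 p3"
        by (auto simp: tangent_triples_def)
      finally show ?thesis by (simp add: mult.commute mult.left_commute)
    qed
    then show "(\<Sum>q\<in>P. \<Sum>t\<in>triples. X q t (p1, p2, p3))
      = m p1 * (m p2 * m p3) * (\<Sum>q\<in>P. m q * real (card (tangent_triples q p1 p2 p3)))"
      by (simp add: sum_distrib_left)
  qed
  also have "\<dots> \<le> (\<Sum>(p1, p2, p3)\<in>P \<times> P \<times> P. m p1 * (m p2 * m p3) *
      (if norm (z p2 - z p1) \<le> 2 * d \<and> norm (z p3 - z p1) \<le> 2 * d then triple_bound else 0))"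
    by (rule sum_mono, clarify) (intro mult_left_mono sum_tangent_triples_le mult_nonneg_nonneg m)
  also have "\<dots> = (\<Sum>p1\<in>P. m p1 * ball_mass p1 * ball_mass p1 * triple_bound)"
    unfolding sum.cartesian_product[symmetric]
  proof (rule sum.cong[OF refl])
    fix p1
    define t where "t p = (if norm (z p - z p1) \<le> 2 * d then m p else 0)" for p
    have t: "ball_mass p1 = (\<Sum>p\<in>P. t p)"
      unfolding t_def using P by (simp add: sum.inter_filter)
    have "(\<Sum>p2\<in>P. \<Sum>p3\<in>P. m p1 * (m p2 * m p3) *
      (if norm (z p2 - z p1) \<le> 2 * d \<and> norm (z p3 - z p1) \<le> 2 * d then triple_bound else 0))
      = (\<Sum>p2\<in>P. \<Sum>p3\<in>P. m p1 * triple_bound * (t p2 * t p3))"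
      by (intro sum.cong refl) (simp add: t_def)
    also have "\<dots> = m p1 * triple_bound * (\<Sum>p2\<in>P. \<Sum>p3\<in>P. t p2 * t p3)"
      by (simp only: sum_distrib_left)
    also have "\<dots> = m p1 * triple_bound * ((\<Sum>p\<in>P. t p) * (\<Sum>p\<in>P. t p))"
      by (simp only: sum_product)
    finally show "(\<Sum>p2\<in>P. \<Sum>p3\<in>P. m p1 * (m p2 * m p3) *
      (if norm (z p2 - z p1) \<le> 2 * d \<and> norm (z p3 - z p1) \<le> 2 * d then triple_bound else 0))
      = m p1 * ball_mass p1 * ball_mass p1 * triple_bound"
      unfolding t by (simp only: mult.assoc mult.commute[of triple_bound])
  qed
  also have "\<dots> \<le> (\<Sum>p1\<in>P. m p1 * (C0 * (2 * d) powr s) * (C0 * (2 * d) powr s) * triple_bound)"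
  proof (rule sum_mono)
    fix p1
    have "1 * \<delta> \<le> A * \<delta>" using A \<delta> by (intro mult_right_mono) auto
    then have "\<delta> \<le> 2 * d" using d d_pos by linarith
    then have "ball_mass p1 \<le> C0 * (2 * d) powr s" by (rule ball)
    moreover have "0 \<le> ball_mass p1" by (intro sum_nonneg m)
    ultimately show "m p1 * ball_mass p1 * ball_mass p1 * triple_bound
        \<le> m p1 * (C0 * (2 * d) powr s) * (C0 * (2 * d) powr s) * triple_bound"
      using m[of p1] C0 triple_bound_nonneg by (intro mult_mono mult_nonneg_nonneg) auto
  qed
  also have "\<dots> = (\<Sum>p1\<in>P. m p1) * ((C0 * (2 * d) powr s)\<^sup>2 * triple_bound)"
    by (simp add: sum_distrib_right power2_eq_square mult.assoc)
  also have "\<dots> \<le> 1 * ((C0 * (2 * d) powr s)\<^sup>2 * triple_bound)"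
    using total triple_bound_nonneg by (intro mult_right_mono mult_nonneg_nonneg) auto
  finally show ?thesis unfolding w by simp
qed

text \<open>The upper bound is \<open>sum_all_le\<close>. For the lower bound, \<open>F q\<close>
  counts the rich directions at q; its mean is at least \<kappa> |I|, and where it is large most
  triples of rich directions are separated.\<close>

theorem tangency_bound:
  assumes \<tau>: "0 \<le> \<tau>" and \<kappa>: "0 \<le> \<kappa>"
    and G: "\<And>i. i \<in> I \<Longrightarrow> \<kappa> \<le> (\<Sum>q | q \<in> P \<and> \<tau> \<le> tube_mass q i. m q)"
    and big: "32 * \<rho> \<le> \<kappa> * real (card I) * \<delta>"
  shows "3 / 64 * (\<kappa> * real (card I)) ^ 3 * \<tau> ^ 3 \<le> (C0 * (2 * d) powr s)\<^sup>2 * triple_bound"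
proof -
  define S where "S q = {i \<in> I. \<tau> \<le> tube_mass q i}" for q
  define F where "F q = real (card (S q))" for q
  define T where "T q = {(i, j, k) \<in> S q \<times> S q \<times> S q. sep i j \<and> sep i k \<and> sep j k}" for q
  \<comment> \<open>Half of the guaranteed mean of \<open>F\<close>, so that points with
    \<open>F q\<close> below \<open>M\<close> can be neglected; cubing the half turns 3/8 into
    3/64.\<close>
  define M where "M = \<kappa> * real (card I) / 2"
  have M0: "0 \<le> M" using \<kappa> by (simp add: M_def)
  have finS: "finite (S q)" for q using I by (simp add: S_def)
  have TS: "T q \<subseteq> triples" for q by (auto simp: T_def S_def triples_def)
  have \<rho>0: "\<rho> > 0" using \<rho> \<delta> by linarith
  have T: "3 / 8 * F q ^ 3 \<le> real (card (T q))" if "M \<le> F q" for q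
  proof -
    have "3 / 8 * real (card (S q)) ^ 3 \<le> real (card {(i, j, k) \<in> S q \<times> S q \<times> S q. \<not> \<not> sep i j \<and> \<not> \<not> sep i k \<and> \<not> \<not> sep j k})"
    proof (rule card_separated_triples[OF finS])
      fix i assume "i \<in> S q"
      have "real (card {j \<in> S q. \<not> sep i j}) \<le> 2 * \<rho> / \<delta> + 2"
        by (rule card_index_le) (use \<rho>0 in \<open>auto simp: S_def sep_def\<close>)
      also have "\<dots> \<le> 4 * \<rho> / \<delta>" using \<rho> \<delta> by (simp add: field_simps)
      finally show "real (card {j \<in> S q. \<not> sep i j}) \<le> 4 * \<rho> / \<delta>" .
    next
      \<comment> \<open>Here 32 in \<open>big\<close> is used: fewer than a quarter of the rich
        directions may be close to a given one, up to equality.\<close>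
      have "16 * \<rho> / \<delta> \<le> M" using big \<delta> by (simp add: M_def field_simps)
      then show "4 * (4 * \<rho> / \<delta>) \<le> real (card (S q))" using that by (simp add: F_def)
    qed
    then show ?thesis by (simp add: F_def T_def)
  qed
  \<comment> \<open>The cubic count is replaced by a bound linear in \<open>F q\<close>, which is
    negative below \<open>M\<close>. It can thus be summed over all q, and total mass at most 1
    leaves at least \<open>M\<close> for the sum of the excesses.\<close>
  have pointwise: "3 / 8 * M\<^sup>2 * (m q * (F q - M)) \<le> m q * real (card (T q))" for q
  proof (cases "M \<le> F q")
    case True
    have "M\<^sup>2 * (F q - M) \<le> (F q)\<^sup>2 * F q"
      using True M0 by (intro mult_mono power_mono) auto
    then have "3 / 8 * (M\<^sup>2 * (F q - M)) \<le> real (card (T q))"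
      using T[OF True] by (simp add: power2_eq_square power3_eq_cube)
    then have "m q * (3 / 8 * (M\<^sup>2 * (F q - M))) \<le> m q * real (card (T q))" by (intro mult_left_mono m)
    then show ?thesis by (simp add: ac_simps)
  next
    case False
    then have "3 / 8 * M\<^sup>2 * (m q * (F q - M)) \<le> 0"
      using m by (intro mult_nonneg_nonpos) auto
    also have "0 \<le> m q * real (card (T q))" using m by simp
    finally show ?thesis .
  qed
  have "2 * M = (\<Sum>i\<in>I. \<kappa>)" by (simp add: M_def)
  also have "\<dots> \<le> (\<Sum>i\<in>I. \<Sum>q | q \<in> P \<and> \<tau> \<le> tube_mass q i. m q)"
    by (intro sum_mono G)
  also have "\<dots> = (\<Sum>i\<in>I. \<Sum>q\<in>P. if i \<in> S q then m q else 0)"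
  proof (rule sum.cong[OF refl])
    fix i assume "i \<in> I"
    then have "{q \<in> P. \<tau> \<le> tube_mass q i} = {q \<in> P. i \<in> S q}" by (simp add: S_def)
    then show "(\<Sum>q | q \<in> P \<and> \<tau> \<le> tube_mass q i. m q) = (\<Sum>q\<in>P. if i \<in> S q then m q else 0)"
      by (simp only: sum.inter_filter[OF P])
  qed
  also have "\<dots> = (\<Sum>q\<in>P. \<Sum>i\<in>I. if i \<in> S q then m q else 0)" by (rule sum.swap)
  also have "\<dots> = (\<Sum>q\<in>P. m q * F q)"
  proof (intro sum.cong refl)
    fix q
    have "I \<inter> S q = S q" by (auto simp: S_def)
    then show "(\<Sum>i\<in>I. if i \<in> S q then m q else 0) = m q * F q"
      using sum.inter_restrict[OF I, of "\<lambda>_. m q" "S q"] by (simp add: F_def mult.commute)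
  qed
  finally have MF: "2 * M \<le> (\<Sum>q\<in>P. m q * F q)" .
  have "M \<le> 2 * M - M * (\<Sum>q\<in>P. m q)" using total M0 mult_left_mono[OF total M0] by simp
  also have "\<dots> \<le> (\<Sum>q\<in>P. m q * F q) - M * (\<Sum>q\<in>P. m q)" using MF by simp
  also have "\<dots> = (\<Sum>q\<in>P. m q * (F q - M))"
    by (simp add: sum_subtractf sum_distrib_left right_diff_distrib mult.commute)
  finally have "M \<le> (\<Sum>q\<in>P. m q * (F q - M))" .
  then have "3 / 8 * M\<^sup>2 * M \<le> 3 / 8 * M\<^sup>2 * (\<Sum>q\<in>P. m q * (F q - M))"
    by (intro mult_left_mono) auto
  also have "\<dots> \<le> (\<Sum>q\<in>P. m q * real (card (T q)))"
    by (simp only: sum_distrib_left) (intro sum_mono pointwise)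
  finally have low: "3 / 64 * (\<kappa> * real (card I)) ^ 3 \<le> (\<Sum>q\<in>P. m q * real (card (T q)))"
    by (simp add: M_def power2_eq_square power3_eq_cube)
  have "3 / 64 * (\<kappa> * real (card I)) ^ 3 * \<tau> ^ 3 \<le> (\<Sum>q\<in>P. m q * real (card (T q))) * \<tau> ^ 3"
    using low \<tau> by (intro mult_right_mono) auto
  also have "\<dots> = (\<Sum>q\<in>P. \<Sum>t\<in>T q. m q * (\<tau> * (\<tau> * \<tau>)))"
    by (simp add: sum_distrib_left sum_distrib_right power3_eq_cube ac_simps)
  also have "\<dots> \<le> (\<Sum>q\<in>P. \<Sum>(i, j, k)\<in>T q. m q * (tube_mass q i * (tube_mass q j * tube_mass q k)))"
    by (intro sum_mono) (auto simp: T_def S_def \<tau> m intro!: mult_left_mono mult_mono mult_nonneg_nonneg sum_nonneg)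
  also have "\<dots> \<le> (\<Sum>q\<in>P. \<Sum>(i, j, k)\<in>triples. m q * (tube_mass q i * (tube_mass q j * tube_mass q k)))"
    by (intro sum_mono sum_mono2 finite_triples TS) (auto simp: m intro!: mult_nonneg_nonneg sum_nonneg)
  also have "\<dots> \<le> (C0 * (2 * d) powr s)\<^sup>2 * triple_bound" by (rule sum_all_le)
  finally show ?thesis .
qed

end

section \<open>Selecting a scale for each exceptional direction\<close>

lemma finite_card_bound_from_sum:
  fixes l :: "nat \<Rightarrow> nat" and t :: real
  assumes "(\<Sum>i. ennreal (2 powr (- (t * real (l i))))) \<le> 1"
  shows "finite {i. l i = j} \<and> real (card {i. l i = j}) \<le> 2 powr (t * real j)"
proof -
  have bound: "real (card F) \<le> 2 powr (t * real j)" if F: "finite F" "F \<subseteq> {i. l i = j}" for F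
  proof -
    have "ennreal (real (card F) * 2 powr (- (t * real j))) = (\<Sum>i\<in>F. ennreal (2 powr (- (t * real (l i)))))"
    proof -
      have "(\<Sum>i\<in>F. ennreal (2 powr (- (t * real (l i))))) = (\<Sum>i\<in>F. ennreal (2 powr (- (t * real j))))"
        using F by (intro sum.cong) auto
      then show ?thesis by (simp add: ennreal_mult ennreal_of_nat_eq_real_of_nat)
    qed
    also have "\<dots> \<le> (\<Sum>i. ennreal (2 powr (- (t * real (l i)))))"
      using F by (intro sum_le_suminf) auto
    also have "\<dots> \<le> ennreal 1" using assms by simp
    finally have "real (card F) * 2 powr (- (t * real j)) \<le> 1" by (subst (asm) ennreal_le_iff) auto
    then show ?thesis by (simp add: powr_minus field_simps)
  qed
  have fin: "finite {i. l i = j}"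
  proof (rule ccontr)
    assume "infinite {i. l i = j}"
    then obtain F where F: "finite F" "card F = nat \<lceil>2 powr (t * real j)\<rceil> + 1" "F \<subseteq> {i. l i = j}"
      using infinite_arbitrarily_large by blast
    then show False using bound[of F] by linarith
  qed
  then show ?thesis using bound by blast
qed

text \<open>The weights 2^(-t l) of the enlarged covering sets have sum at most 1, so at most 2^(t
  j) of them can have level j.\<close>

lemma hausdorff_null_dyadic_cover:
  fixes A :: "'a::metric_space set"
  assumes t: "0 < t" and null: "hausdorff_measure t A = 0"
  shows "\<exists>c l. (\<forall>i::nat. J \<le> l i) \<and> A \<subseteq> (\<Union>i. ball (c i) (2 / 2 ^ l i)) \<and>
    (\<forall>j. finite {i. l i = j} \<and> real (card {i. l i = j}) \<le> 2 powr (t * real j))"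
proof -
  \<comment> \<open>Half of \<epsilon>'s budget 2^(-t) goes to the given cover and half to the
    enlargement below, 2^t being the loss from rounding radii to powers of 2.\<close>
  define \<epsilon> :: real where "\<epsilon> = 2 powr (-t) / 2"
  have \<epsilon>: "0 < \<epsilon>" by (simp add: \<epsilon>_def)
  have "hausdorff_premeasure t (1 / 2 ^ J) A < ennreal \<epsilon>"
    using null \<epsilon> by (simp add: hausdorff_measure_eq_0_iff)
  then obtain U where U: "A \<subseteq> (\<Union>i. U i)" "\<And>i::nat. bounded (U i)" "\<And>i. diameter (U i) \<le> 1 / 2 ^ J"
    "(\<Sum>i. diam_pow t (U i)) < ennreal \<epsilon>"
    by (rule hausdorff_premeasure_approx) blast
  \<comment> \<open>Empty or one-point covering sets have no dyadic level. They receive a positive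
    radius whose t-th powers sum to at most \<epsilon>.\<close>
  define tiny where "tiny i = min (1 / 2 ^ J) ((\<epsilon> * (1/2) ^ Suc i) powr (1 / t))" for i
  define r where "r i = max (diameter (U i)) (tiny i)" for i
  have tiny: "0 < tiny i" for i using \<epsilon> by (simp add: tiny_def)
  have r: "0 < r i" "r i \<le> 1 / 2 ^ J" "diameter (U i) \<le> r i" for i
    using tiny[of i] U(3)[of i] unfolding r_def by (simp_all add: less_max_iff_disj tiny_def)
  have "\<forall>i. \<exists>l. 1 / 2 ^ Suc l < r i \<and> r i \<le> 1 / 2 ^ l"
  proof
    fix i
    have "1 / 2 ^ J \<le> (1 :: real)" by simp
    then have "r i \<le> 1" using r(2)[of i] by linarith
    then show "\<exists>l. 1 / 2 ^ Suc l < r i \<and> r i \<le> 1 / 2 ^ l" using dyadic_bracket[OF r(1)] by blast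
  qed
  then obtain l where l1: "1 / 2 ^ Suc (l i) < r i" and l2: "r i \<le> 1 / 2 ^ l i" for i by metis
  have lJ: "J \<le> l i" for i
  proof -
    have "1 / 2 ^ Suc (l i) < (1 / 2 ^ J :: real)" using l1[of i] r(2)[of i] by linarith
    then have "(2::real) ^ J < 2 ^ Suc (l i)" by (simp add: field_simps)
    then have "J < Suc (l i)" by (subst (asm) power_strict_increasing_iff) auto
    then show ?thesis by simp
  qed
  have w: "ennreal (2 powr (- (t * real (l i)))) \<le> ennreal (2 powr t) * (diam_pow t (U i) + ennreal (\<epsilon> * (1/2) ^ Suc i))" for i
  proof -
    have "2 powr (- real (l i)) \<le> 2 * r i" using l1[of i] by (simp add: powr_minus powr_realpow field_simps)
    then have "(2 powr (- real (l i))) powr t \<le> (2 * r i) powr t" using t by (intro powr_mono2) auto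
    also have "\<dots> = 2 powr t * r i powr t" using r(1)[of i] by (simp add: powr_mult)
    finally have 1: "2 powr (- (t * real (l i))) \<le> 2 powr t * r i powr t" by (simp add: powr_powr mult.commute)
    have "tiny i powr t \<le> ((\<epsilon> * (1/2) ^ Suc i) powr (1 / t)) powr t"
      using t tiny[of i] by (intro powr_mono2) (auto simp: tiny_def)
    also have "\<dots> = \<epsilon> * (1/2) ^ Suc i" using t \<epsilon> by (simp add: powr_powr)
    finally have ty: "tiny i powr t \<le> \<epsilon> * (1/2) ^ Suc i" .
    have "ennreal (r i powr t) \<le> diam_pow t (U i) + ennreal (\<epsilon> * (1/2) ^ Suc i)"
    proof (cases "diameter (U i) \<le> tiny i")
      case True
      then have "ennreal (r i powr t) \<le> ennreal (\<epsilon> * (1/2) ^ Suc i)" using ty by (intro ennreal_leI) (simp add: r_def max_def)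
      then show ?thesis by (rule order_trans) (simp add: add_increasing)
    next
      case False
      then have "U i \<noteq> {}" using tiny[of i] by auto
      then have "ennreal (r i powr t) \<le> diam_pow t (U i)" using False t by (simp add: r_def max_def diam_pow_def)
      then show ?thesis by (rule order_trans) (simp add: add_increasing2)
    qed
    then have "ennreal (2 powr t) * ennreal (r i powr t) \<le> ennreal (2 powr t) * (diam_pow t (U i) + ennreal (\<epsilon> * (1/2) ^ Suc i))"
      by (rule mult_left_mono) simp
    moreover have "ennreal (2 powr (- (t * real (l i)))) \<le> ennreal (2 powr t) * ennreal (r i powr t)"
      using 1 by (simp add: ennreal_mult[symmetric])
    ultimately show ?thesis by (rule order_trans[rotated])
  qed
  have "(\<Sum>i. ennreal (2 powr (- (t * real (l i))))) \<le> (\<Sum>i. ennreal (2 powr t) * (diam_pow t (U i) + ennreal (\<epsilon> * (1/2) ^ Suc i)))"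
    by (intro suminf_le w) auto
  also have "\<dots> = ennreal (2 powr t) * ((\<Sum>i. diam_pow t (U i)) + (\<Sum>i. ennreal (\<epsilon> * (1/2) ^ Suc i)))"
    by (simp only: ennreal_suminf_cmult suminf_add[OF summableI summableI])
  also have "(\<Sum>i. ennreal (\<epsilon> * (1/2) ^ Suc i)) = ennreal \<epsilon>"
    using \<epsilon> by (simp only: suminf_ennreal_geometric)
  also have "ennreal (2 powr t) * ((\<Sum>i. diam_pow t (U i)) + ennreal \<epsilon>) \<le> ennreal (2 powr t) * (ennreal \<epsilon> + ennreal \<epsilon>)"
    using U(4) by (intro mult_left_mono add_right_mono) auto
  also have "\<dots> = ennreal (2 powr t * (\<epsilon> + \<epsilon>))"
    using \<epsilon> by (simp add: ennreal_mult flip: ennreal_plus)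
  also have "2 powr t * (\<epsilon> + \<epsilon>) = 1" by (simp add: \<epsilon>_def powr_minus)
  finally have sum1: "(\<Sum>i. ennreal (2 powr (- (t * real (l i))))) \<le> 1" by simp
  define c where "c i = (SOME x. x \<in> U i)" for i
  have "A \<subseteq> (\<Union>i. ball (c i) (2 / 2 ^ l i))"
  proof
    fix x assume "x \<in> A"
    then obtain i where i: "x \<in> U i" using U(1) by blast
    then have "c i \<in> U i" unfolding c_def by (rule someI)
    then have "dist (c i) x \<le> diameter (U i)" using i U(2) by (intro diameter_bounded_bound)
    also have "\<dots> \<le> 1 / 2 ^ l i" using r(3)[of i] l2[of i] by linarith
    also have "\<dots> < 2 / 2 ^ l i" by (simp add: field_simps)
    finally show "x \<in> (\<Union>i. ball (c i) (2 / 2 ^ l i))" by auto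
  qed
  then show ?thesis using lJ finite_card_bound_from_sum[OF sum1] by blast
qed

section \<open>Pigeonholing mass over levels, balls and annuli\<close>

lemma sum_UN_le:
  fixes f :: "'a \<Rightarrow> real"
  assumes "finite I" "\<And>i. i \<in> I \<Longrightarrow> finite (A i)" "\<And>x. 0 \<le> f x"
  shows "(\<Sum>x\<in>(\<Union>i\<in>I. A i). f x) \<le> (\<Sum>i\<in>I. \<Sum>x\<in>A i. f x)"
  using assms
proof (induction I rule: finite_induct)
  case (insert i I)
  have "(\<Sum>x\<in>A i \<union> (\<Union>i\<in>I. A i). f x) \<le> (\<Sum>x\<in>A i. f x) + (\<Sum>x\<in>(\<Union>i\<in>I. A i). f x)"
    using insert by (subst sum_Un) (auto intro: sum_nonneg)
  then show ?case using insert by fastforce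
qed simp

lemma sum_ge_imp_ex:
  fixes f :: "'k \<Rightarrow> real"
  assumes "finite S" "x \<le> (\<Sum>k\<in>S. f k)" "real (card S) \<le> N" "0 < x"
  shows "\<exists>k\<in>S. x / N \<le> f k"
proof (rule ccontr)
  assume "\<not> ?thesis"
  then have *: "\<And>k. k \<in> S \<Longrightarrow> f k < x / N" by auto
  have "S \<noteq> {}" using assms by auto
  then have "(\<Sum>k\<in>S. f k) < (\<Sum>k\<in>S. x / N)" using * assms(1) by (intro sum_strict_mono) auto
  also have "\<dots> = real (card S) * (x / N)" by simp
  also have "\<dots> \<le> N * (x / N)" using assms by (intro mult_right_mono divide_nonneg_nonneg) auto
  also have "\<dots> \<le> x" using assms(4) by (cases "N = 0") auto
  finally show False using assms(2) by simp
qed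

locale projected_weights = frostman_weights \<nu> s z + circle_frame n u v h R
  for \<nu> s z n u v h R +
  fixes K' :: "(real ^ 3) set"
  assumes compact_K': "compact K'"
    and meets: "\<And>n b. 0 < \<nu> n b \<Longrightarrow> K' \<inter> closed_cell n b \<noteq> {}"
begin

definition proj :: "real \<Rightarrow> real ^ 3 \<Rightarrow> real ^ 3" where
  "proj \<theta> x = x - (x \<bullet> \<gamma> \<theta>) *\<^sub>R \<gamma> \<theta>"

lemma proj_diff: "proj \<theta> (x - y) = proj \<theta> x - proj \<theta> y"
  by (simp add: proj_def inner_diff_left algebra_simps)

lemma near_line_proj: "near_line \<theta> r x \<longleftrightarrow> norm (proj \<theta> x) \<le> r"
  by (simp add: near_line_def proj_def)

lemma norm_proj_le: "norm (proj \<theta> x) \<le> norm x"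
proof -
  have 1: "\<gamma> \<theta> \<bullet> \<gamma> \<theta> = 1" using norm_\<gamma> by (simp add: norm_eq_1)
  have "proj \<theta> x \<bullet> proj \<theta> x = x \<bullet> x - (x \<bullet> \<gamma> \<theta>)\<^sup>2"
    unfolding proj_def inner_diff_left inner_diff_right inner_scaleR_left inner_scaleR_right 1
    by (simp add: inner_commute[of "\<gamma> \<theta>" x] power2_eq_square)
  also have "\<dots> \<le> x \<bullet> x" by simp
  finally show ?thesis by (simp add: norm_le)
qed

lemma continuous_proj: "continuous_on S (proj \<theta>)"
  unfolding proj_def by (intro continuous_intros)

text \<open>10 = 2 (3 + 2): a corner is within 3 / 2^j of a point of its cell whose projection is
  within 2 / 2^j of the centre of a covering ball, and two such corners are compared.\<close>

abbreviation line_mass :: "real \<Rightarrow> nat \<Rightarrow> int ^ 3 \<Rightarrow> real" where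
  "line_mass \<theta> j b \<equiv> \<Sum>b' | b' \<in> cells_at j \<and> near_line \<theta> (10 / 2 ^ j) (corner j b - corner j b'). \<nu> j b'"

abbreviation annulus_mass :: "real \<Rightarrow> nat \<Rightarrow> nat \<Rightarrow> int ^ 3 \<Rightarrow> real" where
  "annulus_mass \<theta> j k q \<equiv>
     \<Sum>p | p \<in> cells_at j \<and> tangent \<theta> (10 / 2 ^ j) (4 / 2 ^ k) (corner j q - corner j p). \<nu> j p"

text \<open>Compactness leaves finitely many balls and thus a finest level \<open>n0\<close>. Each
  cell of positive mass there meets \<open>K'\<close> at a point lying over one of the balls, and
  its ancestor at the level of that ball is counted at that level. If every level collected less
  than \<open>\<kappa> j\<close>, the total would fall short of \<open>\<nu> 0 z\<close>.\<close>

lemma covered_scale: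
  assumes l: "\<And>i. J \<le> l i" and fin: "\<And>j. finite {i. l i = j}"
    and cov: "proj \<theta> ` K' \<subseteq> (\<Union>i::nat. ball (c i) (2 / 2 ^ l i))"
    and small: "\<And>F. finite F \<Longrightarrow> F \<subseteq> {J..} \<Longrightarrow> (\<Sum>j\<in>F. \<kappa> j) < \<nu> 0 z"
  shows "\<exists>j\<ge>J. \<kappa> j \<le> (\<Sum>b | b \<in> cells_at j \<and> (\<exists>i. l i = j \<and> norm (proj \<theta> (corner j b) - c i) \<le> 5 / 2 ^ j). \<nu> j b)"
proof (rule ccontr)
  define H where "H j = {b \<in> cells_at j. \<exists>i. l i = j \<and> norm (proj \<theta> (corner j b) - c i) \<le> 5 / 2 ^ j}" for j
  assume nex: "\<not> ?thesis"
  have lt: "(\<Sum>b\<in>H j. \<nu> j b) < \<kappa> j" if "J \<le> j" for j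
  proof (rule ccontr)
    assume "\<not> (\<Sum>b\<in>H j. \<nu> j b) < \<kappa> j"
    then show False using nex that unfolding H_def not_less by blast
  qed
  have opn: "open (proj \<theta> -` ball (c i) (2 / 2 ^ l i))" for i
    by (intro open_vimage open_ball continuous_proj)
  have "K' \<subseteq> (\<Union>i\<in>UNIV. proj \<theta> -` ball (c i) (2 / 2 ^ l i))"
    using cov by (simp only: image_subset_iff_subset_vimage vimage_UN)
  then obtain N where N: "finite N" "K' \<subseteq> (\<Union>i\<in>N. proj \<theta> -` ball (c i) (2 / 2 ^ l i))"
    by (rule compactE_image[OF compact_K' opn])
  define n0 where "n0 = Max (insert 0 (l ` N))"
  have ln: "l i \<le> n0" if "i \<in> N" for i using that N(1) by (auto simp: n0_def)
  have finH: "finite (H j)" for j using finite_cells_at by (simp add: H_def)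
  let ?D = "\<lambda>j. {b \<in> cells_at n0. (cell_parent ^^ (n0 - j)) b \<in> H j}"
  have anc: "\<exists>j\<in>l ` N. b \<in> ?D j" if b: "b \<in> cells_at n0" "0 < \<nu> n0 b" for b
  proof -
    obtain x where x: "x \<in> K'" "x \<in> closed_cell n0 b" using meets[OF b(2)] by auto
    then obtain i where "i \<in> N" "x \<in> proj \<theta> -` ball (c i) (2 / 2 ^ l i)"
      using N(2) by blast
    then have i: "i \<in> N" "norm (proj \<theta> x - c i) < 2 / 2 ^ l i"
      by (simp_all add: dist_norm norm_minus_commute)
    define j where "j = l i"
    define a where "a = (cell_parent ^^ (n0 - j)) b"
    have n0: "n0 = j + (n0 - j)" using ln[OF i(1)] by (simp add: j_def)
    have "(cell_parent ^^ j) a = (cell_parent ^^ (j + (n0 - j))) b"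
      by (simp only: a_def funpow_add comp_apply)
    also have "\<dots> = z" using b(1) n0 by (simp only: cells_at_def mem_Collect_eq n0[symmetric])
    finally have "a \<in> cells_at j" by (simp add: cells_at_def)
    have "x \<in> closed_cell j a" unfolding a_def using x(2) by (intro closed_cell_mono_funpow) (simp only: n0[symmetric])
    then have "norm (corner j a - x) \<le> 3 / 2 ^ j" by (intro closed_cell_dist[of _ j a] corner_in_closed_cell)
    then have "norm (proj \<theta> (corner j a) - proj \<theta> x) \<le> 3 / 2 ^ j"
      using norm_proj_le[of \<theta> "corner j a - x"] by (simp add: proj_diff)
    then have "norm (proj \<theta> (corner j a) - c i) \<le> 3 / 2 ^ j + 2 / 2 ^ j"
      using i(2) norm_triangle_ineq[of "proj \<theta> (corner j a) - proj \<theta> x" "proj \<theta> x - c i"] by (simp add: j_def)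
    then have "norm (proj \<theta> (corner j a) - c i) \<le> 5 / 2 ^ j" by (simp add: add_divide_distrib[symmetric])
    then have "a \<in> H j" unfolding H_def using \<open>a \<in> cells_at j\<close> j_def by blast
    then have "b \<in> ?D j" using b(1) by (simp add: a_def)
    moreover have "j \<in> l ` N" using i(1) by (simp add: j_def)
    ultimately show ?thesis by blast
  qed
  have "\<nu> 0 z = (\<Sum>b\<in>cells_at n0. \<nu> n0 b)" by (simp add: sum_cells_at)
  also have "\<dots> = (\<Sum>b | b \<in> cells_at n0 \<and> 0 < \<nu> n0 b. \<nu> n0 b)"
    by (rule sum.mono_neutral_right) (use finite_cells_at nonneg in \<open>auto simp: less_le\<close>)
  also have "\<dots> \<le> (\<Sum>b\<in>(\<Union>j\<in>l ` N. ?D j). \<nu> n0 b)"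
    using anc finite_cells_at N(1) by (intro sum_mono2) (auto simp: nonneg)
  also have "\<dots> \<le> (\<Sum>j\<in>l ` N. \<Sum>b\<in>?D j. \<nu> n0 b)"
    using finite_cells_at N(1) nonneg by (intro sum_UN_le) auto
  also have "\<dots> \<le> (\<Sum>j\<in>l ` N. \<kappa> j)"
  proof (rule sum_mono)
    fix j assume j: "j \<in> l ` N"
    then have jn: "n0 = j + (n0 - j)" and J: "J \<le> j" using ln l by auto
    have "(\<Sum>b\<in>?D j. \<nu> n0 b) \<le> (\<Sum>a\<in>(cell_parent ^^ (n0 - j)) ` ?D j. \<nu> j a)"
      using sum_le_ancestors[of "?D j" j "n0 - j"] finite_cells_at jn by simp
    also have "\<dots> \<le> (\<Sum>a\<in>H j. \<nu> j a)" by (intro sum_mono2 finH) (auto simp: nonneg)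
    finally show "(\<Sum>b\<in>?D j. \<nu> n0 b) \<le> \<kappa> j" using lt[OF J] by linarith
  qed
  also have "\<dots> < \<nu> 0 z" using N(1) l by (intro small) auto
  finally show False by simp
qed

text \<open>Each counted cell is assigned to one of at most \<open>N\<close> centres. Cells with
  line mass below \<kappa> / (2 N) contribute less than that amount per centre, since all cells at
  one centre lie in a common tube; together they lose at most half of \<kappa>.\<close>

lemma rich_directions:
  assumes \<kappa>: "0 < \<kappa>" and V: "finite V" "real (card V) \<le> N"
    and H: "\<kappa> \<le> (\<Sum>b | b \<in> cells_at j \<and> (\<exists>v\<in>V. norm (proj \<theta> (corner j b) - v) \<le> 5 / 2 ^ j). \<nu> j b)"
  shows "\<kappa> / 2 \<le> (\<Sum>b | b \<in> cells_at j \<and>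
      \<kappa> / (2 * N) \<le> line_mass \<theta> j b. \<nu> j b)"
proof -
  let ?H = "{b \<in> cells_at j. \<exists>v\<in>V. norm (proj \<theta> (corner j b) - v) \<le> 5 / 2 ^ j}"
  let ?G = "{b \<in> cells_at j. \<kappa> / (2 * N) \<le> line_mass \<theta> j b}"
  have finH: "finite ?H" using finite_cells_at by simp
  have "\<forall>b\<in>?H. \<exists>v. v \<in> V \<and> norm (proj \<theta> (corner j b) - v) \<le> 5 / 2 ^ j" by blast
  from bchoice[OF this] obtain f
    where f: "\<And>b. b \<in> ?H \<Longrightarrow> f b \<in> V \<and> norm (proj \<theta> (corner j b) - f b) \<le> 5 / 2 ^ j" by blast
  have "?H \<noteq> {}"
  proof
    assume "?H = {}"
    then have "(\<Sum>b\<in>?H. \<nu> j b) = 0" by (simp only: sum.empty)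
    then show False using H \<kappa> by linarith
  qed
  then have "V \<noteq> {}" by auto
  then have "0 < card V" using V(1) by (simp add: card_gt_0_iff)
  then have N: "0 < N" using V(2) by linarith
  have poor: "(\<Sum>b\<in>?H - ?G. \<nu> j b) \<le> \<kappa> / 2"
  proof -
    have "(\<Sum>b\<in>?H - ?G. \<nu> j b) = (\<Sum>v\<in>f ` (?H - ?G). \<Sum>b | b \<in> ?H - ?G \<and> f b = v. \<nu> j b)"
      using finH by (intro sum.image_gen) auto
    also have "\<dots> \<le> (\<Sum>v\<in>f ` (?H - ?G). \<kappa> / (2 * N))"
    proof (rule sum_mono)
      fix v assume "v \<in> f ` (?H - ?G)"
      then obtain b0 where b0: "b0 \<in> ?H" "b0 \<notin> ?G" "v = f b0" by blast
      have "(\<Sum>b | b \<in> ?H - ?G \<and> f b = v. \<nu> j b)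
          \<le> line_mass \<theta> j b0"
      proof (rule sum_mono2)
        show "{b \<in> ?H - ?G. f b = v} \<subseteq> {b' \<in> cells_at j. near_line \<theta> (10 / 2 ^ j) (corner j b0 - corner j b')}"
        proof
          fix b assume "b \<in> {b \<in> ?H - ?G. f b = v}"
          then have b: "b \<in> ?H" "f b = v" by blast+
          then have "norm (proj \<theta> (corner j b) - v) \<le> 5 / 2 ^ j" using f[OF b(1)] by simp
          moreover have "norm (proj \<theta> (corner j b0) - v) \<le> 5 / 2 ^ j" using f[OF b0(1)] b0(3) by simp
          moreover have "proj \<theta> (corner j b0 - corner j b)
              = (proj \<theta> (corner j b0) - v) - (proj \<theta> (corner j b) - v)"
            by (simp add: proj_diff)
          ultimately have "norm (proj \<theta> (corner j b0 - corner j b)) \<le> 10 / 2 ^ j"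
            using norm_triangle_ineq4[of "proj \<theta> (corner j b0) - v" "proj \<theta> (corner j b) - v"] by simp
          then show "b \<in> {b' \<in> cells_at j. near_line \<theta> (10 / 2 ^ j) (corner j b0 - corner j b')}"
            using b(1) by (simp add: near_line_proj)
        qed
      qed (use finite_cells_at nonneg in auto)
      then show "(\<Sum>b | b \<in> ?H - ?G \<and> f b = v. \<nu> j b) \<le> \<kappa> / (2 * N)" using b0 by auto
    qed
    also have "\<dots> = real (card (f ` (?H - ?G))) * (\<kappa> / (2 * N))" by simp
    also have "\<dots> \<le> N * (\<kappa> / (2 * N))"
    proof (rule mult_right_mono)
      have "card (f ` (?H - ?G)) \<le> card V" using f V(1) by (intro card_mono) blast+
      then show "real (card (f ` (?H - ?G))) \<le> N" using V(2) by linarith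
    qed (use \<kappa> N in simp)
    also have "\<dots> = \<kappa> / 2" using N by simp
    finally show ?thesis .
  qed
  have "(\<Sum>b\<in>?H. \<nu> j b) = (\<Sum>b\<in>?H - ?G. \<nu> j b) + (\<Sum>b\<in>?H \<inter> ?G. \<nu> j b)"
    using sum.Int_Diff[OF finH, of "\<nu> j" ?G] by simp
  then have "\<kappa> / 2 \<le> (\<Sum>b\<in>?H \<inter> ?G. \<nu> j b)" using H poor by linarith
  also have "\<dots> \<le> (\<Sum>b\<in>?G. \<nu> j b)" using finite_cells_at nonneg by (intro sum_mono2) auto
  finally show ?thesis .
qed

lemma corner_dist_le:
  assumes "b \<in> cells_at j" "b' \<in> cells_at j"
  shows "norm (corner j b - corner j b') \<le> 3"
proof -
  have "corner j a \<in> closed_cell 0 z" if "a \<in> cells_at j" for a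
    using closed_cell_mono_funpow[of "corner j a" 0 j a] corner_in_closed_cell[of j a] that
    by (simp add: cells_at_def)
  then show ?thesis using closed_cell_dist[of "corner j b" 0 z "corner j b'"] assms by simp
qed

text \<open>The part of a tube within 40 / 2^j of its base point is negligible by
  \<open>small\<close>; distances from there up to 4 fall into fewer than j dyadic annuli. One
  pigeonhole finds a rich annulus for each cell, a second one an annulus common to a 1/j share of
  the mass. The cut-off 40 is 4 times the tube radius 10, as the tangency lemmas demand.\<close>

lemma rich_annulus:
  assumes \<kappa>: "0 < \<kappa>" and \<tau>: "0 < \<tau>" and j: "1 \<le> j"
    and G: "\<kappa> \<le> (\<Sum>b | b \<in> cells_at j \<and>
      \<tau> \<le> line_mass \<theta> j b. \<nu> j b)"
    and small: "125 * 2 powr s * (40 / 2 ^ j) powr s \<le> \<tau> / 2"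
  shows "\<exists>k<j. 40 / 2 ^ j \<le> (4 / 2 ^ k :: real) \<and> \<kappa> / j \<le> (\<Sum>q | q \<in> cells_at j \<and>
      \<tau> / 2 / j \<le> annulus_mass \<theta> j k q. \<nu> j q)"
proof -
  define Ks where "Ks = {k. k < j \<and> 40 / 2 ^ j \<le> (4 / 2 ^ k :: real)}"
  have Ks: "finite Ks" "real (card Ks) \<le> real j"
  proof -
    have "Ks \<subseteq> {..<j}" by (auto simp: Ks_def)
    then show "finite Ks" "real (card Ks) \<le> real j"
      using card_mono[of "{..<j}" Ks] by (auto intro: finite_subset)
  qed
  let ?X = "\<lambda>b. {b' \<in> cells_at j. near_line \<theta> (10 / 2 ^ j) (corner j b - corner j b')}"
  let ?Y = "\<lambda>k b. {b' \<in> cells_at j. tangent \<theta> (10 / 2 ^ j) (4 / 2 ^ k) (corner j b - corner j b')}"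
  let ?Z = "\<lambda>b. {b' \<in> cells_at j. norm (corner j b' - corner j b) \<le> 40 / 2 ^ j}"
  have split: "?X b \<subseteq> ?Z b \<union> (\<Union>k\<in>Ks. ?Y k b)" if b: "b \<in> cells_at j" for b
  proof
    fix b' assume b': "b' \<in> ?X b"
    let ?x = "corner j b - corner j b'"
    show "b' \<in> ?Z b \<union> (\<Union>k\<in>Ks. ?Y k b)"
    proof (cases "norm ?x \<le> 40 / 2 ^ j")
      case True
      then show ?thesis using b' by (simp add: norm_minus_commute)
    next
      case False
      have "norm ?x / 4 \<le> 1" using corner_dist_le[OF b, of b'] b' by simp
      moreover have "0 < norm ?x"
      proof -
        have "0 < (40 / 2 ^ j :: real)" by simp
        then show ?thesis using False by linarith
      qed
      ultimately obtain k where "1 / 2 ^ Suc k < norm ?x / 4" "norm ?x / 4 \<le> 1 / 2 ^ k"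
        using dyadic_bracket[of "norm ?x / 4"] by auto
      then have k1: "4 / 2 ^ Suc k < norm ?x" and k2: "norm ?x \<le> 4 / 2 ^ k" by simp_all
      have d: "40 / 2 ^ j \<le> (4 / 2 ^ k :: real)" using False k2 by linarith
      then have "(2::real) ^ k * 10 \<le> 2 ^ j" by (simp add: field_simps)
      then have "(2::real) ^ k < 2 ^ j" using zero_less_power[of "2::real" k] by linarith
      then have "k < j" by (subst (asm) power_strict_increasing_iff) auto
      then have "k \<in> Ks" using d by (simp add: Ks_def)
      moreover have "b' \<in> ?Y k b" using b' k1 k2 by (simp add: tangent_def)
      ultimately show ?thesis by blast
    qed
  qed
  have ex: "\<exists>k\<in>Ks. \<tau> / 2 / j \<le> (\<Sum>b'\<in>?Y k b. \<nu> j b')"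
    if b: "b \<in> cells_at j" "\<tau> \<le> (\<Sum>b'\<in>?X b. \<nu> j b')" for b
  proof -
    have "\<tau> \<le> (\<Sum>b'\<in>?Z b \<union> (\<Union>k\<in>Ks. ?Y k b). \<nu> j b')"
      using b(2) split[OF b(1)] finite_cells_at Ks(1) nonneg
      by (intro order_trans[OF b(2)] sum_mono2) auto
    also have "\<dots> \<le> (\<Sum>b'\<in>?Z b. \<nu> j b') + (\<Sum>b'\<in>(\<Union>k\<in>Ks. ?Y k b). \<nu> j b')"
      using finite_cells_at Ks(1) nonneg by (subst sum_Un) (auto intro: sum_nonneg)
    also have "\<dots> \<le> \<tau> / 2 + (\<Sum>k\<in>Ks. \<Sum>b'\<in>?Y k b. \<nu> j b')"
    proof (rule add_mono)
      have "(\<Sum>b'\<in>?Z b. \<nu> j b') \<le> 125 * 2 powr s * (40 / 2 ^ j) powr s"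
        by (rule ball_bound) (simp add: divide_right_mono)
      then show "(\<Sum>b'\<in>?Z b. \<nu> j b') \<le> \<tau> / 2" using small by linarith
      show "(\<Sum>b'\<in>(\<Union>k\<in>Ks. ?Y k b). \<nu> j b') \<le> (\<Sum>k\<in>Ks. \<Sum>b'\<in>?Y k b. \<nu> j b')"
        using finite_cells_at Ks(1) nonneg by (intro sum_UN_le) auto
    qed
    finally have "\<tau> / 2 \<le> (\<Sum>k\<in>Ks. \<Sum>b'\<in>?Y k b. \<nu> j b')" by linarith
    then show ?thesis using Ks \<tau> by (intro sum_ge_imp_ex) auto
  qed
  let ?G = "{b \<in> cells_at j. \<tau> \<le> (\<Sum>b'\<in>?X b. \<nu> j b')}"
  let ?H = "\<lambda>k. {q \<in> cells_at j. \<tau> / 2 / j \<le> (\<Sum>p\<in>?Y k q. \<nu> j p)}"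
  have "\<kappa> \<le> (\<Sum>b\<in>?G. \<nu> j b)" using G by simp
  also have "\<dots> \<le> (\<Sum>b\<in>(\<Union>k\<in>Ks. ?H k). \<nu> j b)"
    using ex finite_cells_at Ks(1) nonneg by (intro sum_mono2) auto
  also have "\<dots> \<le> (\<Sum>k\<in>Ks. \<Sum>b\<in>?H k. \<nu> j b)"
    using finite_cells_at Ks(1) nonneg by (intro sum_UN_le) auto
  finally have "\<exists>k\<in>Ks. \<kappa> / j \<le> (\<Sum>b\<in>?H k. \<nu> j b)"
    using Ks \<kappa> by (intro sum_ge_imp_ex) auto
  then show ?thesis by (auto simp: Ks_def)
qed

text \<open>The tube mass \<kappa> / (2 * 2^(t j)) stems from \<open>rich_directions\<close> with
  2^(t j) balls, the extra factors 1/2 and 1/j from \<open>rich_annulus\<close>. The scale found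
  depends on the direction, hence the later union over all j.\<close>

lemma good_scale:
  assumes t: "0 < t" and null: "hausdorff_measure t (proj \<theta> ` K') = 0" and J: "1 \<le> J"
    and \<kappa>: "\<And>j. 0 < \<kappa> j"
    and sums: "\<And>F. finite F \<Longrightarrow> F \<subseteq> {J..} \<Longrightarrow> (\<Sum>j\<in>F. \<kappa> j) < \<nu> 0 z"
    and small: "\<And>j. J \<le> j \<Longrightarrow> 125 * 2 powr s * (40 / 2 ^ j) powr s \<le> \<kappa> j / (2 * 2 powr (t * real j)) / 2"
  shows "\<exists>j\<ge>J. \<exists>k<j. 40 / 2 ^ j \<le> (4 / 2 ^ k :: real) \<and> \<kappa> j / 2 / j \<le> (\<Sum>q | q \<in> cells_at j \<and>
      \<kappa> j / (2 * 2 powr (t * real j)) / 2 / j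
        \<le> annulus_mass \<theta> j k q. \<nu> j q)"
proof -
  obtain c l where cl: "\<And>i::nat. J \<le> l i" "proj \<theta> ` K' \<subseteq> (\<Union>i. ball (c i) (2 / 2 ^ l i))"
    "\<And>j. finite {i. l i = j}" "\<And>j. real (card {i. l i = j}) \<le> 2 powr (t * real j)"
    using hausdorff_null_dyadic_cover[OF t null, of J] by blast
  obtain j where j: "J \<le> j"
    "\<kappa> j \<le> (\<Sum>b | b \<in> cells_at j \<and> (\<exists>i. l i = j \<and> norm (proj \<theta> (corner j b) - c i) \<le> 5 / 2 ^ j). \<nu> j b)"
    using covered_scale[where \<kappa> = \<kappa>, OF cl(1,3,2) sums] by blast
  define V where "V = c ` {i. l i = j}"
  have V: "finite V" "real (card V) \<le> 2 powr (t * real j)"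
    using cl(3)[of j] cl(4)[of j] card_image_le[OF cl(3)[of j], of c] by (auto simp: V_def)
  have "\<kappa> j \<le> (\<Sum>b | b \<in> cells_at j \<and> (\<exists>v\<in>V. norm (proj \<theta> (corner j b) - v) \<le> 5 / 2 ^ j). \<nu> j b)"
  proof -
    have "{b \<in> cells_at j. \<exists>i. l i = j \<and> norm (proj \<theta> (corner j b) - c i) \<le> 5 / 2 ^ j}
      = {b \<in> cells_at j. \<exists>v\<in>V. norm (proj \<theta> (corner j b) - v) \<le> 5 / 2 ^ j}"
      by (auto simp: V_def)
    then show ?thesis using j(2) by simp
  qed
  from rich_annulus[OF _ _ _ rich_directions[OF \<kappa>[of j] V this] small[OF j(1)]] \<kappa>[of j] j(1) J
  show ?thesis by (intro exI[of _ j]) auto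
qed

end

section \<open>The exceptional set of directions\<close>

lemma linear_le_powr:
  assumes "0 < c"
  shows "real j * (2 powr c - 1) \<le> 2 powr (c * real j)"
proof -
  have "0 < 2 powr c - 1" using assms powr_less_mono[of 0 c 2] by simp
  then have "1 + real j * (2 powr c - 1) \<le> (1 + (2 powr c - 1)) ^ j"
    by (intro Bernoulli_inequality) linarith
  also have "\<dots> = 2 powr (c * real j)" by (simp add: powr_powr flip: powr_realpow)
  finally show ?thesis by linarith
qed

lemma eventually_const_le_powr:
  fixes c M :: real assumes "0 < c"
  shows "\<forall>\<^sub>F j in sequentially. M \<le> 2 powr (c * real j)"
proof -
  have y: "0 < 2 powr c - 1" using assms powr_less_mono[of 0 c 2] by simp
  have "M \<le> 2 powr (c * real j)" if "nat \<lceil>M / (2 powr c - 1)\<rceil> \<le> j" for j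
  proof -
    have "M / (2 powr c - 1) \<le> real j" using that by linarith
    then have "M \<le> real j * (2 powr c - 1)" using y by (simp add: pos_divide_le_eq)
    then show ?thesis using linear_le_powr[OF assms, of j] by linarith
  qed
  then show ?thesis unfolding eventually_sequentially by blast
qed

lemma eventually_linear_le_powr:
  fixes c M :: real assumes "0 < c"
  shows "\<forall>\<^sub>F j in sequentially. M * real j \<le> 2 powr (c * real j)"
proof -
  have c: "0 < c / 2" using assms by simp
  then have y: "0 < 2 powr (c / 2) - 1" using powr_less_mono[of 0 "c / 2" 2] by simp
  have "\<forall>\<^sub>F j in sequentially. M / (2 powr (c / 2) - 1) \<le> 2 powr (c / 2 * real j)"
    by (rule eventually_const_le_powr[OF c])
  then show ?thesis
  proof eventually_elim
    case (elim j)
    have "M * real j = (M / y) * (real j * y)" if "0 < y" for y using that by simp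
    from this[OF y] have "M * real j = (M / (2 powr (c / 2) - 1)) * (real j * (2 powr (c / 2) - 1))" .
    also have "\<dots> \<le> 2 powr (c / 2 * real j) * (2 powr (c / 2 * real j))"
      using elim y linear_le_powr[OF c, of j] by (intro mult_mono mult_nonneg_nonneg) auto
    also have "\<dots> = 2 powr (c * real j)" by (simp flip: powr_add add: field_simps)
    finally show ?case .
  qed
qed

context projected_weights begin

definition good :: "real \<Rightarrow> real \<Rightarrow> real \<Rightarrow> nat \<Rightarrow> nat \<Rightarrow> bool" where
  "good \<kappa> \<tau> \<theta> j k \<longleftrightarrow> \<kappa> \<le> (\<Sum>q | q \<in> cells_at j \<and>
      \<tau> \<le> annulus_mass \<theta> j k q. \<nu> j q)"

lemma good_mono:
  assumes "good \<kappa> \<tau> \<theta> j k" "\<kappa>' \<le> \<kappa>" "\<tau>' \<le> \<tau>"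
  shows "good \<kappa>' \<tau>' \<theta> j k"
proof -
  have "(\<Sum>q | q \<in> cells_at j \<and>
      \<tau> \<le> annulus_mass \<theta> j k q. \<nu> j q)
    \<le> (\<Sum>q | q \<in> cells_at j \<and>
      \<tau>' \<le> annulus_mass \<theta> j k q. \<nu> j q)"
    using assms(3) finite_cells_at nonneg by (intro sum_mono2) auto
  then show ?thesis using assms(1,2) unfolding good_def by linarith
qed

definition mass_const :: real where "mass_const = 125 * 2 powr s"

text \<open>The constants of \<open>tangency_bound\<close> at relative thickness A = 10, with powers
  of d, \<rho> and 2^j split off; 720 = 72 * 10.\<close>

definition count_const :: real where
  "count_const = (mass_const * 2 powr s)\<^sup>2 * angle_const 10 ^ 3 * (48 * nondeg_const + 3) ^ 3
     * (mass_const * (720 * nondeg_const) powr s)"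

lemma good_directions_count:
  assumes k: "40 / 2 ^ j \<le> (4 / 2 ^ k :: real)" and I: "finite I"
    and \<theta>: "\<And>i. i \<in> I \<Longrightarrow> a0 + real i / 2 ^ j \<le> \<theta> i \<and> \<theta> i \<le> a0 + (real i + 1) / 2 ^ j"
      "\<And>i. i \<in> I \<Longrightarrow> \<theta> i \<in> {a0..a0 + 1}"
    and good: "\<And>i. i \<in> I \<Longrightarrow> good \<kappa> \<tau> (\<theta> i) j k"
    and \<kappa>: "0 \<le> \<kappa>" and \<tau>: "0 \<le> \<tau>" and \<rho>: "1 / 2 ^ j \<le> \<rho>" "\<rho> \<le> 1"
    and big: "32 * \<rho> \<le> \<kappa> * real (card I) * (1 / 2 ^ j)"
  shows "3 / 64 * (\<kappa> * real (card I)) ^ 3 * \<tau> ^ 3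
    \<le> count_const * ((4 / 2 ^ k) powr (2 * s - 3) * ((1 / \<rho>\<^sup>2) ^ 3 * (1 / 2 ^ j / \<rho>\<^sup>2) powr s))"
proof -
  let ?d = "4 / 2 ^ k :: real"
  interpret T: tangency_count n u v h R "cells_at j" "corner j" "\<nu> j" I \<theta> s mass_const 10 "1 / 2 ^ j" ?d a0 \<rho>
  proof
    show "(\<Sum>p\<in>cells_at j. \<nu> j p) \<le> 1" using sum_cells_at root_le_1 by simp
    show "4 * (10 * (1 / 2 ^ j)) \<le> ?d" using k by simp
    show "?d \<le> 4" by (simp add: field_simps)
    show "(\<Sum>p | p \<in> cells_at j \<and> norm (corner j p - y) \<le> r. \<nu> j p) \<le> mass_const * r powr s"
      if "1 / 2 ^ j \<le> r" for y r
      unfolding mass_const_def by (rule ball_bound[OF that])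
  qed (use finite_cells_at nonneg s_pos I \<theta> \<rho> in \<open>auto simp: mass_const_def\<close>)
  have near: "T.near p q i \<longleftrightarrow> tangent (\<theta> i) (10 / 2 ^ j) ?d (corner j q - corner j p)" for p q i
    by (simp add: T.near_def)
  have "3 / 64 * (\<kappa> * real (card I)) ^ 3 * \<tau> ^ 3 \<le> (mass_const * (2 * ?d) powr s)\<^sup>2 * T.triple_bound"
    by (rule T.tangency_bound[OF \<tau> \<kappa> _ big]) (use good in \<open>simp add: good_def near\<close>)
  also have "\<dots> = count_const * (?d powr (2 * s - 3) * ((1 / \<rho>\<^sup>2) ^ 3 * (1 / 2 ^ j / \<rho>\<^sup>2) powr s))"
  proof -
    have d0: "0 < ?d" by simp
    have \<rho>0: "0 < \<rho>" using \<rho>(1) by (smt (verit) divide_pos_pos zero_less_power)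
    have 1: "((2 * ?d) powr s)\<^sup>2 / ?d ^ 3 = (2 powr s)\<^sup>2 * ?d powr (2 * s - 3)"
    proof -
      have "((2 * ?d) powr s)\<^sup>2 = (2 powr s)\<^sup>2 * (?d powr s)\<^sup>2"
        using d0 by (subst powr_mult) (simp_all add: power_mult_distrib)
      moreover have "(?d powr s)\<^sup>2 = ?d powr (2 * s)"
        by (simp add: power2_eq_square flip: powr_add)
      moreover have "?d ^ 3 = ?d powr 3" using d0 by (simp add: powr_numeral)
      ultimately show ?thesis by (simp add: powr_diff)
    qed
    have 2: "(72 * nondeg_const * (10 * (1 / 2 ^ j)) / \<rho>\<^sup>2) powr s = (720 * nondeg_const) powr s * (1 / 2 ^ j / \<rho>\<^sup>2) powr s"
    proof -
      have "72 * nondeg_const * (10 * (1 / 2 ^ j)) / \<rho>\<^sup>2 = (720 * nondeg_const) * (1 / 2 ^ j / \<rho>\<^sup>2)" by simp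
      then show ?thesis using nondeg_const_pos \<rho>0 by (simp only: powr_mult)
    qed
    have 3: "((48 * nondeg_const + 3) / \<rho>\<^sup>2) ^ 3 = (48 * nondeg_const + 3) ^ 3 * (1 / \<rho>\<^sup>2) ^ 3"
      by (simp add: power_divide)
    have 4: "(mass_const * (2 * ?d) powr s)\<^sup>2 * (angle_const 10 / ?d) ^ 3
        = mass_const\<^sup>2 * angle_const 10 ^ 3 * (((2 * ?d) powr s)\<^sup>2 / ?d ^ 3)"
      by (simp only: power_mult_distrib power_divide) simp
    show ?thesis
      unfolding T.triple_bound_def T.local_mass_def 2 3 count_const_def
      unfolding mult.assoc[symmetric] 4
      unfolding 1 power_mult_distrib by (simp only: ac_simps)
  qed
  finally show ?thesis .
qed


text \<open>Uniform in the annulus \<open>k\<close> and in the representatives chosen from the arcs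
  of length 2^(-j), so one threshold for j serves all of them.\<close>

definition few_directions :: "real \<Rightarrow> real \<Rightarrow> real \<Rightarrow> nat \<Rightarrow> bool" where
  "few_directions t \<eta> a0 j \<longleftrightarrow> (\<forall>k I \<theta>. 40 / 2 ^ j \<le> (4 / 2 ^ k :: real) \<longrightarrow> finite I \<longrightarrow>
    (\<forall>i\<in>I. a0 + real i / 2 ^ j \<le> \<theta> i \<and> \<theta> i \<le> a0 + (real i + 1) / 2 ^ j \<and> \<theta> i \<in> {a0..a0 + 1} \<and>
      good (2 powr (- (2 * \<eta> * real j))) (2 powr (- ((t + 2 * \<eta>) * real j))) (\<theta> i) j k) \<longrightarrow>
    real (card I) \<le> 2 powr (real j * (1 - \<eta>)))"

text \<open>With \<rho> = 2^(-4 \<eta> j), the lower bound in \<open>good_directions_count\<close>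
  has exponent 3 - 3 t - 15 \<eta>, the upper one max 0 (3 - 2 s) - s + (24 + 8 s) \<eta>. The
  hypothesis says that the former is larger, 39 being 15 + 24, so both cannot hold for large
  j.\<close>

lemma few_good_directions:
  fixes t \<eta> a0 :: real
  assumes \<eta>: "0 < \<eta>" "4 * \<eta> \<le> 1"
    and exps: "(39 + 8 * s) * \<eta> < 3 - 3 * t + s - max 0 (3 - 2 * s)"
  shows "\<forall>\<^sub>F j in sequentially. few_directions t \<eta> a0 j"
proof -
  define \<mu> where "\<mu> = max 0 (3 - 2 * s)"
  define K where "K = 64 / 3 * count_const * 4 powr \<bar>2 * s - 3\<bar> + 1"
  \<comment> \<open>The surplus of the lower exponent over the upper one; it eventually beats the
    constant \<open>K\<close>.\<close>
  define gap where "gap = 3 - 3 * t + s - \<mu> - (39 + 8 * s) * \<eta>"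
  have gap: "0 < gap" using exps by (simp add: gap_def \<mu>_def)
  have count_pos: "0 < count_const"
  proof -
    have "0 < angle_const 10" using h R by (simp add: angle_const_def add_pos_pos)
    then show ?thesis using nondeg_const_pos by (simp add: count_const_def mass_const_def add_pos_pos)
  qed
  have "\<forall>\<^sub>F j in sequentially. K \<le> 2 powr (gap * real j) \<and> 32 \<le> 2 powr (\<eta> * real j)"
    using eventually_const_le_powr[OF gap, of K] eventually_const_le_powr[OF \<eta>(1), of 32]
    by (rule eventually_conj)
  then show ?thesis
  proof eventually_elim
    case (elim j)
    show ?case
      unfolding few_directions_def
    proof (intro allI impI, rule ccontr)
      fix k I \<theta>
      assume k: "40 / 2 ^ j \<le> (4 / 2 ^ k :: real)" and I: "finite I"
        and g: "\<forall>i\<in>I. a0 + real i / 2 ^ j \<le> \<theta> i \<and> \<theta> i \<le> a0 + (real i + 1) / 2 ^ j \<and> \<theta> i \<in> {a0..a0 + 1} \<and>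
          good (2 powr (- (2 * \<eta> * real j))) (2 powr (- ((t + 2 * \<eta>) * real j))) (\<theta> i) j k"
        and "\<not> real (card I) \<le> 2 powr (real j * (1 - \<eta>))"
      then have big: "2 powr (real j * (1 - \<eta>)) < real (card I)" by simp
      \<comment> \<open>\<open>x c\<close> stands for 2^(c j), so that the comparison reduces to
        arithmetic of exponents.\<close>
      define x where "x = (\<lambda>c. 2 powr (c * real j))"
      have x_pos: "0 < x c" for c by (simp add: x_def)
      have x_add: "x c * x c' = x (c + c')" for c c' by (simp add: x_def powr_add distrib_right)
      have x_power: "x c ^ m = x (c * real m)" for c and m :: nat
        by (simp add: x_def powr_powr mult.commute mult.left_commute flip: powr_realpow)
      have x_powr: "x c powr r = x (c * r)" for c r by (simp add: x_def powr_powr mult.commute mult.left_commute)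
      have x_inv: "1 / x c = x (- c)" for c by (simp add: x_def powr_minus inverse_eq_divide)
      have x_mono: "x c \<le> x c'" if "c \<le> c'" for c c' using that by (simp add: x_def mult_right_mono)
      have \<delta>: "1 / 2 ^ j = x (- 1)" by (simp add: x_def powr_minus powr_realpow inverse_eq_divide)
      \<comment> \<open>\<kappa> |I| 2^(-j) is at least 2^(-3 \<eta> j). The separation 2^(-4 \<eta>
        j) is smaller by a factor that eventually exceeds 32, as \<open>big\<close>
        requires.\<close>
      let ?\<kappa> = "x (- (2 * \<eta>))" and ?\<tau> = "x (- (t + 2 * \<eta>))" and ?\<rho> = "x (- (4 * \<eta>))"
      have card: "x (1 - \<eta>) \<le> real (card I)" using big by (simp add: x_def mult.commute)
      have \<kappa>I: "x (1 - 3 * \<eta>) \<le> ?\<kappa> * real (card I)"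
      proof -
        have "?\<kappa> * x (1 - \<eta>) \<le> ?\<kappa> * real (card I)" using card x_pos less_imp_le by (intro mult_left_mono) auto
        then show ?thesis by (simp add: x_add)
      qed
      have "3 / 64 * (?\<kappa> * real (card I)) ^ 3 * ?\<tau> ^ 3
        \<le> count_const * ((4 / 2 ^ k) powr (2 * s - 3) * ((1 / ?\<rho>\<^sup>2) ^ 3 * (1 / 2 ^ j / ?\<rho>\<^sup>2) powr s))"
      proof (rule good_directions_count[OF k I, where ?a0.0 = a0 and \<theta> = \<theta>])
        show "1 / 2 ^ j \<le> ?\<rho>" unfolding \<delta> using \<eta> by (intro x_mono) simp
        show "?\<rho> \<le> 1" using x_mono[of "- (4 * \<eta>)" 0] \<eta> by (simp add: x_def)
        have "32 * ?\<rho> \<le> x \<eta> * ?\<rho>" using elim x_pos[of "- (4 * \<eta>)"] by (intro mult_right_mono) (auto simp: x_def)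
        also have "\<dots> = x (1 - 3 * \<eta>) * x (- 1)" by (simp add: x_add)
        also have "\<dots> \<le> ?\<kappa> * real (card I) * x (- 1)"
          using \<kappa>I x_pos less_imp_le by (intro mult_right_mono) auto
        finally show "32 * ?\<rho> \<le> ?\<kappa> * real (card I) * (1 / 2 ^ j)" by (simp add: \<delta>)
        show "good ?\<kappa> ?\<tau> (\<theta> i) j k" if "i \<in> I" for i
          using g that unfolding x_def mult_minus_left by blast
      qed (use g x_pos less_imp_le in \<open>auto simp: x_def\<close>)
      moreover have "3 / 64 * x (3 * (1 - 3 * \<eta>)) * x (- (3 * (t + 2 * \<eta>))) \<le> 3 / 64 * (?\<kappa> * real (card I)) ^ 3 * ?\<tau> ^ 3"
      proof -
        have "x (1 - 3 * \<eta>) ^ 3 \<le> (?\<kappa> * real (card I)) ^ 3"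
          using \<kappa>I x_pos[of "1 - 3 * \<eta>"] by (intro power_mono) auto
        then have "3 / 64 * x (1 - 3 * \<eta>) ^ 3 * ?\<tau> ^ 3 \<le> 3 / 64 * (?\<kappa> * real (card I)) ^ 3 * ?\<tau> ^ 3"
          using x_pos[of "- (t + 2 * \<eta>)"] by (intro mult_right_mono mult_left_mono) auto
        then show ?thesis by (simp add: x_power algebra_simps)
      qed
      \<comment> \<open>As a power of d this is largest at an end of the range: at d = 4 if 2 s
        \<ge> 3, otherwise it is controlled by its value at d = 2^(-j).\<close>
      moreover have "(4 / 2 ^ k) powr (2 * s - 3) \<le> 4 powr \<bar>2 * s - 3\<bar> * x \<mu>"
      proof (cases "0 \<le> 2 * s - 3")
        case True
        have "(4 / 2 ^ k) powr (2 * s - 3) \<le> 4 powr (2 * s - 3)"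
          using True by (intro powr_mono2) (auto simp: field_simps)
        then show ?thesis using True by (simp add: \<mu>_def x_def)
      next
        case False
        have "1 / 2 ^ j \<le> (4 / 2 ^ k :: real)"
        proof -
          have "1 / 2 ^ j \<le> (40 / 2 ^ j :: real)" by (simp add: divide_right_mono)
          then show ?thesis using k by linarith
        qed
        then have "(4 / 2 ^ k) powr (2 * s - 3) \<le> (1 / 2 ^ j) powr (2 * s - 3)"
          using False by (intro powr_mono2') auto
        also have "\<dots> = 1 * x \<mu>" unfolding \<delta> x_powr using False by (simp add: \<mu>_def)
        also have "\<dots> \<le> 4 powr \<bar>2 * s - 3\<bar> * x \<mu>"
          using x_pos[of \<mu>] by (intro mult_right_mono) (auto simp: ge_one_powr_ge_zero)
        finally show ?thesis .
      qed
      moreover have "(1 / ?\<rho>\<^sup>2) ^ 3 * (1 / 2 ^ j / ?\<rho>\<^sup>2) powr s = x (24 * \<eta> + (8 * \<eta> - 1) * s)"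
      proof -
        have r: "1 / ?\<rho>\<^sup>2 = x (8 * \<eta>)" by (simp add: x_power x_inv)
        have "1 / 2 ^ j / ?\<rho>\<^sup>2 = x (8 * \<eta> - 1)"
          using x_add[of "- 1" "8 * \<eta>"] unfolding r[symmetric] \<delta> by simp
        then show ?thesis unfolding r by (simp add: x_power x_powr x_add)
      qed
      ultimately have "3 / 64 * x (3 * (1 - 3 * \<eta>)) * x (- (3 * (t + 2 * \<eta>)))
          \<le> count_const * ((4 powr \<bar>2 * s - 3\<bar> * x \<mu>) * x (24 * \<eta> + (8 * \<eta> - 1) * s))"
        using count_pos x_pos less_imp_le
        by (smt (verit) mult_left_mono mult_right_mono)
      then have "x (3 * (1 - 3 * \<eta>)) * x (- (3 * (t + 2 * \<eta>)))
          \<le> (64 / 3 * count_const * 4 powr \<bar>2 * s - 3\<bar>) * (x \<mu> * x (24 * \<eta> + (8 * \<eta> - 1) * s))"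
        by (simp add: algebra_simps)
      also have "\<dots> < K * (x \<mu> * x (24 * \<eta> + (8 * \<eta> - 1) * s))"
        using x_pos by (intro mult_strict_right_mono mult_pos_pos) (auto simp: K_def)
      also have "\<dots> \<le> x gap * (x \<mu> * x (24 * \<eta> + (8 * \<eta> - 1) * s))"
        using elim x_pos less_imp_le by (intro mult_right_mono mult_nonneg_nonneg) (auto simp: x_def)
      also have "\<dots> = x (3 * (1 - 3 * \<eta>)) * x (- (3 * (t + 2 * \<eta>)))"
        unfolding x_add by (rule arg_cong[where f = x]) (simp add: gap_def algebra_simps)
      finally show False by simp
    qed
  qed
qed


text \<open>Every exceptional direction is good at some level beyond any given one, and at each
  large level the good directions fit into few arcs, so the limsup lemma applies. Parameters range
  over an interval of length 1 because the lower chord and sine estimates hold for such angle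
  differences.\<close>

lemma exceptional_arc_null:
  assumes t: "0 < t" "t < s" "t < 1 + s / 3" and root: "0 < \<nu> 0 z"
  shows "hausdorff_measure 1 {\<gamma> \<theta> |\<theta>. \<theta> \<in> {a0..a0 + 1} \<and> hausdorff_measure t (proj \<theta> ` K') = 0} = 0"
proof -
  \<comment> \<open>This is 3 (1 + s/3 - t) if 2 s \<ge> 3 and 3 (s - t) otherwise; the two
    conditions on t make it positive.\<close>
  define \<mu> where "\<mu> = 3 - 3 * t + s - max 0 (3 - 2 * s)"
  have \<mu>: "0 < \<mu>" using t by (auto simp: \<mu>_def max_def)
  \<comment> \<open>1/4 keeps \<rho> above 2^(-j), (s - t)/2 makes the core of the tubes negligible,
    and 40 instead of 39 gives the strict inequality wanted by
    \<open>few_good_directions\<close>.\<close>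
  define \<eta> where "\<eta> = min (1 / 4) (min ((s - t) / 2) (\<mu> / (40 + 8 * s)))"
  have \<eta>: "0 < \<eta>" "4 * \<eta> \<le> 1" "\<eta> < s - t" "(39 + 8 * s) * \<eta> < \<mu>"
  proof -
    show \<eta>0: "0 < \<eta>" using t \<mu> s_pos by (simp add: \<eta>_def)
    show "4 * \<eta> \<le> 1" by (simp add: \<eta>_def)
    have "\<eta> \<le> (s - t) / 2" unfolding \<eta>_def by linarith
    also have "\<dots> < s - t" using t(2) by simp
    finally show "\<eta> < s - t" .
    have "\<eta> \<le> \<mu> / (40 + 8 * s)" unfolding \<eta>_def by linarith
    then have "\<eta> * (40 + 8 * s) \<le> \<mu>" using s_pos by (simp add: pos_le_divide_eq)
    then show "(39 + 8 * s) * \<eta> < \<mu>" using \<eta>0 by (simp add: algebra_simps)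
  qed
  \<comment> \<open>Summable over levels, with tails eventually below the total mass as
    \<open>covered_scale\<close> requires, yet only a small power of the scale.\<close>
  define \<kappa> where "\<kappa> j = 2 powr (- (\<eta> * real j))" for j :: nat
  define q where "q = 2 powr (- \<eta>)"
  have q: "0 < q" "q < 1" using \<eta>(1) powr_less_mono[of "-\<eta>" 0 2] by (auto simp: q_def)
  have \<kappa>q: "\<kappa> j = q ^ j" for j by (simp add: \<kappa>_def q_def powr_powr flip: powr_realpow)
  have "(\<lambda>J. q ^ J / (1 - q)) \<longlonglongrightarrow> 0 / (1 - q)"
    using q by (intro tendsto_intros LIMSEQ_power_zero) auto
  then have ev1: "\<forall>\<^sub>F J in sequentially. q ^ J / (1 - q) < \<nu> 0 z"
    by (rule order_tendstoD) (use root in simp)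
  have ev2: "\<forall>\<^sub>F j in sequentially. 125 * 2 powr s * 40 powr s * 4 \<le> 2 powr ((s - t - \<eta>) * real j)"
    by (rule eventually_const_le_powr) (use \<eta> in simp)
  have ev3: "\<forall>\<^sub>F j in sequentially. 4 * real j \<le> 2 powr (\<eta> * real j)"
    by (rule eventually_linear_le_powr[OF \<eta>(1)])
  have ev4: "\<forall>\<^sub>F j in sequentially. 1 * real j \<le> 2 powr (\<eta> / 2 * real j)"
    by (rule eventually_linear_le_powr) (use \<eta> in simp)
  note ev5 = few_good_directions[OF \<eta>(1,2) \<eta>(4)[unfolded \<mu>_def], of a0]
  \<comment> \<open>The additional factor 2^(-\<eta> j) absorbs the losses of order j from the
    pigeonholing over annuli, here and in \<open>\<tau>'\<close>.\<close>
  define \<kappa>' where "\<kappa>' j = 2 powr (- (2 * \<eta> * real j))" for j :: nat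
  define \<tau>' where "\<tau>' j = 2 powr (- ((t + 2 * \<eta>) * real j))" for j :: nat
  obtain J0 where J0_all: "\<forall>j\<ge>J0. 1 \<le> j \<and> q ^ j / (1 - q) < \<nu> 0 z \<and>
      125 * 2 powr s * 40 powr s * 4 \<le> 2 powr ((s - t - \<eta>) * real j) \<and> 4 * real j \<le> 2 powr (\<eta> * real j) \<and>
      1 * real j \<le> 2 powr (\<eta> / 2 * real j) \<and> few_directions t \<eta> a0 j"
    using eventually_conj[OF eventually_ge_at_top eventually_conj[OF ev1 eventually_conj[OF ev2
      eventually_conj[OF ev3 eventually_conj[OF ev4 ev5]]]], of 1]
    unfolding eventually_sequentially by blast
  have J0: "1 \<le> j" "q ^ j / (1 - q) < \<nu> 0 z"
    "125 * 2 powr s * 40 powr s * 4 \<le> 2 powr ((s - t - \<eta>) * real j)"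
    "4 * real j \<le> 2 powr (\<eta> * real j)" "1 * real j \<le> 2 powr (\<eta> / 2 * real j)" "few_directions t \<eta> a0 j" if "J0 \<le> j" for j
    using J0_all that by blast+
  define Good where "Good \<theta> j \<longleftrightarrow> (\<exists>k<j. 40 / 2 ^ j \<le> (4 / 2 ^ k :: real) \<and> good (\<kappa>' j) (\<tau>' j) \<theta> j k)" for \<theta> j
  define F where "F j = \<gamma> ` {\<theta> \<in> {a0..a0 + 1}. Good \<theta> j}" for j
  show ?thesis
  proof (rule hausdorff_measure_limsup_null[where \<eta> = "\<eta> / 2" and c = 1 and F = F and ?J0.0 = J0])
    show "0 < \<eta> / 2" "0 \<le> (1::real)" using \<eta> by simp_all
  next
    fix J
    show "{\<gamma> \<theta> |\<theta>. \<theta> \<in> {a0..a0 + 1} \<and> hausdorff_measure t (proj \<theta> ` K') = 0} \<subseteq> (\<Union>j\<in>{J..}. F j)"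
    proof safe
      fix \<theta> assume \<theta>: "\<theta> \<in> {a0..a0 + 1}" "hausdorff_measure t (proj \<theta> ` K') = 0"
      define J1 where "J1 = max J J0"
      have J1: "J0 \<le> J1" "J \<le> J1" by (simp_all add: J1_def)
      have "\<exists>j\<ge>J1. \<exists>k<j. 40 / 2 ^ j \<le> (4 / 2 ^ k :: real) \<and> \<kappa> j / 2 / j \<le> (\<Sum>q | q \<in> cells_at j \<and>
        \<kappa> j / (2 * 2 powr (t * real j)) / 2 / j
        \<le> annulus_mass \<theta> j k q. \<nu> j q)"
      proof (rule good_scale[OF t(1) \<theta>(2)])
        show "1 \<le> J1" using J0(1)[OF J1(1)] .
        show "0 < \<kappa> j" for j by (simp add: \<kappa>_def)
        fix S assume S: "finite S" "S \<subseteq> {J1..}"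
        have sm: "summable (\<lambda>i. \<kappa> (i + J1))" unfolding \<kappa>q using q by (simp add: power_add summable_mult2)
        have inj: "inj_on (\<lambda>j. j - J1) S"
        proof (rule inj_onI)
          fix x y assume xy: "x \<in> S" "y \<in> S" "x - J1 = y - J1"
          then have "J1 \<le> x" "J1 \<le> y" using S(2) by auto
          then show "x = y" using xy(3) by linarith
        qed
        have "(\<Sum>j\<in>S. \<kappa> j) = (\<Sum>i\<in>(\<lambda>j. j - J1) ` S. \<kappa> (i + J1))"
          unfolding sum.reindex[OF inj] comp_def
          by (rule sum.cong[OF refl]) (use S(2) in auto)
        also have "\<dots> \<le> (\<Sum>i. \<kappa> (i + J1))"
          by (rule sum_le_suminf[OF sm]) (use S in \<open>auto simp: \<kappa>_def\<close>)
        also have "\<dots> = q ^ J1 / (1 - q)"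
          unfolding \<kappa>q power_add using q by (subst suminf_mult2[symmetric]) (auto simp: suminf_geometric summable_geometric)
        also have "\<dots> < \<nu> 0 z" by (rule J0(2)[OF J1(1)])
        finally show "(\<Sum>j\<in>S. \<kappa> j) < \<nu> 0 z" .
      next
        fix j assume "J1 \<le> j"
        then have j: "J0 \<le> j" using J1 by simp
        have "125 * 2 powr s * (40 / 2 ^ j) powr s = (125 * 2 powr s * 40 powr s * 4) / 4 * 2 powr (- (s * real j))"
        proof -
          have "(40 / 2 ^ j :: real) = 40 * 2 powr (- real j)"
            by (simp add: powr_minus powr_realpow divide_inverse)
          then show ?thesis by (simp add: powr_mult powr_powr mult.commute)
        qed
        also have "\<dots> \<le> 2 powr ((s - t - \<eta>) * real j) / 4 * 2 powr (- (s * real j))"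
          using J0(3)[OF j] by (intro mult_right_mono divide_right_mono) auto
        also have "\<dots> = \<kappa> j / (2 * 2 powr (t * real j)) / 2"
        proof -
          have "2 powr ((s - t - \<eta>) * real j) * 2 powr (- (s * real j)) = \<kappa> j * 2 powr (- (t * real j))"
            unfolding \<kappa>_def powr_add[symmetric] by (rule arg_cong[where f = "(powr) 2"]) (simp add: algebra_simps)
          then have "2 powr ((s - t - \<eta>) * real j) / 4 * 2 powr (- (s * real j)) = \<kappa> j * 2 powr (- (t * real j)) / 4"
            by simp
          then show ?thesis by (simp add: powr_minus_divide)
        qed
        finally show "125 * 2 powr s * (40 / 2 ^ j) powr s \<le> \<kappa> j / (2 * 2 powr (t * real j)) / 2" .
      qed
      then obtain j k where jk: "J1 \<le> j" "k < j" "40 / 2 ^ j \<le> (4 / 2 ^ k :: real)"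
        "good (\<kappa> j / 2 / j) (\<kappa> j / (2 * 2 powr (t * real j)) / 2 / j) \<theta> j k"
        unfolding good_def by blast
      have j: "J0 \<le> j" "0 < real j" using jk(1) J1 J0(1)[of j] by auto
      have \<kappa>4: "\<kappa>' j * (4 * real j) \<le> \<kappa> j"
      proof -
        have "\<kappa>' j * (4 * real j) \<le> \<kappa>' j * 2 powr (\<eta> * real j)"
          by (rule mult_left_mono[OF J0(4)[OF j(1)]]) (simp add: \<kappa>'_def)
        also have "\<dots> = \<kappa> j" unfolding \<kappa>'_def \<kappa>_def powr_add[symmetric]
          by (rule arg_cong[where f = "(powr) 2"]) (simp add: algebra_simps)
        finally show ?thesis .
      qed
      have "0 < \<kappa> j" by (simp add: \<kappa>_def)
      have "\<kappa>' j \<le> \<kappa> j / (4 * real j)" using \<kappa>4 j(2) by (subst pos_le_divide_eq) auto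
      then have le1: "\<kappa>' j \<le> \<kappa> j / 4 / real j" by (simp only: divide_divide_eq_left)
      also have "\<dots> \<le> \<kappa> j / 2 / real j"
        by (rule divide_right_mono) (use \<open>0 < \<kappa> j\<close> in simp_all)
      finally have le2: "\<kappa>' j \<le> \<kappa> j / 2 / real j" .
      have "\<tau>' j = \<kappa>' j * 2 powr (- (t * real j))"
        unfolding \<tau>'_def \<kappa>'_def powr_add[symmetric]
        by (rule arg_cong[where f = "(powr) 2"]) (simp add: algebra_simps)
      also have "\<dots> \<le> \<kappa> j / 4 / real j * 2 powr (- (t * real j))" by (rule mult_right_mono[OF le1]) simp
      also have "\<dots> = \<kappa> j / (2 * 2 powr (t * real j)) / 2 / j" by (simp add: powr_minus_divide)
      finally have "good (\<kappa>' j) (\<tau>' j) \<theta> j k" by (rule good_mono[OF jk(4) le2])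
      then have "Good \<theta> j" unfolding Good_def using jk(2,3) by blast
      then have "\<gamma> \<theta> \<in> F j" unfolding F_def using \<theta>(1) by blast
      moreover have "j \<in> {J..}" using jk(1) J1(2) by simp
      ultimately show "\<gamma> \<theta> \<in> (\<Union>j\<in>{J..}. F j)" by blast
    qed
  next
    fix j assume j: "J0 \<le> j"
    define B where "B i = \<gamma> ` {a0 + real i / 2 ^ j..a0 + (real i + 1) / 2 ^ j}" for i :: nat
    define Ik where "Ik k = {i. i \<le> 2 ^ j \<and> (\<exists>\<theta>. a0 + real i / 2 ^ j \<le> \<theta> \<and> \<theta> \<le> a0 + (real i + 1) / 2 ^ j \<and> \<theta> \<in> {a0..a0 + 1} \<and>
      good (\<kappa>' j) (\<tau>' j) \<theta> j k)}" for k
    define Ks where "Ks = {k. k < j \<and> 40 / 2 ^ j \<le> (4 / 2 ^ k :: real)}"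
    have finI: "finite (Ik k)" for k by (rule finite_subset[of _ "{..2 ^ j}"]) (auto simp: Ik_def)
    have Ks: "finite Ks" "card Ks \<le> j"
    proof -
      have "Ks \<subseteq> {..<j}" by (auto simp: Ks_def)
      then show "finite Ks" "card Ks \<le> j" using card_mono[of "{..<j}" Ks] by (auto intro: finite_subset)
    qed
    have card_Ik: "real (card (Ik k)) \<le> 2 powr (real j * (1 - \<eta>))" if "k \<in> Ks" for k
    proof -
      have "\<forall>i\<in>Ik k. \<exists>\<theta>. a0 + real i / 2 ^ j \<le> \<theta> \<and> \<theta> \<le> a0 + (real i + 1) / 2 ^ j \<and> \<theta> \<in> {a0..a0 + 1} \<and>
        good (\<kappa>' j) (\<tau>' j) \<theta> j k" by (auto simp: Ik_def)
      from bchoice[OF this] obtain f where f: "\<forall>i\<in>Ik k. a0 + real i / 2 ^ j \<le> f i \<and> f i \<le> a0 + (real i + 1) / 2 ^ j \<and> f i \<in> {a0..a0 + 1} \<and>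
        good (\<kappa>' j) (\<tau>' j) (f i) j k" by blast
      have "40 / 2 ^ j \<le> (4 / 2 ^ k :: real)" using that by (simp add: Ks_def)
      then show ?thesis using J0(6)[OF j] finI[of k] f unfolding few_directions_def \<kappa>'_def \<tau>'_def by blast
    qed
    let ?I = "\<Union>k\<in>Ks. Ik k"
    have "real (card ?I) \<le> real (\<Sum>k\<in>Ks. card (Ik k))"
      using card_UN_le[OF Ks(1), of Ik] by (rule of_nat_mono)
    also have "\<dots> = (\<Sum>k\<in>Ks. real (card (Ik k)))" by simp
    also have "\<dots> \<le> (\<Sum>k\<in>Ks. 2 powr (real j * (1 - \<eta>)))" by (intro sum_mono card_Ik)
    also have "\<dots> \<le> real j * 2 powr (real j * (1 - \<eta>))" using Ks(2) by (simp add: mult_right_mono)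
    \<comment> \<open>At most j annuli occur at level j; half of the gain \<eta> pays for their
      number.\<close>
    also have "\<dots> \<le> 2 powr (\<eta> / 2 * real j) * 2 powr (real j * (1 - \<eta>))"
      using J0(5)[OF j] by (intro mult_right_mono) auto
    also have "\<dots> = 2 powr (real j * (1 - \<eta> / 2))"
      unfolding powr_add[symmetric] by (rule arg_cong[where f = "(powr) 2"]) (simp add: algebra_simps)
    finally have card: "real (card ?I) \<le> 2 powr (real j * (1 - \<eta> / 2))" .
    have sub: "F j \<subseteq> (\<Union>i\<in>?I. B i)"
      unfolding F_def
    proof safe
      fix \<theta> assume \<theta>: "\<theta> \<in> {a0..a0 + 1}" "Good \<theta> j"
      obtain k where k: "k \<in> Ks" "good (\<kappa>' j) (\<tau>' j) \<theta> j k" using \<theta>(2) by (auto simp: Good_def Ks_def)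
      define i where "i = nat \<lfloor>(\<theta> - a0) * 2 ^ j\<rfloor>"
      have pos: "0 \<le> (\<theta> - a0) * 2 ^ j" using \<theta>(1) by simp
      have i: "real i \<le> (\<theta> - a0) * 2 ^ j" "(\<theta> - a0) * 2 ^ j \<le> real i + 1"
        using pos unfolding i_def by linarith+
      have "(\<theta> - a0) * 2 ^ j \<le> 1 * 2 ^ j" using \<theta>(1) by (intro mult_right_mono) auto
      then have "real i \<le> 2 ^ j" using i(1) by linarith
      then have i2: "i \<le> 2 ^ j" by (metis of_nat_le_iff of_nat_numeral of_nat_power)
      have ib: "a0 + real i / 2 ^ j \<le> \<theta>" "\<theta> \<le> a0 + (real i + 1) / 2 ^ j"
        using i by (simp_all add: field_simps)
      have "i \<in> Ik k" unfolding Ik_def using i2 ib \<theta>(1) k(2) by blast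
      moreover have "\<gamma> \<theta> \<in> B i" unfolding B_def using ib by auto
      ultimately show "\<gamma> \<theta> \<in> (\<Union>i\<in>?I. B i)" using k(1) by blast
    qed
    have dist: "norm (x - y) \<le> 1 / 2 ^ j" if xy: "x \<in> B i" "y \<in> B i" for x y i
    proof -
      obtain \<theta> \<phi> where *: "x = \<gamma> \<theta>" "y = \<gamma> \<phi>" "\<theta> \<in> {a0 + real i / 2 ^ j..a0 + (real i + 1) / 2 ^ j}"
        "\<phi> \<in> {a0 + real i / 2 ^ j..a0 + (real i + 1) / 2 ^ j}" using xy by (auto simp: B_def)
      have "\<bar>\<theta> - \<phi>\<bar> \<le> 1 / 2 ^ j" using *(3,4) by (auto simp: add_divide_distrib abs_le_iff)
      then show ?thesis using \<gamma>_lipschitz[of \<theta> \<phi>] * by simp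
    qed
    have "bounded (B i)" "diameter (B i) \<le> 1 / 2 ^ j" for i
    proof -
      show "bounded (B i)" by (rule boundedI[of _ 1]) (auto simp: B_def norm_\<gamma>)
      show "diameter (B i) \<le> 1 / 2 ^ j" by (rule diameter_le) (use dist in auto)
    qed
    then show "\<exists>I B. finite I \<and> F j \<subseteq> (\<Union>i\<in>I. B i :: (real ^ 3) set) \<and>
      (\<forall>i\<in>I. bounded (B (i::nat)) \<and> diameter (B i) \<le> 1 / 2 ^ j) \<and> real (card I) \<le> 2 powr (j * (1 - \<eta> / 2))"
      using sub card finI Ks(1) by (intro exI[of _ ?I] exI[of _ B]) auto
  qed
qed

end

section \<open>From arcs and exponents to the plane and dimensions\<close>

lemma hausdorff_measure_1_singleton: "hausdorff_measure 1 {x :: 'a::metric_space} = 0"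
  unfolding hausdorff_measure_eq_0_iff
proof (intro allI impI)
  fix \<delta> :: real assume "0 < \<delta>"
  then have "hausdorff_premeasure 1 \<delta> {x} \<le> ennreal (real (card {0::nat}) * 0 powr 1)"
    by (intro hausdorff_premeasure_finite_cover[where B = "\<lambda>_. {x}"]) auto
  then show "hausdorff_premeasure 1 \<delta> {x} = 0" by simp
qed

lemma orthonormal_expansion:
  fixes n u v :: "real ^ 3"
  assumes 1: "n \<bullet> n = 1" "u \<bullet> u = 1" "v \<bullet> v = 1" and 0: "n \<bullet> u = 0" "n \<bullet> v = 0" "u \<bullet> v = 0"
  shows "x = (x \<bullet> n) *\<^sub>R n + (x \<bullet> u) *\<^sub>R u + (x \<bullet> v) *\<^sub>R v"
proof -
  let ?B = "{n, u, v}"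
  have swap: "u \<bullet> n = 0" "v \<bullet> n = 0" "v \<bullet> u = 0" using 0 by (simp_all add: inner_commute)
  have dist: "n \<noteq> u" "n \<noteq> v" "u \<noteq> v" using 1 0 by auto
  have orth: "pairwise orthogonal ?B" using 0 swap by (auto simp: pairwise_insert orthogonal_def)
  have "0 \<notin> ?B" using 1 by auto
  then have ind: "independent ?B" using orth by (intro pairwise_orthogonal_independent)
  have "card ?B = dim (UNIV :: (real ^ 3) set)" using dist by simp
  then have "UNIV \<subseteq> span ?B" using card_eq_dim[of ?B UNIV] ind by simp
  then have span: "y \<in> span ?B" for y by blast
  define y where "y = x - ((x \<bullet> n) *\<^sub>R n + (x \<bullet> u) *\<^sub>R u + (x \<bullet> v) *\<^sub>R v)"
  have "y \<bullet> n = 0" "y \<bullet> u = 0" "y \<bullet> v = 0"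
    by (simp_all add: y_def inner_diff_left inner_add_left 1 0 swap)
  then have "orthogonal y b" if "b \<in> ?B" for b using that by (auto simp: orthogonal_def)
  then have "orthogonal y y" by (rule orthogonal_to_span[OF span])
  then have "y = 0" by (simp add: orthogonal_def)
  then show ?thesis by (simp add: y_def)
qed

lemma plane_frame:
  fixes W :: "(real ^ 3) set"
  assumes "affine W" "aff_dim W = 2" "0 \<notin> W"
  obtains n u v h where "n \<bullet> n = 1" "u \<bullet> u = 1" "v \<bullet> v = 1" "n \<bullet> u = 0" "n \<bullet> v = 0" "u \<bullet> v = 0"
    "0 < h" "W = {x. x \<bullet> n = h}"
proof -
  have "\<exists>a b. a \<noteq> 0 \<and> affine hull W = {x. a \<bullet> x = b}"
    using assms(2) aff_dim_eq_hyperplane[of W] by simp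
  then obtain a b where ab: "a \<noteq> 0" "affine hull W = {x. a \<bullet> x = b}" by blast
  have W: "W = {x. a \<bullet> x = b}" using ab(2) hull_same[of affine W] assms(1) by simp
  have b: "b \<noteq> 0" using assms(3) W by auto
  \<comment> \<open>The sign of \<open>b\<close> orients the normal so that the height
    \<open>h\<close> is positive.\<close>
  define n where "n = (sgn b / norm a) *\<^sub>R a"
  define h where "h = \<bar>b\<bar> / norm a"
  have na: "0 < norm a" using ab(1) by simp
  have nn: "n \<bullet> n = 1"
    using na b by (simp add: n_def power2_norm_eq_inner[symmetric] power2_eq_square sgn_if)
  have h: "0 < h" using b na by (simp add: h_def)
  have W': "W = {x. x \<bullet> n = h}"
    unfolding W n_def h_def using na b by (auto simp: inner_commute sgn_if field_simps)
  obtain u0 where u0: "u0 \<noteq> 0" "orthogonal n u0"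
    using orthogonal_to_vector_exists[of n] by auto
  define u where "u = u0 /\<^sub>R norm u0"
  have uu: "u \<bullet> u = 1" using u0(1) by (simp add: u_def power2_norm_eq_inner[symmetric] power2_eq_square)
  have nu: "n \<bullet> u = 0" using u0(2) by (simp add: u_def orthogonal_def inner_commute)
  define v where "v = cross3 n u"
  have "n \<bullet> v = 0" "u \<bullet> v = 0" by (simp_all add: v_def dot_cross_self)
  moreover have "v \<bullet> v = 1"
    using norm_cross_dot[of n u] nn uu nu by (simp add: v_def power_mult_distrib power2_norm_eq_inner)
  ultimately show thesis using that nn uu nu h W' by blast
qed


lemma (in circle_frame) circle_param:
  assumes e: "norm e = 1" "e \<bullet> n = h"
  shows "\<exists>a::nat. \<exists>\<theta>\<in>{real a..real a + 1}. e = \<gamma> \<theta>"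
proof -
  have "(e \<bullet> u)\<^sup>2 + (e \<bullet> v)\<^sup>2 = R\<^sup>2"
    using inner_expand[of e e] e hR by (simp add: norm_eq_1 power2_eq_square)
  then have "((e \<bullet> u) / R)\<^sup>2 + ((e \<bullet> v) / R)\<^sup>2 = 1"
    using R by (simp add: power_divide flip: add_divide_distrib)
  then obtain \<theta> where \<theta>: "0 \<le> \<theta>" "(e \<bullet> u) / R = cos \<theta>" "(e \<bullet> v) / R = sin \<theta>"
    by (rule sincos_total_2pi)
  have "e \<bullet> u = R * cos \<theta>" "e \<bullet> v = R * sin \<theta>" using \<theta>(2,3) R by (auto simp: field_simps)
  then have "e = \<gamma> \<theta>" unfolding \<gamma>_def using expand[of e] e(2) by simp
  moreover have "\<theta> \<in> {real (nat \<lfloor>\<theta>\<rfloor>)..real (nat \<lfloor>\<theta>\<rfloor>) + 1}" using \<theta>(1) by auto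
  ultimately show ?thesis by blast
qed

lemma exceptional_directions_null:
  fixes W K :: "(real ^ 3) set"
  assumes W: "affine W" "aff_dim W = 2" "0 \<notin> W" and K: "K \<in> sets borel"
    and t: "0 < t" "t < s" "t < 1 + s / 3" and pos: "hausdorff_measure s K \<noteq> 0"
  shows "hausdorff_measure 1 {e \<in> sphere 0 1 \<inter> W. hausdorff_measure t (proj_perp e ` K) = 0} = 0"
proof -
  obtain n u v h where f: "n \<bullet> n = 1" "u \<bullet> u = 1" "v \<bullet> v = 1" "n \<bullet> u = 0" "n \<bullet> v = 0" "u \<bullet> v = 0"
    "0 < h" "W = {x. x \<bullet> n = h}"
    by (rule plane_frame[OF W])
  show ?thesis
  proof (cases "h < 1")
    \<comment> \<open>A plane at distance at least 1 meets the sphere in at most the point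
      \<open>n\<close>, which has length zero.\<close>
    case False
    have "e = n" if "e \<in> sphere 0 1 \<inter> W" for e
    proof -
      have "e \<bullet> e = 1" "e \<bullet> n = h" using that f(8) by (auto simp: norm_eq_1)
      then have "(e - n) \<bullet> (e - n) \<le> 0"
        using False f(1) by (simp add: inner_diff_left inner_diff_right inner_commute)
      then show ?thesis using inner_ge_zero[of "e - n"] inner_eq_zero_iff[of "e - n"] by auto
    qed
    then have "{e \<in> sphere 0 1 \<inter> W. hausdorff_measure t (proj_perp e ` K) = 0} \<subseteq> {n}" by blast
    then show ?thesis using hausdorff_measure_1_singleton by (rule hausdorff_measure_null_mono)
  next
    case True
    define R where "R = sqrt (1 - h\<^sup>2)"
    have h2: "h\<^sup>2 < 1" using True f(7) by (simp add: abs_square_less_1)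
    have s: "0 < s" using t by linarith
    obtain z K' \<nu> where \<nu>: "frostman_weights \<nu> s z" "0 < \<nu> 0 z" "compact K'" "K' \<subseteq> K"
      "\<And>n b. 0 < \<nu> n b \<Longrightarrow> K' \<inter> closed_cell n b \<noteq> {}"
      using frostman[OF K s pos] by blast
    interpret frostman_weights \<nu> s z by (rule \<nu>(1))
    interpret projected_weights \<nu> s z n u v h R K'
    proof
      show "x = (x \<bullet> n) *\<^sub>R n + (x \<bullet> u) *\<^sub>R u + (x \<bullet> v) *\<^sub>R v" for x
        by (rule orthonormal_expansion[OF f(1-6)])
      show "0 < R" "h\<^sup>2 + R\<^sup>2 = 1" using h2 by (simp_all add: R_def)
    qed (rule f(1-7) \<nu>(3,5), assumption?)+
    define E where "E a = {\<gamma> \<theta> |\<theta>. \<theta> \<in> {real a..real a + 1} \<and> hausdorff_measure t (proj \<theta> ` K') = 0}" for a :: nat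
    have "{e \<in> sphere 0 1 \<inter> W. hausdorff_measure t (proj_perp e ` K) = 0} \<subseteq> (\<Union>a. E a)"
    proof
      fix e assume "e \<in> {e \<in> sphere 0 1 \<inter> W. hausdorff_measure t (proj_perp e ` K) = 0}"
      then have e: "norm e = 1" "e \<bullet> n = h" "hausdorff_measure t (proj_perp e ` K) = 0" using f(8) by auto
      obtain a \<theta> where a: "\<theta> \<in> {real a..real a + 1}" "e = \<gamma> \<theta>" using circle_param[OF e(1,2)] by blast
      have "proj_perp e = proj \<theta>"
        by (rule ext) (simp add: a(2) proj_perp_eq[OF norm_\<gamma>] proj_def)
      \<comment> \<open>\<open>K'\<close> was chosen before the direction, so each direction that is
        exceptional for \<open>K\<close> is exceptional for this one compact subset.\<close>
      then have "proj \<theta> ` K' \<subseteq> proj_perp e ` K" using \<nu>(4) by auto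
      then have "hausdorff_measure t (proj \<theta> ` K') = 0" using e(3) by (rule hausdorff_measure_null_mono)
      then have "e \<in> E a" using a by (auto simp: E_def)
      then show "e \<in> (\<Union>a. E a)" by blast
    qed
    moreover have "hausdorff_measure 1 (\<Union>a. E a) = 0"
      unfolding E_def by (intro hausdorff_measure_null_UN exceptional_arc_null t \<nu>(2))
    ultimately show ?thesis by (rule hausdorff_measure_null_mono)
  qed
qed

text \<open>Rational exponents reduce the exceptional set to countably many null sets. The exponent
  t is placed first, just above d, and then s below D but large enough for t to be
  admissible.\<close>

lemma rational_exponents:
  fixes D d :: ennreal
  assumes d: "d < min D (1 + D / 3)"
  obtains s t where "s \<in> \<rat>" "t \<in> \<rat>" "0 < t" "t < s" "t < 1 + s / 3" "ennreal s < D" "d < ennreal t"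
proof -
  obtain y where y: "d < y" "y < min D (1 + D / 3)" using dense[OF d] by blast
  then have "y < top" using less_top_ennreal by (meson less_le_trans top_greatest)
  then obtain b where b: "y = ennreal b" "0 \<le> b" by (cases y) auto
  have "d < top" using y(1) \<open>y < top\<close> by (rule less_trans)
  then obtain a where a: "d = ennreal a" "0 \<le> a" by (cases d) auto
  have "a < b" using y(1) a b by (simp add: ennreal_less_iff)
  then obtain t where t: "t \<in> \<rat>" "a < t" "t < b" using Rats_dense_in_real by blast
  have t0: "0 < t" using a t by linarith
  have bD: "ennreal b < D" "ennreal b < 1 + D / 3" using y(2) b by auto
  have "\<exists>s\<in>\<rat>. t < s \<and> t < 1 + s / 3 \<and> ennreal s < D"
  proof (cases D)
    case (real D')
    have "b < D'" using bD(1) real b by (simp add: ennreal_less_iff)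
    moreover have "b < 1 + D' / 3"
    proof -
      have "1 + D / 3 = ennreal (1 + D' / 3)"
        using real by (simp add: divide_ennreal flip: ennreal_numeral ennreal_1 ennreal_plus)
      then show ?thesis using bD(2) b by (simp add: ennreal_less_iff)
    qed
    ultimately have "t < D'" "t - 1 < D' / 3" using t(3) by linarith+
    then have "t < D'" "(t - 1) * 3 < D'" by (simp_all only: pos_less_divide_eq zero_less_numeral)
    \<comment> \<open>A number s above this maximum satisfies both t < s and t < 1 + s/3.\<close>
    then have "max t (3 * (t - 1)) < D'" by simp
    then obtain s where "s \<in> \<rat>" "max t (3 * (t - 1)) < s" "s < D'" using Rats_dense_in_real by blast
    then show ?thesis using real t0 by (intro bexI[of _ s]) (auto simp: ennreal_less_iff)
  next
    case top
    obtain s where "s \<in> \<rat>" "max t (3 * (t - 1)) < s" using Rats_dense_in_real[of "max t (3 * (t - 1))" "max t (3 * (t - 1)) + 1"] by auto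
    then show ?thesis using top by (intro bexI[of _ s]) auto
  qed
  moreover have "d < ennreal t" using a t by (simp add: ennreal_less_iff)
  ultimately show thesis using that t t0 by blast
qed

theorem theorem1p1:
  fixes W K :: "(real ^ 3) set"
  assumes "affine W" and "aff_dim W = 2" and "0 \<notin> W"
    and "K \<in> sets borel"
  shows "hausdorff_measure 1
           {e \<in> sphere 0 1 \<inter> W.
              \<not> hausdorff_dim (proj_perp e ` K) \<ge> min (hausdorff_dim K) (1 + hausdorff_dim K / 3)} = 0
         \<and> (hausdorff_dim K \<le> 3 / 2 \<longrightarrow>
         hausdorff_measure 1
           {e \<in> sphere 0 1 \<inter> W. \<not> hausdorff_dim (proj_perp e ` K) = hausdorff_dim K} = 0)"
proof -
  define D where "D = hausdorff_dim K"
  define Bad where "Bad = {e \<in> sphere 0 1 \<inter> W. \<not> hausdorff_dim (proj_perp e ` K) \<ge> min D (1 + D / 3)}"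
  define Q where "Q = {(s, t). s \<in> \<rat> \<and> t \<in> \<rat> \<and> 0 < t \<and> t < s \<and> t < 1 + s / 3 \<and> ennreal s < D}"
  define E where "E = (\<lambda>(s :: real, t). {e \<in> sphere 0 1 \<inter> W. hausdorff_measure t (proj_perp e ` K) = 0})"
  have "countable Q"
    by (rule countable_subset[of _ "\<rat> \<times> \<rat>"]) (auto simp: Q_def countable_rat)
  moreover have "hausdorff_measure 1 (E p) = 0" if pQ: "p \<in> Q" for p
  proof -
    obtain s t where p: "p = (s, t)" "0 < t" "t < s" "t < 1 + s / 3" "ennreal s < D" using pQ by (auto simp: Q_def)
    have "hausdorff_measure s K \<noteq> 0"
      using p by (intro hausdorff_measure_nonzero_below_dim) (auto simp: D_def)
    then show ?thesis unfolding E_def p(1) prod.case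
      by (rule exceptional_directions_null[OF assms p(2-4)])
  qed
  ultimately have null: "hausdorff_measure 1 (\<Union>p\<in>Q. E p) = 0"
    by (rule hausdorff_measure_null_countable_UN)
  have "Bad \<subseteq> (\<Union>p\<in>Q. E p)"
  proof
    fix e assume e: "e \<in> Bad"
    then have "hausdorff_dim (proj_perp e ` K) < min D (1 + D / 3)" by (simp add: Bad_def not_le)
    then obtain s t where st: "s \<in> \<rat>" "t \<in> \<rat>" "0 < t" "t < s" "t < 1 + s / 3" "ennreal s < D"
        "hausdorff_dim (proj_perp e ` K) < ennreal t"
      by (rule rational_exponents)
    then have "(s, t) \<in> Q" "e \<in> E (s, t)"
      using e hausdorff_measure_null_above_dim[OF st(7)] by (auto simp: Q_def E_def Bad_def)
    then show "e \<in> (\<Union>p\<in>Q. E p)" by blast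
  qed
  then have bad: "hausdorff_measure 1 Bad = 0" using null by (rule hausdorff_measure_null_mono)
  have "hausdorff_measure 1 {e \<in> sphere 0 1 \<inter> W. \<not> hausdorff_dim (proj_perp e ` K) = D} = 0" if D: "D \<le> 3 / 2"
  proof -
    \<comment> \<open>This is where 3/2 enters: it is the solution of D = 1 + D/3, so below it the
      minimum equals D.\<close>
    have "D \<le> 1 + D / 3"
    proof (cases D)
      case (real D')
      have "(3 / 2 :: ennreal) = ennreal (3 / 2)" by (simp add: divide_ennreal flip: ennreal_numeral)
      then have "D' \<le> 3 / 2" using D real by (simp add: ennreal_le_iff)
      then have le: "ennreal D' \<le> ennreal (1 + D' / 3)" by (intro ennreal_leI) simp
      have "1 + D / 3 = ennreal (1 + D' / 3)"
        using real by (simp add: divide_ennreal flip: ennreal_numeral ennreal_1 ennreal_plus)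
      then show ?thesis using le real(2) by (simp only:)
    next
      case top
      then show ?thesis using D by (simp add: top_unique divide_ennreal flip: ennreal_numeral)
    qed
    have "{e \<in> sphere 0 1 \<inter> W. \<not> hausdorff_dim (proj_perp e ` K) = D} \<subseteq> Bad"
    proof
      fix e assume e: "e \<in> {e \<in> sphere 0 1 \<inter> W. \<not> hausdorff_dim (proj_perp e ` K) = D}"
      then have norm: "norm e = 1" by simp
      \<comment> \<open>Projections do not increase distances, so the upper bound on the dimension
        holds for every unit vector and only the lower bound can fail.\<close>
      have "dist (proj_perp e x) (proj_perp e y) \<le> dist x y" for x y
      proof -
        define w where "w = x - y"
        have "proj_perp e x - proj_perp e y = w - (w \<bullet> e) *\<^sub>R e"
          by (simp add: proj_perp_eq[OF norm] w_def inner_diff_left scaleR_left_diff_distrib)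
        moreover have "(w - (w \<bullet> e) *\<^sub>R e) \<bullet> (w - (w \<bullet> e) *\<^sub>R e) = w \<bullet> w - (w \<bullet> e)\<^sup>2"
          using norm by (simp add: norm_eq_1 inner_diff_left inner_diff_right inner_commute power2_eq_square)
        ultimately show ?thesis by (simp add: dist_norm norm_le w_def)
      qed
      then have "hausdorff_dim (proj_perp e ` K) \<le> D"
        unfolding D_def by (rule hausdorff_dim_contraction_le)
      then have "\<not> D \<le> hausdorff_dim (proj_perp e ` K)" using e by auto
      then show "e \<in> Bad" using e \<open>D \<le> 1 + D / 3\<close> by (auto simp: Bad_def min_def)
    qed
    then show ?thesis using bad by (rule hausdorff_measure_null_mono)
  qed
  then show ?thesis using bad unfolding Bad_def D_def by blast
qed

end
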